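(* Let $V$ be an $\mathrm{FI}$-module over a commutative ring $\Bbbk$ which is generated in degree $\leqslant k$ and related in degree $\leqslant d$, where $k,d\in\mathbb{Z}_+$. Let $$\mathrm{hd}_1^D(V):=\max\{\mathrm{hd}_1(D^iV)+i \mid i=0,1,\ldots,k\},\qquad \mathrm{td}^D(V):=\max\{\mathrm{td}(D^iV)+i\mid i=0,1,\ldots,k\}.$$ Then $$\mathrm{td}(V)\leqslant \min\{k,d\}+d-1,$$ $$\mathrm{reg}(V)\leqslant \max\{\mathrm{hd}_1^D(V)-1,\ \mathrm{td}^D(V)\},$$ $$\max\{\mathrm{hd}_1^D(V)-1,\ \mathrm{td}^D(V)\}\leqslant \min\{k,d\}+d-1.$$ In particular, $$\mathrm{reg}(V)\leqslant \min\{k,d\}+d-1.$$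
   Context: $\Bbbk$ is a commutative ring and $\mathbb{Z}_+$ is the set of non-negative integers. $\mathrm{FI}$ is the category whose objects are finite sets and whose morphisms are injective maps. An $\mathrm{FI}$-module is a functor $V$ from $\mathrm{FI}$ to the category of $\Bbbk$-modules; write $V_X$ for $V(X)$ and $f_*$ for the map induced by an injection $f$. FI-modules form an abelian category (exactness computed objectwise); "projective" means projective object in this category. For $n\in\mathbb{Z}_+$, $\mathbf{n}=\{1,\ldots,n\}$ ($\mathbf 0=\emptyset$). The supremum of an empty set is $-\infty$ and the infimum of an empty set is $\infty$. FI-homology: for an $\mathrm{FI}$-module $V$, let $(JV)_X\subset V_X$ be the span of the images of $f_*:V_Y\to V_X$ for all injections $f:Y\to X$ with $|Y|<|X|$; $F(V):=V/JV$ is a right exact functor on $\mathrm{FI}$-modules, and $H_a$ ($a\in\mathbb{Z}_+$) is its $a$-th left derived functor. Shift and derivative: fix a one-element set $\{\star\}$; $SV$ is the $\mathrm{FI}$-module with $(SV)_X=V_{X\sqcup\{\star\}}$ and with an injection $f$ acting through $f\sqcup\mathrm{id}_{\{\star\}}$. The natural homomorphism $\iota:V\to SV$ is induced by the inclusions $X\hookrightarrow X\sqcup\{\star\}$. $DV$ is the cokernel of $\iota:V\to SV$; $D$ is a functor, the derivative functor, and $D^i$ is its $i$-fold iterate. Degrees: $\deg(V):=\sup\{n\in\mathbb{Z}_+\mid V_{\mathbf n}\neq0\}$; $\mathrm{hd}_a(V):=\deg H_a(V)$; $\mathrm{reg}(V)$ is the infimum of the set of all $c\in\mathbb{Z}$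 such that $\mathrm{hd}_a(V)\leqslant c+a$ for every integer $a\geqslant1$; $\mathrm{td}(V)$ is the supremum of all $n\in\mathbb{Z}_+$ for which there is a nonzero $v\in V_{\mathbf n}$ with $f_*(v)=0$ for every injection $f:\mathbf n\to\mathbf{n+1}$. $V$ is generated in degree $\leqslant k$ if $\mathrm{hd}_0(V)\leqslant k$. $V$ is generated in degree $\leqslant k$ and related in degree $\leqslant d$ if there is a short exact sequence $0\to W\to P\to V\to0$ of $\mathrm{FI}$-modules where $P$ is projective and generated in degree $\leqslant k$ and $W$ is generated in degree $\leqslant d$. *)

theory Defs
  imports
    "HOL-Algebra.Module"
    "HOL-Algebra.AbelCoset"
    "HOL-Library.FuncSet"
    "HOL-Library.Extended_Real"
begin

section \<open>FI-modules\<close>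

text \<open>
  FI is represented by its equivalent small full subcategory of finite sets of natural numbers.
  Morphisms are extensional functions, so that they are determined by their values on the source.
\<close>

definition fi_hom :: "nat set \<Rightarrow> nat set \<Rightarrow> (nat \<Rightarrow> nat) set" where
  "fi_hom X Y = {f \<in> X \<rightarrow>\<^sub>E Y. inj_on f X}"

definition linear_maps ::
  "('a, 'x) ring_scheme \<Rightarrow> ('a, 'b) module \<Rightarrow> ('a, 'c) module \<Rightarrow> ('b \<Rightarrow> 'c) set" where
  "linear_maps R M N = {h \<in> carrier M \<rightarrow> carrier N.
     (\<forall>x\<in>carrier M. \<forall>y\<in>carrier M. h (x \<oplus>\<^bsub>M\<^esub> y) = h x \<oplus>\<^bsub>N\<^esub> h y) \<and>
     (\<forall>r\<in>carrier R. \<forall>x\<in>carrier M. h (r \<odot>\<^bsub>M\<^esub> x) = r \<odot>\<^bsub>N\<^esub> h x)}"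

text \<open>\<^term>\<open>fi_act V X Y f\<close> is the map induced by \<^term>\<open>f \<in> fi_hom X Y\<close>.\<close>

record ('a, 'b) fi_mod =
  fi_obj :: "nat set \<Rightarrow> ('a, 'b) module"
  fi_act :: "nat set \<Rightarrow> nat set \<Rightarrow> (nat \<Rightarrow> nat) \<Rightarrow> 'b \<Rightarrow> 'b"

locale fi_module = cring R
  for R :: "('a, 'x) ring_scheme" (structure) and V :: "('a, 'b) fi_mod" +
  assumes obj_module: "finite X \<Longrightarrow> Module.module R (fi_obj V X)"
    and act_linear: "\<lbrakk>finite X; finite Y; f \<in> fi_hom X Y\<rbrakk>
      \<Longrightarrow> fi_act V X Y f \<in> linear_maps R (fi_obj V X) (fi_obj V Y)"
    and act_id: "\<lbrakk>finite X; v \<in> carrier (fi_obj V X)\<rbrakk> \<Longrightarrow> fi_act V X X (\<lambda>x\<in>X. x) v = v"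
    and act_compose: "\<lbrakk>finite X; finite Y; finite Z; f \<in> fi_hom X Y; g \<in> fi_hom Y Z;
        v \<in> carrier (fi_obj V X)\<rbrakk>
      \<Longrightarrow> fi_act V X Z (compose X g f) v = fi_act V Y Z g (fi_act V X Y f v)"

type_synonym ('b, 'c) fi_map = "nat set \<Rightarrow> 'b \<Rightarrow> 'c"

definition fi_morphisms ::
  "('a, 'x) ring_scheme \<Rightarrow> ('a, 'b) fi_mod \<Rightarrow> ('a, 'c) fi_mod \<Rightarrow> ('b, 'c) fi_map set" where
  "fi_morphisms R V W = {\<phi>.
     (\<forall>X. finite X \<longrightarrow> \<phi> X \<in> linear_maps R (fi_obj V X) (fi_obj W X)) \<and>
     (\<forall>X Y f. finite X \<and> finite Y \<and> f \<in> fi_hom X Y \<longrightarrow>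
        (\<forall>v\<in>carrier (fi_obj V X). \<phi> Y (fi_act V X Y f v) = fi_act W X Y f (\<phi> X v)))}"

definition fi_kernel :: "('a, 'b) fi_mod \<Rightarrow> ('a, 'c) fi_mod \<Rightarrow> ('b, 'c) fi_map \<Rightarrow> nat set \<Rightarrow> 'b set" where
  "fi_kernel V W \<phi> X = {v \<in> carrier (fi_obj V X). \<phi> X v = \<zero>\<^bsub>fi_obj W X\<^esub>}"

definition fi_image :: "('a, 'b) fi_mod \<Rightarrow> ('b, 'c) fi_map \<Rightarrow> nat set \<Rightarrow> 'c set" where
  "fi_image V \<phi> X = \<phi> X ` carrier (fi_obj V X)"

definition fi_mono :: "('a, 'b) fi_mod \<Rightarrow> ('b, 'c) fi_map \<Rightarrow> bool" where
  "fi_mono V \<phi> \<longleftrightarrow> (\<forall>X. finite X \<longrightarrow> inj_on (\<phi> X) (carrier (fi_obj V X)))"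

definition fi_epi :: "('a, 'b) fi_mod \<Rightarrow> ('a, 'c) fi_mod \<Rightarrow> ('b, 'c) fi_map \<Rightarrow> bool" where
  "fi_epi V W \<phi> \<longleftrightarrow> (\<forall>X. finite X \<longrightarrow> fi_image V \<phi> X = carrier (fi_obj W X))"

definition fi_exact ::
  "('a, 'b) fi_mod \<Rightarrow> ('b, 'c) fi_map \<Rightarrow> ('a, 'c) fi_mod \<Rightarrow> ('c, 'd) fi_map \<Rightarrow> ('a, 'd) fi_mod \<Rightarrow> bool"
  where
  "fi_exact U \<phi> V \<psi> W \<longleftrightarrow> (\<forall>X. finite X \<longrightarrow> fi_image U \<phi> X = fi_kernel V W \<psi> X)"

definition fi_short_exact ::
  "('a, 'x) ring_scheme \<Rightarrow> ('a, 'b) fi_mod \<Rightarrow> ('b, 'c) fi_map \<Rightarrow> ('a, 'c) fi_mod \<Rightarrow> ('c, 'd) fi_map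
    \<Rightarrow> ('a, 'd) fi_mod \<Rightarrow> bool" where
  "fi_short_exact R U \<phi> V \<psi> W \<longleftrightarrow>
     fi_module R U \<and> fi_module R V \<and> fi_module R W \<and>
     \<phi> \<in> fi_morphisms R U V \<and> \<psi> \<in> fi_morphisms R V W \<and>
     fi_mono U \<phi> \<and> fi_exact U \<phi> V \<psi> W \<and> fi_epi V W \<psi>"


section \<open>Subobjects and quotients\<close>

definition fi_sub :: "('a, 'b) fi_mod \<Rightarrow> (nat set \<Rightarrow> 'b set) \<Rightarrow> ('a, 'b) fi_mod" where
  "fi_sub V N = V\<lparr>fi_obj := (\<lambda>X. (fi_obj V X)\<lparr>carrier := N X\<rparr>)\<rparr>"

text \<open>
  A quotient module is carried by one chosen representative of each coset. Its elements thus have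
  the same type as those of the module, and constructions involving quotients can be iterated.
\<close>

definition coset_rep :: "('a, 'b) module \<Rightarrow> 'b set \<Rightarrow> 'b \<Rightarrow> 'b" where
  "coset_rep M N x = (SOME y. y \<in> N +>\<^bsub>M\<^esub> x)"

definition quot_module :: "('a, 'b) module \<Rightarrow> 'b set \<Rightarrow> ('a, 'b) module" where
  "quot_module M N = M\<lparr>
     carrier := coset_rep M N ` carrier M,
     zero := coset_rep M N \<zero>\<^bsub>M\<^esub>,
     add := (\<lambda>x y. coset_rep M N (x \<oplus>\<^bsub>M\<^esub> y)),
     smult := (\<lambda>r x. coset_rep M N (r \<odot>\<^bsub>M\<^esub> x))\<rparr>"

definition fi_quot :: "('a, 'b) fi_mod \<Rightarrow> (nat set \<Rightarrow> 'b set) \<Rightarrow> ('a, 'b) fi_mod" where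
  "fi_quot V N = \<lparr>
     fi_obj = (\<lambda>X. quot_module (fi_obj V X) (N X)),
     fi_act = (\<lambda>X Y f v. coset_rep (fi_obj V Y) (N Y) (fi_act V X Y f v))\<rparr>"


section \<open>Projective FI-modules and FI-homology\<close>

datatype ('a, 'b) fi_univ = Elt 'b | Comb "('a \<times> nat list \<times> ('a, 'b) fi_univ) list"

text \<open>
  This type is a universe of elements. It contains a copy of every FI-module over \<^typ>\<open>'b\<close>, and
  it is closed under submodules, quotients and free covers: if \<open>V\<close> has elements in
  \<^typ>\<open>('a, 'b) fi_univ\<close>, there is a free FI-module mapping onto \<open>V\<close> whose elements over \<open>X\<close> are the
  formal combinations of pairs of an injection \<open>f : {1..n} \<rightarrow> X\<close> and an element \<open>v\<close> of \<open>V\<close> over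
  \<open>{1..n}\<close>. Choosing one expression for each combination as a term \<open>Comb\<close>, whose entries are a
  coefficient, the list of values of \<open>f\<close>, and \<open>v\<close>, this module has its elements in
  \<^typ>\<open>('a, 'b) fi_univ\<close> again. So resolutions exist within the universe.
\<close>

text \<open>
  Test objects of the lifting property are taken in the universe over the element type of \<open>P\<close>.
  It contains a copy of \<open>P\<close> and a free FI-module mapping onto that copy, so that lifting the
  identity already exhibits \<open>P\<close> as a direct summand of a free FI-module.
\<close>

definition fi_projective :: "('a, 'x) ring_scheme \<Rightarrow> ('a, 'b) fi_mod \<Rightarrow> bool" where
  "fi_projective R P \<longleftrightarrow> fi_module R P \<and>
     (\<forall>(A :: ('a, ('a, 'b) fi_univ) fi_mod) (B :: ('a, ('a, 'b) fi_univ) fi_mod) \<pi> \<psi>.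
        fi_module R A \<and> fi_module R B \<and> \<pi> \<in> fi_morphisms R A B \<and> fi_epi A B \<pi> \<and>
        \<psi> \<in> fi_morphisms R P B \<longrightarrow>
        (\<exists>\<chi>\<in>fi_morphisms R P A. \<forall>X. finite X \<longrightarrow>
           (\<forall>v\<in>carrier (fi_obj P X). \<pi> X (\<chi> X v) = \<psi> X v)))"

text \<open>The differential \<^term>\<open>d n\<close> goes from \<^term>\<open>P (Suc n)\<close> to \<^term>\<open>P n\<close>.\<close>

definition fi_projective_resolution ::
  "('a, 'x) ring_scheme \<Rightarrow> (nat \<Rightarrow> ('a, 'c) fi_mod) \<Rightarrow> (nat \<Rightarrow> ('c, 'c) fi_map) \<Rightarrow> ('c, 'b) fi_map
    \<Rightarrow> ('a, 'b) fi_mod \<Rightarrow> bool" where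
  "fi_projective_resolution R P d \<epsilon> V \<longleftrightarrow>
     (\<forall>n. fi_projective R (P n)) \<and>
     (\<forall>n. d n \<in> fi_morphisms R (P (Suc n)) (P n)) \<and>
     \<epsilon> \<in> fi_morphisms R (P 0) V \<and>
     fi_epi (P 0) V \<epsilon> \<and>
     fi_exact (P 1) (d 0) (P 0) \<epsilon> V \<and>
     (\<forall>n. fi_exact (P (Suc (Suc n))) (d (Suc n)) (P (Suc n)) (d n) (P n))"

definition fi_complex_homology ::
  "(nat \<Rightarrow> ('a, 'c) fi_mod) \<Rightarrow> (nat \<Rightarrow> ('c, 'c) fi_map) \<Rightarrow> nat \<Rightarrow> ('a, 'c) fi_mod" where
  "fi_complex_homology C d a =
     fi_quot
       (case a of
          0 \<Rightarrow> C 0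
        | Suc m \<Rightarrow> fi_sub (C (Suc m)) (fi_kernel (C (Suc m)) (C m) (d m)))
       (fi_image (C (Suc a)) (d a))"

definition fi_J :: "('a, 'x) ring_scheme \<Rightarrow> ('a, 'b) fi_mod \<Rightarrow> nat set \<Rightarrow> 'b set" where
  "fi_J R V X = \<Inter>{N. submodule N R (fi_obj V X) \<and>
     (\<forall>Y f. finite Y \<and> card Y < card X \<and> f \<in> fi_hom Y X \<longrightarrow>
        fi_act V Y X f ` carrier (fi_obj V Y) \<subseteq> N)}"

definition fi_F :: "('a, 'x) ring_scheme \<Rightarrow> ('a, 'b) fi_mod \<Rightarrow> ('a, 'b) fi_mod" where
  "fi_F R V = fi_quot V (fi_J R V)"

definition fi_F_map ::
  "('a, 'x) ring_scheme \<Rightarrow> ('a, 'c) fi_mod \<Rightarrow> ('b, 'c) fi_map \<Rightarrow> ('b, 'c) fi_map" where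
  "fi_F_map R W \<phi> = (\<lambda>X v. coset_rep (fi_obj W X) (fi_J R W X) (\<phi> X v))"

text \<open>
  The left derived functors of \<^const>\<open>fi_F\<close>, computed on a chosen projective resolution.
\<close>

definition fi_homology ::
  "('a, 'x) ring_scheme \<Rightarrow> nat \<Rightarrow> ('a, 'b) fi_mod \<Rightarrow> ('a, ('a, 'b) fi_univ) fi_mod" where
  "fi_homology R a V =
     (let (P, d, \<epsilon>) = (SOME (P, d, \<epsilon>). fi_projective_resolution R P d \<epsilon> V)
      in fi_complex_homology (\<lambda>n. fi_F R (P n)) (\<lambda>n. fi_F_map R (P n) (d n)) a)"


section \<open>Shift and derivative\<close>

text \<open>
  The disjoint union of \<open>X\<close> with a one-element set is \<^term>\<open>insert 0 (Suc ` X)\<close>: the added point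
  is \<^term>\<open>0::nat\<close>, and \<open>X\<close> is included via \<^term>\<open>Suc\<close>.
\<close>

definition add_star :: "nat set \<Rightarrow> nat set" where
  "add_star X = insert 0 (Suc ` X)"

definition add_star_map :: "nat set \<Rightarrow> (nat \<Rightarrow> nat) \<Rightarrow> nat \<Rightarrow> nat" where
  "add_star_map X f = (\<lambda>i\<in>add_star X. case i of 0 \<Rightarrow> 0 | Suc j \<Rightarrow> Suc (f j))"

definition fi_shift :: "('a, 'b) fi_mod \<Rightarrow> ('a, 'b) fi_mod" where
  "fi_shift V = \<lparr>
     fi_obj = (\<lambda>X. fi_obj V (add_star X)),
     fi_act = (\<lambda>X Y f. fi_act V (add_star X) (add_star Y) (add_star_map X f))\<rparr>"

definition fi_iota :: "('a, 'b) fi_mod \<Rightarrow> ('b, 'b) fi_map" where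
  "fi_iota V X = fi_act V X (add_star X) (\<lambda>x\<in>X. Suc x)"

definition fi_deriv :: "('a, 'b) fi_mod \<Rightarrow> ('a, 'b) fi_mod" where
  "fi_deriv V = fi_quot (fi_shift V) (fi_image V (fi_iota V))"


section \<open>Degrees\<close>

definition fi_deg :: "('a, 'b) fi_mod \<Rightarrow> ereal" where
  "fi_deg V = Sup {ereal (real n) |n. carrier (fi_obj V {1..n}) \<noteq> {\<zero>\<^bsub>fi_obj V {1..n}\<^esub>}}"

definition fi_hd :: "('a, 'x) ring_scheme \<Rightarrow> nat \<Rightarrow> ('a, 'b) fi_mod \<Rightarrow> ereal" where
  "fi_hd R a V = fi_deg (fi_homology R a V)"

definition fi_reg :: "('a, 'x) ring_scheme \<Rightarrow> ('a, 'b) fi_mod \<Rightarrow> ereal" where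
  "fi_reg R V = Inf {ereal (real_of_int c) |c. \<forall>a\<ge>1. fi_hd R a V \<le> ereal (real_of_int c + real a)}"

definition fi_td :: "('a, 'b) fi_mod \<Rightarrow> ereal" where
  "fi_td V = Sup {ereal (real n) |n.
     \<exists>v\<in>carrier (fi_obj V {1..n}). v \<noteq> \<zero>\<^bsub>fi_obj V {1..n}\<^esub> \<and>
       (\<forall>f\<in>fi_hom {1..n} {1..n+1}. fi_act V {1..n} {1..n+1} f v = \<zero>\<^bsub>fi_obj V {1..n+1}\<^esub>)}"

definition fi_hd1_D :: "('a, 'x) ring_scheme \<Rightarrow> nat \<Rightarrow> ('a, 'b) fi_mod \<Rightarrow> ereal" where
  "fi_hd1_D R k V = Max ((\<lambda>i. fi_hd R 1 ((fi_deriv ^^ i) V) + ereal (real i)) ` {0..k})"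

definition fi_td_D :: "nat \<Rightarrow> ('a, 'b) fi_mod \<Rightarrow> ereal" where
  "fi_td_D k V = Max ((\<lambda>i. fi_td ((fi_deriv ^^ i) V) + ereal (real i)) ` {0..k})"

definition fi_generated_in_degree_le :: "('a, 'x) ring_scheme \<Rightarrow> nat \<Rightarrow> ('a, 'b) fi_mod \<Rightarrow> bool" where
  "fi_generated_in_degree_le R k V \<longleftrightarrow> fi_hd R 0 V \<le> ereal (real k)"

definition fi_presentation ::
  "('a, 'x) ring_scheme \<Rightarrow> nat \<Rightarrow> nat \<Rightarrow> ('a, 'b) fi_mod \<Rightarrow> ('b, 'c) fi_map \<Rightarrow> ('a, 'c) fi_mod
    \<Rightarrow> ('c, 'd) fi_map \<Rightarrow> ('a, 'd) fi_mod \<Rightarrow> bool" where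
  "fi_presentation R k d W \<phi> P \<psi> V \<longleftrightarrow>
     fi_short_exact R W \<phi> P \<psi> V \<and> fi_projective R P \<and>
     fi_generated_in_degree_le R k P \<and> fi_generated_in_degree_le R d W"

end

theory Submission
  imports Defs
begin

text \<open>
  Let \<open>K V\<close> be the kernel of \<open>\<iota> : V \<rightarrow> S V\<close>. Since \<open>F D = S F\<close> and the only higher derived functor
  of \<open>D\<close> is \<open>L\<^sub>1 D = K\<close>, there is an exact sequence
  \<open>H\<^sub>a\<^sub>+\<^sub>1(D V) \<rightarrow> H\<^sub>a\<^sub>-\<^sub>1(K V) \<rightarrow> S H\<^sub>a(V) \<rightarrow> H\<^sub>a(D V) \<rightarrow> H\<^sub>a\<^sub>-\<^sub>2(K V)\<close>. All non-bijective injections vanish on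
  \<open>K V\<close>, so \<open>H\<^sub>0(K V) = K V\<close> and \<open>H\<^sub>a(K V)\<close> has degree at most \<open>td(V) + a\<close>. Hence
  \<open>td(V) \<le> max(hd\<^sub>2(D V), hd\<^sub>1(V) - 1)\<close> and \<open>hd\<^sub>a(V) \<le> max(td(V) + a, hd\<^sub>a(D V) + 1)\<close>. Since \<open>D\<close> lowers the degrees
  of generators and relations by one, both bounds on \<open>td\<close> and \<open>reg\<close> follow by induction on the degree of
  generation, starting at \<open>V = 0\<close>; the second one alone gives \<open>reg(V) \<le> td\<^sup>D(V)\<close>.

  To make the exact sequence elementary, vanishing of homology is read off the Koszul complex, whose value
  at \<open>X \<union> {\<star>}\<close> is the cone of the map induced by \<open>\<iota>\<close> on the complexes of \<open>V\<close> and \<open>S V\<close> at \<open>X\<close>. It computes the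
  derived functors of \<open>F\<close> by dimension shifting, because it is exact in positive degrees on projectives: a
  projective is a retract of a free FI-module, so \<open>\<iota>\<close> has a natural retraction, and this property passes to \<open>D\<close>.
\<close>

text \<open>The constant comes from one count: \<open>min k d + d - 1\<close> drops by exactly 2
  when k and d both drop by one, and 2 is the cost of using hd_2(D V) <= reg(D V) + 2 in the bound
  for td(V). The minimum appears because the count ends either at V = 0 or when the relation bound
  becomes negative. In the latter case H_1 vanishes in every degree, and the same induction removes
  torsion and higher homology with no restriction on degrees. The obstacle is that iota has a
  kernel, so passing to D V yields no short exact sequence of complexes. Exactness for D V is
  therefore expressed by relative cycles in the complexes of S V and V, a condition that makes sense
  for a noninjective iota and is what a mapping cone produces. Derived functors enter through two
  implications only: exactness of the Koszul complex in degree a >= 1 forces H_a to vanish on sets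
  of that size, and vanishing of H_0 forces generation from smaller sets. The first serves the
  conclusions, the second reads the hypotheses; no isomorphism between the two homologies is
  built.\<close>

text \<open>Additivity is kept apart from \<open>linear_maps\<close> because the groups of the
  Koszul complex carry no scalar action.\<close>

definition add_homs :: "('b, 'm) ring_scheme \<Rightarrow> ('c, 'n) ring_scheme \<Rightarrow> ('b \<Rightarrow> 'c) set" where
  "add_homs G H = {h \<in> carrier G \<rightarrow> carrier H.
     \<forall>x\<in>carrier G. \<forall>y\<in>carrier G. h (x \<oplus>\<^bsub>G\<^esub> y) = h x \<oplus>\<^bsub>H\<^esub> h y}"

lemma add_homsI:
  assumes "\<And>x. x \<in> carrier G \<Longrightarrow> h x \<in> carrier H"
    and "\<And>x y. x \<in> carrier G \<Longrightarrow> y \<in> carrier G \<Longrightarrow> h (x \<oplus>\<^bsub>G\<^esub> y) = h x \<oplus>\<^bsub>H\<^esub> h y"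
  shows "h \<in> add_homs G H"
  using assms by (auto simp: add_homs_def)

lemma add_homs_closed: "h \<in> add_homs G H \<Longrightarrow> x \<in> carrier G \<Longrightarrow> h x \<in> carrier H"
  by (auto simp: add_homs_def)

lemma add_homs_add:
  "h \<in> add_homs G H \<Longrightarrow> x \<in> carrier G \<Longrightarrow> y \<in> carrier G \<Longrightarrow> h (x \<oplus>\<^bsub>G\<^esub> y) = h x \<oplus>\<^bsub>H\<^esub> h y"
  by (auto simp: add_homs_def)

lemma add_homs_zero:
  assumes h: "h \<in> add_homs G H" and "abelian_group G" "abelian_group H"
  shows "h \<zero>\<^bsub>G\<^esub> = \<zero>\<^bsub>H\<^esub>"
proof -
  interpret G: abelian_group G by fact
  interpret H: abelian_group H by fact
  have "h \<zero>\<^bsub>G\<^esub> \<oplus>\<^bsub>H\<^esub> h \<zero>\<^bsub>G\<^esub> = h \<zero>\<^bsub>G\<^esub>"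
    using add_homs_add[OF h G.zero_closed G.zero_closed] by simp
  then show ?thesis
    using add_homs_closed[OF h G.zero_closed] H.add.r_cancel_one' by metis
qed

lemma add_homs_neg:
  assumes h: "h \<in> add_homs G H" and "abelian_group G" "abelian_group H" and x: "x \<in> carrier G"
  shows "h (\<ominus>\<^bsub>G\<^esub> x) = \<ominus>\<^bsub>H\<^esub> h x"
proof -
  interpret G: abelian_group G by fact
  interpret H: abelian_group H by fact
  have "h (\<ominus>\<^bsub>G\<^esub> x) \<oplus>\<^bsub>H\<^esub> h x = \<zero>\<^bsub>H\<^esub>"
    using add_homs_add[OF h, of "\<ominus>\<^bsub>G\<^esub> x" x] x add_homs_zero[OF assms(1-3)] by (simp add: G.l_neg)
  then show ?thesis
    using x add_homs_closed[OF h] H.minus_equality by (metis G.a_inv_closed)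
qed

lemma (in abelian_group) sum_zero_iff:
  "x \<in> carrier G \<Longrightarrow> y \<in> carrier G \<Longrightarrow> x \<oplus> y = \<zero> \<longleftrightarrow> x = \<ominus> y"
  using add.inv_equality add.l_inv by blast

lemma (in abelian_group) eq_add_iff:
  "x \<in> carrier G \<Longrightarrow> y \<in> carrier G \<Longrightarrow> z \<in> carrier G \<Longrightarrow> x = y \<oplus> z \<longleftrightarrow> x \<oplus> \<ominus> y = z"
  by (metis a_comm a_inv_closed r_neg1 r_neg2)

lemma linear_maps_add_homs: "h \<in> linear_maps R M N \<Longrightarrow> h \<in> add_homs M N"
  by (auto simp: linear_maps_def add_homs_def)

lemma linear_maps_smult:
  "h \<in> linear_maps R M N \<Longrightarrow> r \<in> carrier R \<Longrightarrow> x \<in> carrier M \<Longrightarrow> h (r \<odot>\<^bsub>M\<^esub> x) = r \<odot>\<^bsub>N\<^esub> h x"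
  by (auto simp: linear_maps_def)

lemma linear_mapsI:
  assumes "h \<in> add_homs M N"
    and "\<And>r x. r \<in> carrier R \<Longrightarrow> x \<in> carrier M \<Longrightarrow> h (r \<odot>\<^bsub>M\<^esub> x) = r \<odot>\<^bsub>N\<^esub> h x"
  shows "h \<in> linear_maps R M N"
  using assms by (auto simp: linear_maps_def add_homs_def)

lemma linear_maps_comp:
  assumes "h \<in> linear_maps R L M" "k \<in> linear_maps R M N"
  shows "(\<lambda>x. k (h x)) \<in> linear_maps R L N"
  using assms by (auto simp: linear_maps_def Pi_iff)

section \<open>Finite sets and injections\<close>

lemma fi_homI:
  "(\<And>x. x \<in> X \<Longrightarrow> f x \<in> Y) \<Longrightarrow> inj_on f X \<Longrightarrow> (\<lambda>x\<in>X. f x) \<in> fi_hom X Y"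
  by (auto simp: fi_hom_def inj_on_def)

lemma fi_hom_mem: "f \<in> fi_hom X Y \<Longrightarrow> x \<in> X \<Longrightarrow> f x \<in> Y"
  by (auto simp: fi_hom_def)

lemma fi_hom_inj: "f \<in> fi_hom X Y \<Longrightarrow> inj_on f X"
  by (auto simp: fi_hom_def)

lemma fi_hom_compose: "f \<in> fi_hom X Y \<Longrightarrow> g \<in> fi_hom Y Z \<Longrightarrow> compose X g f \<in> fi_hom X Z"
  by (auto simp: fi_hom_def compose_def inj_on_def Pi_iff PiE_iff)

lemma fi_hom_eqI:
  assumes "f \<in> fi_hom X Y" "g \<in> fi_hom X Z" "\<And>x. x \<in> X \<Longrightarrow> f x = g x"
  shows "f = g"
  using assms by (auto simp: fi_hom_def PiE_iff intro: extensionalityI[of f X])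

lemma fi_hom_card: "f \<in> fi_hom X Y \<Longrightarrow> finite Y \<Longrightarrow> card X \<le> card Y"
  by (auto simp: fi_hom_def intro: card_inj_on_le)

text \<open>Degrees are read off on \<open>{1..n}\<close>, the Koszul complex lives on
  \<open>{0..<n}\<close>, and homology is taken on any finite set; functoriality along such a pair
  moves statements between them.\<close>

lemma ex_fi_iso:
  assumes "finite X" "finite Y" "card X = card Y"
  obtains f g where "f \<in> fi_hom X Y" "g \<in> fi_hom Y X"
    "compose X g f = (\<lambda>x\<in>X. x)" "compose Y f g = (\<lambda>y\<in>Y. y)"
proof -
  obtain h where h: "bij_betw h X Y"
    using assms finite_same_card_bij by blast
  let ?f = "\<lambda>x\<in>X. h x" and ?g = "\<lambda>y\<in>Y. inv_into X h y"
  have hX: "h ` X = Y" "inj_on h X" using h by (auto simp: bij_betw_def)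
  have "?f \<in> fi_hom X Y" using hX by (intro fi_homI) auto
  moreover have "?g \<in> fi_hom Y X"
    using hX by (intro fi_homI) (auto intro: inv_into_into inj_on_inv_into)
  moreover have "compose X ?g ?f = (\<lambda>x\<in>X. x)" "compose Y ?f ?g = (\<lambda>y\<in>Y. y)"
    using hX by (auto simp: compose_def fun_eq_iff f_inv_into_f inv_into_into)
  ultimately show ?thesis by (rule that)
qed

section \<open>Adjoining a point to a set and to an injection\<close>

lemma finite_add_star [simp]: "finite (add_star X) \<longleftrightarrow> finite X"
  by (auto simp: add_star_def dest: finite_imageD)

lemma card_add_star [simp]: "finite X \<Longrightarrow> card (add_star X) = Suc (card X)"
  by (simp add: add_star_def card_image)

text \<open>The reason for working on \<open>{0..<n}\<close>: adjoining a point gives the next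
  initial segment on the nose, so recursion on n involves no bijections.\<close>

lemma add_star_atLeastLessThan [simp]: "add_star {0..<n} = {0..<Suc n}"
  by (simp add: add_star_def atLeast0_lessThan_Suc_eq_insert_0)

lemma add_star_map_simps [simp]:
  "0 \<in> add_star X" "Suc x \<in> add_star X \<longleftrightarrow> x \<in> X"
  "add_star_map X f 0 = 0" "x \<in> X \<Longrightarrow> add_star_map X f (Suc x) = Suc (f x)"
  by (auto simp: add_star_map_def add_star_def)

lemma add_star_cases:
  assumes "x \<in> add_star X"
  obtains "x = 0" | y where "x = Suc y" "y \<in> X"
  using assms by (auto simp: add_star_def)

lemma add_star_ext:
  assumes "\<And>x. x \<notin> add_star X \<Longrightarrow> f x = g x" "f 0 = g 0" "\<And>x. x \<in> X \<Longrightarrow> f (Suc x) = g (Suc x)"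
  shows "f = g"
proof
  fix x show "f x = g x"
    using assms by (cases "x \<in> add_star X") (auto elim: add_star_cases)
qed

lemma add_star_map_outside: "x \<notin> add_star X \<Longrightarrow> add_star_map X f x = undefined"
  by (simp add: add_star_map_def)

lemma add_star_map_fi_hom:
  assumes f: "f \<in> fi_hom X Y"
  shows "add_star_map X f \<in> fi_hom (add_star X) (add_star Y)"
proof -
  have "add_star_map X f x \<in> add_star Y" if "x \<in> add_star X" for x
    using that by (cases rule: add_star_cases) (auto intro: fi_hom_mem[OF f])
  moreover have "inj_on (add_star_map X f) (add_star X)"
  proof (rule inj_onI)
    fix x y assume "x \<in> add_star X" "y \<in> add_star X" "add_star_map X f x = add_star_map X f y"
    then show "x = y"
      using inj_onD[OF fi_hom_inj[OF f]] by (elim add_star_cases) auto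
  qed
  ultimately show ?thesis
    by (auto simp: fi_hom_def PiE_iff extensional_def add_star_map_outside)
qed

lemma add_star_map_id: "add_star_map X (\<lambda>x\<in>X. x) = (\<lambda>x\<in>add_star X. x)"
  by (rule add_star_ext[where X = X]) (simp_all add: add_star_map_outside)

lemma add_star_map_compose:
  assumes "f \<in> fi_hom X Y"
  shows "add_star_map X (compose X g f) = compose (add_star X) (add_star_map Y g) (add_star_map X f)"
  by (rule add_star_ext[where X = X])
     (use fi_hom_mem[OF assms] in \<open>simp_all add: add_star_map_outside compose_def\<close>)

abbreviation succ_map :: "nat set \<Rightarrow> nat \<Rightarrow> nat" where
  "succ_map X \<equiv> (\<lambda>x\<in>X. Suc x)"

lemma succ_map_fi_hom: "succ_map X \<in> fi_hom X (add_star X)"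
  by (auto intro!: fi_homI)

lemma add_star_map_succ_map:
  "f \<in> fi_hom X Y \<Longrightarrow> compose X (add_star_map X f) (succ_map X) = compose X (succ_map Y) f"
  by (auto simp: fun_eq_iff compose_def dest: fi_hom_mem)

section \<open>The transposition of the two points added by a double shift\<close>

definition star_swap :: "nat set \<Rightarrow> nat \<Rightarrow> nat" where
  "star_swap X = (\<lambda>x\<in>add_star (add_star X). if x = 0 then 1 else if x = 1 then 0 else x)"

lemma star_swap_fi_hom: "star_swap X \<in> fi_hom (add_star (add_star X)) (add_star (add_star X))"
  unfolding star_swap_def by (rule fi_homI) (auto simp: add_star_def inj_on_def)

lemma star_swap_simps [simp]:
  "star_swap X 0 = Suc 0" "star_swap X (Suc 0) = 0"
  "x \<in> X \<Longrightarrow> star_swap X (Suc (Suc x)) = Suc (Suc x)"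
  by (simp_all add: star_swap_def)

lemma add_star2_ext:
  assumes "\<And>x. x \<notin> add_star (add_star X) \<Longrightarrow> f x = g x" "f 0 = g 0" "f (Suc 0) = g (Suc 0)"
    "\<And>x. x \<in> X \<Longrightarrow> f (Suc (Suc x)) = g (Suc (Suc x))"
  shows "f = g"
  by (rule add_star_ext[where X = "add_star X"]) (use assms in \<open>auto elim: add_star_cases\<close>)

lemma star_swap_natural:
  assumes "f \<in> fi_hom X Y"
  shows "compose (add_star (add_star X)) (star_swap Y) (add_star_map (add_star X) (add_star_map X f))
    = compose (add_star (add_star X)) (add_star_map (add_star X) (add_star_map X f)) (star_swap X)"
  by (rule add_star2_ext[where X = X]) (use fi_hom_mem[OF assms] in \<open>simp_all add: compose_def\<close>)

text \<open>The two embeddings of \<open>add_star X\<close> miss the point 0 and the point 1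
  respectively, hence the transposition exchanges them.\<close>

lemma star_swap_succ_map:
  "compose (add_star X) (star_swap X) (succ_map (add_star X)) = add_star_map X (succ_map X)"
  "compose (add_star X) (star_swap X) (add_star_map X (succ_map X)) = succ_map (add_star X)"
  by (rule add_star_ext[where X = X]; simp add: compose_def add_star_map_outside)+

section \<open>FI-modules and their morphisms\<close>

context fi_module
begin

lemma obj_group: "finite X \<Longrightarrow> abelian_group (fi_obj V X)"
  using obj_module[of X] by (simp add: Module.module_def)

lemma act_hom:
  "finite X \<Longrightarrow> finite Y \<Longrightarrow> f \<in> fi_hom X Y \<Longrightarrow> fi_act V X Y f \<in> add_homs (fi_obj V X) (fi_obj V Y)"
  by (rule linear_maps_add_homs[OF act_linear])

lemma act_closed:
  "finite X \<Longrightarrow> finite Y \<Longrightarrow> f \<in> fi_hom X Y \<Longrightarrow> v \<in> carrier (fi_obj V X) \<Longrightarrow>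
    fi_act V X Y f v \<in> carrier (fi_obj V Y)"
  by (rule add_homs_closed[OF act_hom])

lemma act_zero:
  "finite X \<Longrightarrow> finite Y \<Longrightarrow> f \<in> fi_hom X Y \<Longrightarrow> fi_act V X Y f \<zero>\<^bsub>fi_obj V X\<^esub> = \<zero>\<^bsub>fi_obj V Y\<^esub>"
  by (rule add_homs_zero[OF act_hom obj_group obj_group])

end

lemma fi_morphismsI:
  assumes "\<And>X. finite X \<Longrightarrow> \<phi> X \<in> linear_maps R (fi_obj V X) (fi_obj W X)"
    and "\<And>X Y f v. finite X \<Longrightarrow> finite Y \<Longrightarrow> f \<in> fi_hom X Y \<Longrightarrow> v \<in> carrier (fi_obj V X) \<Longrightarrow>
      \<phi> Y (fi_act V X Y f v) = fi_act W X Y f (\<phi> X v)"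
  shows "\<phi> \<in> fi_morphisms R V W"
  using assms by (auto simp: fi_morphisms_def)

lemma fi_morphisms_linear:
  "\<phi> \<in> fi_morphisms R V W \<Longrightarrow> finite X \<Longrightarrow> \<phi> X \<in> linear_maps R (fi_obj V X) (fi_obj W X)"
  by (auto simp: fi_morphisms_def)

lemma fi_morphisms_hom:
  "\<phi> \<in> fi_morphisms R V W \<Longrightarrow> finite X \<Longrightarrow> \<phi> X \<in> add_homs (fi_obj V X) (fi_obj W X)"
  by (rule linear_maps_add_homs[OF fi_morphisms_linear])

lemma fi_morphisms_closed:
  "\<phi> \<in> fi_morphisms R V W \<Longrightarrow> finite X \<Longrightarrow> v \<in> carrier (fi_obj V X) \<Longrightarrow> \<phi> X v \<in> carrier (fi_obj W X)"
  by (rule add_homs_closed[OF fi_morphisms_hom])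

lemma fi_morphisms_zero:
  "\<phi> \<in> fi_morphisms R V W \<Longrightarrow> fi_module R V \<Longrightarrow> fi_module R W \<Longrightarrow> finite X \<Longrightarrow>
    \<phi> X \<zero>\<^bsub>fi_obj V X\<^esub> = \<zero>\<^bsub>fi_obj W X\<^esub>"
  by (rule add_homs_zero[OF fi_morphisms_hom fi_module.obj_group fi_module.obj_group])

lemma fi_morphisms_natural:
  "\<phi> \<in> fi_morphisms R V W \<Longrightarrow> finite X \<Longrightarrow> finite Y \<Longrightarrow> f \<in> fi_hom X Y \<Longrightarrow> v \<in> carrier (fi_obj V X) \<Longrightarrow>
    \<phi> Y (fi_act V X Y f v) = fi_act W X Y f (\<phi> X v)"
  by (auto simp: fi_morphisms_def)

lemma fi_morphisms_comp:
  assumes "\<phi> \<in> fi_morphisms R U V" "\<psi> \<in> fi_morphisms R V W"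
  shows "(\<lambda>X v. \<psi> X (\<phi> X v)) \<in> fi_morphisms R U W"
  by (rule fi_morphismsI)
     (use assms in \<open>auto intro: linear_maps_comp fi_morphisms_linear
        simp: fi_morphisms_natural fi_morphisms_closed\<close>)

lemma fi_morphisms_shift:
  "\<phi> \<in> fi_morphisms R V W \<Longrightarrow> (\<lambda>X. \<phi> (add_star X)) \<in> fi_morphisms R (fi_shift V) (fi_shift W)"
  by (rule fi_morphismsI)
     (auto simp: fi_shift_def intro: fi_morphisms_linear fi_morphisms_natural add_star_map_fi_hom)

lemma fi_shift_simps [simp]:
  "fi_obj (fi_shift V) X = fi_obj V (add_star X)"
  "fi_act (fi_shift V) X Y f = fi_act V (add_star X) (add_star Y) (add_star_map X f)"
  by (simp_all add: fi_shift_def)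

lemma fi_shift_module:
  assumes "fi_module R V" shows "fi_module R (fi_shift V)"
proof -
  interpret fi_module R V by fact
  have "fi_act V (add_star X) (add_star Z) (add_star_map X (compose X g f)) v
      = fi_act V (add_star Y) (add_star Z) (add_star_map Y g)
          (fi_act V (add_star X) (add_star Y) (add_star_map X f) v)"
    if "finite X" "finite Y" "finite Z" "f \<in> fi_hom X Y" "g \<in> fi_hom Y Z"
      "v \<in> carrier (fi_obj V (add_star X))" for X Y Z f g v
    using act_compose[of "add_star X" "add_star Y" "add_star Z" "add_star_map X f"
        "add_star_map Y g" v] that
    by (simp add: add_star_map_fi_hom add_star_map_compose)
  note comp = this
  show ?thesis
  proof (rule fi_module.intro[OF cring_axioms], rule fi_module_axioms.intro, goal_cases)
    case (1 X) then show ?case by (simp add: obj_module)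
  next
    case (2 X Y f) then show ?case by (simp add: act_linear add_star_map_fi_hom)
  next
    case (3 X v) then show ?case by (simp add: act_id add_star_map_id)
  next
    case (4 X Y Z f g v) then show ?case using comp[OF 4(1-5)] by simp
  qed
qed

lemma fi_iota_morphism:
  assumes "fi_module R V" shows "fi_iota V \<in> fi_morphisms R V (fi_shift V)"
proof -
  interpret fi_module R V by fact
  show ?thesis
  proof (rule fi_morphismsI)
    fix X Y f v assume *: "finite X" "finite Y" "f \<in> fi_hom X Y" "v \<in> carrier (fi_obj V X)"
    show "fi_iota V Y (fi_act V X Y f v) = fi_act (fi_shift V) X Y f (fi_iota V X v)"
      using * by (simp add: fi_iota_def act_compose[symmetric] succ_map_fi_hom add_star_map_fi_hom
          add_star_map_succ_map)
  qed (auto simp: fi_iota_def act_linear succ_map_fi_hom)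
qed

lemma fi_iota_natural:
  assumes "\<phi> \<in> fi_morphisms R V W" "finite X" "v \<in> carrier (fi_obj V X)"
  shows "\<phi> (add_star X) (fi_iota V X v) = fi_iota W X (\<phi> X v)"
  using assms by (simp add: fi_iota_def fi_morphisms_natural succ_map_fi_hom)

definition fi_swap :: "('a, 'b) fi_mod \<Rightarrow> ('b, 'b) fi_map" where
  "fi_swap V X = fi_act V (add_star (add_star X)) (add_star (add_star X)) (star_swap X)"

lemma fi_swap_morphism:
  assumes "fi_module R V"
  shows "fi_swap V \<in> fi_morphisms R (fi_shift (fi_shift V)) (fi_shift (fi_shift V))"
proof -
  interpret fi_module R V by fact
  show ?thesis
  proof (rule fi_morphismsI)
    fix X Y f v assume *: "finite X" "finite Y" "f \<in> fi_hom X Y"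
      "v \<in> carrier (fi_obj (fi_shift (fi_shift V)) X)"
    then show "fi_swap V Y (fi_act (fi_shift (fi_shift V)) X Y f v)
      = fi_act (fi_shift (fi_shift V)) X Y f (fi_swap V X v)"
      by (simp add: fi_swap_def act_compose[symmetric] star_swap_fi_hom add_star_map_fi_hom
          star_swap_natural)
  qed (auto simp: fi_swap_def act_linear star_swap_fi_hom)
qed

text \<open>\<open>fi_iota V (add_star X)\<close> is the shift of iota, while
  \<open>fi_iota (fi_shift V) X\<close> is iota of the shift. They are different maps, and the swap
  mediates whenever an induction replaces V by S V or D V.\<close>

lemma fi_swap_iota:
  assumes "fi_module R V" "finite X" "v \<in> carrier (fi_obj V (add_star X))"
  shows "fi_swap V X (fi_iota V (add_star X) v) = fi_iota (fi_shift V) X v"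
    and "fi_swap V X (fi_iota (fi_shift V) X v) = fi_iota V (add_star X) v"
proof -
  interpret fi_module R V by fact
  show "fi_swap V X (fi_iota V (add_star X) v) = fi_iota (fi_shift V) X v"
    "fi_swap V X (fi_iota (fi_shift V) X v) = fi_iota V (add_star X) v"
    using assms
    by (simp_all add: fi_swap_def fi_iota_def act_compose[symmetric] succ_map_fi_hom
        add_star_map_fi_hom star_swap_fi_hom star_swap_succ_map)
qed

lemma fi_epiD:
  "fi_epi V W q \<Longrightarrow> finite X \<Longrightarrow> w \<in> carrier (fi_obj W X) \<Longrightarrow> \<exists>v\<in>carrier (fi_obj V X). q X v = w"
  unfolding fi_epi_def fi_image_def by (metis imageE)

lemma fi_exactD:
  assumes "fi_exact U i V q W" "finite X" "v \<in> carrier (fi_obj V X)" "q X v = \<zero>\<^bsub>fi_obj W X\<^esub>"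
  shows "\<exists>u\<in>carrier (fi_obj U X). i X u = v"
proof -
  have "v \<in> i X ` carrier (fi_obj U X)"
    using assms by (simp add: fi_exact_def fi_image_def fi_kernel_def)
  then show ?thesis by auto
qed

lemma fi_exact_zero:
  assumes "fi_exact U i V q W" "finite X" "u \<in> carrier (fi_obj U X)"
  shows "q X (i X u) = \<zero>\<^bsub>fi_obj W X\<^esub>"
proof -
  have "i X ` carrier (fi_obj U X) = fi_kernel V W q X"
    using assms by (simp add: fi_exact_def fi_image_def)
  with assms(3) have "i X u \<in> fi_kernel V W q X" by blast
  then show ?thesis by (simp add: fi_kernel_def)
qed

section \<open>The Koszul complex\<close>

text \<open>The chain groups are iterated products whose number of factors depends on n; binary
  trees hold all of them in one type. Ring records are used merely as carriers of abelian groups, so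
  multiplication stays undefined.\<close>

datatype 'b ktree = Leaf 'b | Node "'b ktree" "'b ktree"

definition leaf_group :: "('b, 'm) ring_scheme \<Rightarrow> 'b ktree ring" where
  "leaf_group G = \<lparr>carrier = Leaf ` carrier G, mult = undefined, one = undefined, zero = Leaf \<zero>\<^bsub>G\<^esub>,
     add = (\<lambda>s t. case (s, t) of (Leaf x, Leaf y) \<Rightarrow> Leaf (x \<oplus>\<^bsub>G\<^esub> y) | _ \<Rightarrow> undefined)\<rparr>"

definition node_group :: "'b ktree ring \<Rightarrow> 'b ktree ring \<Rightarrow> 'b ktree ring" where
  "node_group G H = \<lparr>carrier = {Node x y |x y. x \<in> carrier G \<and> y \<in> carrier H},
     mult = undefined, one = undefined, zero = Node \<zero>\<^bsub>G\<^esub> \<zero>\<^bsub>H\<^esub>,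
     add = (\<lambda>s t. case (s, t) of (Node x y, Node x' y') \<Rightarrow> Node (x \<oplus>\<^bsub>G\<^esub> x') (y \<oplus>\<^bsub>H\<^esub> y')
       | _ \<Rightarrow> undefined)\<rparr>"

lemma leaf_group_simps [simp]:
  "Leaf x \<in> carrier (leaf_group G) \<longleftrightarrow> x \<in> carrier G"
  "\<zero>\<^bsub>leaf_group G\<^esub> = Leaf \<zero>\<^bsub>G\<^esub>" "Leaf x \<oplus>\<^bsub>leaf_group G\<^esub> Leaf y = Leaf (x \<oplus>\<^bsub>G\<^esub> y)"
  by (auto simp: leaf_group_def)

lemma node_group_simps [simp]:
  "Node x y \<in> carrier (node_group G H) \<longleftrightarrow> x \<in> carrier G \<and> y \<in> carrier H"
  "\<zero>\<^bsub>node_group G H\<^esub> = Node \<zero>\<^bsub>G\<^esub> \<zero>\<^bsub>H\<^esub>"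
  "Node x y \<oplus>\<^bsub>node_group G H\<^esub> Node x' y' = Node (x \<oplus>\<^bsub>G\<^esub> x') (y \<oplus>\<^bsub>H\<^esub> y')"
  by (auto simp: node_group_def)

lemma leaf_groupE:
  assumes "t \<in> carrier (leaf_group G)"
  obtains x where "t = Leaf x" "x \<in> carrier G"
  using assms by (auto simp: leaf_group_def)

lemma node_groupE:
  assumes "t \<in> carrier (node_group G H)"
  obtains x y where "t = Node x y" "x \<in> carrier G" "y \<in> carrier H"
  using assms by (auto simp: node_group_def)

lemma leaf_group_abelian:
  assumes "abelian_group G" shows "abelian_group (leaf_group G)"
proof -
  interpret G: abelian_group G by fact
  show ?thesis
  proof (rule abelian_groupI)
    fix x assume "x \<in> carrier (leaf_group G)"
    then obtain a where a: "x = Leaf a" "a \<in> carrier G" by (rule leaf_groupE)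
    then show "\<exists>y\<in>carrier (leaf_group G). y \<oplus>\<^bsub>leaf_group G\<^esub> x = \<zero>\<^bsub>leaf_group G\<^esub>"
      by (intro bexI[of _ "Leaf (\<ominus>\<^bsub>G\<^esub> a)"]) (auto simp: G.l_neg)
  qed (auto elim!: leaf_groupE simp: G.a_ac)
qed

lemma node_group_abelian:
  assumes "abelian_group G" "abelian_group H" shows "abelian_group (node_group G H)"
proof -
  interpret G: abelian_group G by fact
  interpret H: abelian_group H by fact
  show ?thesis
  proof (rule abelian_groupI)
    fix x assume "x \<in> carrier (node_group G H)"
    then obtain a b where a: "x = Node a b" "a \<in> carrier G" "b \<in> carrier H" by (rule node_groupE)
    then show "\<exists>y\<in>carrier (node_group G H). y \<oplus>\<^bsub>node_group G H\<^esub> x = \<zero>\<^bsub>node_group G H\<^esub>"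
      by (intro bexI[of _ "Node (\<ominus>\<^bsub>G\<^esub> a) (\<ominus>\<^bsub>H\<^esub> b)"]) (auto simp: G.l_neg H.l_neg)
  qed (auto elim!: node_groupE simp: G.a_ac H.a_ac)
qed

lemma node_group_neg:
  assumes "abelian_group G" "abelian_group H" "x \<in> carrier G" "y \<in> carrier H"
  shows "\<ominus>\<^bsub>node_group G H\<^esub> Node x y = Node (\<ominus>\<^bsub>G\<^esub> x) (\<ominus>\<^bsub>H\<^esub> y)"
proof -
  interpret G: abelian_group G by fact
  interpret H: abelian_group H by fact
  interpret N: abelian_group "node_group G H" using assms by (intro node_group_abelian)
  show ?thesis
    by (rule N.minus_equality) (use assms in \<open>auto simp: G.l_neg H.l_neg\<close>)
qed

lemma leaf_group_neg:
  assumes "abelian_group G" "x \<in> carrier G"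
  shows "\<ominus>\<^bsub>leaf_group G\<^esub> Leaf x = Leaf (\<ominus>\<^bsub>G\<^esub> x)"
proof -
  interpret G: abelian_group G by fact
  interpret N: abelian_group "leaf_group G" using assms by (intro leaf_group_abelian)
  show ?thesis
    by (rule N.minus_equality) (use assms in \<open>auto simp: G.l_neg\<close>)
qed

text \<open>
  \<^term>\<open>kz n V\<close> is the sum, over all subsets \<open>I\<close> of \<open>X = {0..<n}\<close>, of the groups \<open>V\<^bsub>X - I\<^esub>\<close>, identified
  with \<open>V\<close> on an initial segment; the summands with \<open>I\<close> of size \<open>a\<close> form \<^term>\<open>kz_part n V a\<close>. The complex
  for \<open>n + 1\<close> is the mapping cone of the complex for \<open>n\<close> under \<open>\<iota> : V \<rightarrow> SV\<close>, which spares the signs of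
  the usual differential.
\<close>

fun kz :: "nat \<Rightarrow> ('a, 'b) fi_mod \<Rightarrow> 'b ktree ring" where
  "kz 0 V = leaf_group (fi_obj V {})"
| "kz (Suc n) V = node_group (kz n (fi_shift V)) (kz n V)"

text \<open>Degrees are integers so that the recursion may pass through \<open>a - 1\<close> without
  case distinctions; parts of negative degree are zero.\<close>

fun kz_part :: "nat \<Rightarrow> ('a, 'b) fi_mod \<Rightarrow> int \<Rightarrow> 'b ktree set" where
  "kz_part 0 V a = {Leaf v |v. v \<in> carrier (fi_obj V {}) \<and> (a \<noteq> 0 \<longrightarrow> v = \<zero>\<^bsub>fi_obj V {}\<^esub>)}"
| "kz_part (Suc n) V a = {Node x y |x y. x \<in> kz_part n (fi_shift V) a \<and> y \<in> kz_part n V (a - 1)}"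

fun kz_map :: "nat \<Rightarrow> ('b, 'c) fi_map \<Rightarrow> 'b ktree \<Rightarrow> 'c ktree" where
  "kz_map 0 \<phi> (Leaf v) = Leaf (\<phi> {} v)"
| "kz_map (Suc n) \<phi> (Node x y) = Node (kz_map n (\<lambda>X. \<phi> (add_star X)) x) (kz_map n \<phi> y)"
| "kz_map _ _ _ = undefined"

fun kz_d :: "nat \<Rightarrow> ('a, 'b) fi_mod \<Rightarrow> 'b ktree \<Rightarrow> 'b ktree" where
  "kz_d 0 V t = Leaf \<zero>\<^bsub>fi_obj V {}\<^esub>"
| "kz_d (Suc n) V (Node x y) =
     Node (kz_d n (fi_shift V) x \<oplus>\<^bsub>kz n (fi_shift V)\<^esub> kz_map n (fi_iota V) y) (\<ominus>\<^bsub>kz n V\<^esub> kz_d n V y)"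
| "kz_d (Suc n) V (Leaf v) = undefined"

lemma kz_group: "fi_module R V \<Longrightarrow> abelian_group (kz n V)"
  by (induction n arbitrary: V)
     (auto intro: leaf_group_abelian node_group_abelian fi_module.obj_group fi_shift_module)

lemma kz_part_subset: "fi_module R V \<Longrightarrow> kz_part n V a \<subseteq> carrier (kz n V)"
proof (induction n arbitrary: V a)
  case (Suc n)
  then show ?case using Suc.IH[OF fi_shift_module[OF Suc.prems]] Suc.IH[OF Suc.prems]
    by (auto simp: subset_iff)
qed auto

lemma kz_part_carrier: "x \<in> kz_part n V a \<Longrightarrow> fi_module R V \<Longrightarrow> x \<in> carrier (kz n V)"
  using kz_part_subset by blast

lemma kz_part_zero: "fi_module R V \<Longrightarrow> \<zero>\<^bsub>kz n V\<^esub> \<in> kz_part n V a"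
proof (induction n arbitrary: V a)
  case 0
  then show ?case using abelian_monoid.zero_closed[OF abelian_group.axioms(1)[OF fi_module.obj_group[OF 0]]]
    by simp
qed (simp add: fi_shift_module)

lemma kz_part_add:
  "fi_module R V \<Longrightarrow> x \<in> kz_part n V a \<Longrightarrow> y \<in> kz_part n V a \<Longrightarrow> x \<oplus>\<^bsub>kz n V\<^esub> y \<in> kz_part n V a"
proof (induction n arbitrary: V a x y)
  case 0
  interpret G: abelian_group "fi_obj V {}" using 0 by (intro fi_module.obj_group) auto
  show ?case using 0 by auto
next
  case (Suc n)
  then show ?case
    using Suc.IH[OF fi_shift_module[OF Suc.prems(1)]] Suc.IH[OF Suc.prems(1)] by auto
qed

lemma kz_part_neg:
  "fi_module R V \<Longrightarrow> x \<in> kz_part n V a \<Longrightarrow> \<ominus>\<^bsub>kz n V\<^esub> x \<in> kz_part n V a"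
proof (induction n arbitrary: V a x)
  case 0
  interpret G: abelian_group "fi_obj V {}" using 0 by (intro fi_module.obj_group) auto
  show ?case using 0 by (auto simp: leaf_group_neg G.abelian_group_axioms)
next
  case (Suc n)
  have S: "fi_module R (fi_shift V)" using Suc.prems by (intro fi_shift_module)
  obtain s t where "x = Node s t" "s \<in> kz_part n (fi_shift V) a" "t \<in> kz_part n V (a - 1)"
    using Suc.prems by auto
  with Suc S show ?case
    by (simp add: node_group_neg kz_group kz_part_carrier[OF _ S] kz_part_carrier[OF _ Suc.prems(1)])
qed

lemma kz_part_neg_degree: "fi_module R V \<Longrightarrow> x \<in> kz_part n V a \<Longrightarrow> a < 0 \<Longrightarrow> x = \<zero>\<^bsub>kz n V\<^esub>"
  by (induction n arbitrary: V a x) (auto intro!: fi_shift_module)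

lemma kz_map_part:
  assumes "\<phi> \<in> fi_morphisms R V W" "fi_module R V" "fi_module R W" "x \<in> kz_part n V a"
  shows "kz_map n \<phi> x \<in> kz_part n W a"
  using assms
proof (induction n arbitrary: V W a x \<phi>)
  case 0
  then show ?case
    using fi_morphisms_closed[OF 0(1), of "{}"] fi_morphisms_zero[OF 0(1-3), of "{}"] by fastforce
next
  case (Suc n)
  then show ?case by (auto intro!: Suc.IH fi_shift_module fi_morphisms_shift)
qed

lemma kz_map_hom:
  assumes "\<phi> \<in> fi_morphisms R V W" "fi_module R V" "fi_module R W"
  shows "kz_map n \<phi> \<in> add_homs (kz n V) (kz n W)"
  using assms
proof (induction n arbitrary: V W \<phi>)
  case 0
  note h = fi_morphisms_hom[OF 0(1) finite.emptyI]
  show ?case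
    by (rule add_homsI) (auto elim!: leaf_groupE simp: add_homs_closed[OF h] add_homs_add[OF h])
next
  case (Suc n)
  have 1: "kz_map n \<phi> \<in> add_homs (kz n V) (kz n W)"
    by (rule Suc.IH[OF Suc.prems])
  have 2: "kz_map n (\<lambda>X. \<phi> (add_star X)) \<in> add_homs (kz n (fi_shift V)) (kz n (fi_shift W))"
    by (intro Suc.IH fi_morphisms_shift fi_shift_module Suc.prems)
  show ?case
    by (rule add_homsI) (auto elim!: node_groupE simp: add_homs_closed[OF 1] add_homs_add[OF 1]
        add_homs_closed[OF 2] add_homs_add[OF 2])
qed

lemma kz_map_comp:
  "x \<in> carrier (kz n U) \<Longrightarrow> kz_map n (\<lambda>X v. \<psi> X (\<phi> X v)) x = kz_map n \<psi> (kz_map n \<phi> x)"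
  by (induction n arbitrary: U x \<phi> \<psi>) (auto elim!: leaf_groupE node_groupE)

lemma kz_map_cong:
  "x \<in> carrier (kz n V) \<Longrightarrow> (\<And>X v. finite X \<Longrightarrow> v \<in> carrier (fi_obj V X) \<Longrightarrow> \<phi> X v = \<psi> X v) \<Longrightarrow>
    kz_map n \<phi> x = kz_map n \<psi> x"
proof (induction n arbitrary: V x \<phi> \<psi>)
  case 0
  then show ?case by (auto elim!: leaf_groupE)
next
  case (Suc n)
  then obtain s t where "x = Node s t" "s \<in> carrier (kz n (fi_shift V))" "t \<in> carrier (kz n V)"
    by (auto elim!: node_groupE)
  with Suc.IH[of s "fi_shift V" "\<lambda>X. \<phi> (add_star X)" "\<lambda>X. \<psi> (add_star X)"] Suc.IH[of t V \<phi> \<psi>]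
  show ?case by (simp add: Suc.prems(2))
qed

lemma kz_map_iota:
  assumes "\<phi> \<in> fi_morphisms R V W" "x \<in> carrier (kz n V)"
  shows "kz_map n (\<lambda>X. \<phi> (add_star X)) (kz_map n (fi_iota V) x) = kz_map n (fi_iota W) (kz_map n \<phi> x)"
proof -
  have "kz_map n (\<lambda>X v. \<phi> (add_star X) (fi_iota V X v)) x = kz_map n (\<lambda>X v. fi_iota W X (\<phi> X v)) x"
    by (rule kz_map_cong[OF assms(2)]) (simp add: fi_iota_natural[OF assms(1)])
  then show ?thesis
    using kz_map_comp[OF assms(2), of "\<lambda>X. \<phi> (add_star X)" "fi_iota V"]
      kz_map_comp[OF assms(2), of "fi_iota W" \<phi>] by simp
qed

lemma kz_iota_hom:
  "fi_module R V \<Longrightarrow> kz_map n (fi_iota V) \<in> add_homs (kz n V) (kz n (fi_shift V))"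
  by (intro kz_map_hom fi_iota_morphism fi_shift_module)

lemma kz_d_hom: "fi_module R V \<Longrightarrow> kz_d n V \<in> add_homs (kz n V) (kz n V)"
proof (induction n arbitrary: V)
  case 0
  interpret G: abelian_group "fi_obj V {}" using 0 by (intro fi_module.obj_group) auto
  show ?case by (auto intro: add_homsI)
next
  case (Suc n)
  note V = Suc.prems
  have S: "fi_module R (fi_shift V)" using V by (rule fi_shift_module)
  interpret G: abelian_group "kz n V" by (rule kz_group[OF V])
  interpret H: abelian_group "kz n (fi_shift V)" by (rule kz_group[OF S])
  note h = Suc.IH[OF V] Suc.IH[OF S] kz_iota_hom[OF V, of n]
  note c = h[THEN add_homs_closed]
  show ?case
    by (rule add_homsI) (auto elim!: node_groupE
        simp: c h[THEN add_homs_add] H.a_ac G.minus_add)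
qed

lemma kz_d_part: "fi_module R V \<Longrightarrow> x \<in> kz_part n V a \<Longrightarrow> kz_d n V x \<in> kz_part n V (a - 1)"
proof (induction n arbitrary: V a x)
  case 0
  interpret G: abelian_group "fi_obj V {}" using 0 by (intro fi_module.obj_group) auto
  show ?case by auto
next
  case (Suc n)
  note V = Suc.prems(1)
  have S: "fi_module R (fi_shift V)" using V by (rule fi_shift_module)
  show ?case
    using Suc.prems(2) Suc.IH[OF V, of _ "a - 1"]
    by (auto intro!: kz_part_add[OF S] kz_part_neg[OF V] Suc.IH[OF S]
        kz_map_part[OF fi_iota_morphism[OF V] V S])
qed

lemma kz_d_natural:
  assumes "\<phi> \<in> fi_morphisms R V W" "fi_module R V" "fi_module R W" "x \<in> carrier (kz n V)"
  shows "kz_d n W (kz_map n \<phi> x) = kz_map n \<phi> (kz_d n V x)"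
  using assms
proof (induction n arbitrary: V W \<phi> x)
  case 0
  then show ?case by (auto elim!: leaf_groupE simp: fi_morphisms_zero)
next
  case (Suc n)
  note V = Suc.prems(2) and W = Suc.prems(3) and \<phi> = Suc.prems(1)
  note S = fi_shift_module[OF V] fi_shift_module[OF W] and \<phi>S = fi_morphisms_shift[OF \<phi>]
  obtain s t where x: "x = Node s t" "s \<in> carrier (kz n (fi_shift V))" "t \<in> carrier (kz n V)"
    using Suc.prems(4) by (auto elim!: node_groupE)
  note m = kz_map_hom[OF \<phi> V W, of n] kz_map_hom[OF \<phi>S S, of n]
  note c = add_homs_closed[OF kz_d_hom[OF V] x(3)] add_homs_closed[OF kz_d_hom[OF S(1)] x(2)]
    add_homs_closed[OF kz_iota_hom[OF V] x(3)]
  show ?case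
    using x Suc.IH[OF \<phi>S S x(2)] Suc.IH[OF \<phi> V W x(3)] kz_map_iota[OF \<phi> x(3)]
    by (simp add: add_homs_add[OF m(2)] c add_homs_neg[OF m(1) kz_group[OF V] kz_group[OF W]])
qed

text \<open>The mixed component of the square is d iota - iota d, which vanishes because a morphism
  of FI-modules induces a chain map.\<close>

lemma kz_d_d:
  assumes "fi_module R V" "x \<in> carrier (kz n V)"
  shows "kz_d n V (kz_d n V x) = \<zero>\<^bsub>kz n V\<^esub>"
  using assms
proof (induction n arbitrary: V x)
  case 0
  then show ?case by simp
next
  case (Suc n)
  note V = Suc.prems(1)
  have S: "fi_module R (fi_shift V)" using V by (rule fi_shift_module)
  interpret G: abelian_group "kz n V" by (rule kz_group[OF V])
  interpret H: abelian_group "kz n (fi_shift V)" by (rule kz_group[OF S])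
  obtain s t where x: "x = Node s t" "s \<in> carrier (kz n (fi_shift V))" "t \<in> carrier (kz n V)"
    using Suc.prems(2) by (auto elim!: node_groupE)
  note h = kz_d_hom[OF V, of n] kz_d_hom[OF S, of n] kz_iota_hom[OF V, of n]
  note c = h[THEN add_homs_closed]
  show ?case
    using x Suc.IH[OF S x(2)] Suc.IH[OF V x(3)] kz_d_natural[OF fi_iota_morphism[OF V] V S x(3)]
    by (simp add: c h[THEN add_homs_add] H.r_neg
        add_homs_neg[OF h(1) G.abelian_group_axioms G.abelian_group_axioms]
        add_homs_neg[OF h(3) G.abelian_group_axioms H.abelian_group_axioms])
qed

section \<open>Exactness of the chain groups as functors of the FI-module\<close>

lemma kz_map_part_surj:
  assumes "q \<in> fi_morphisms R V D" "fi_module R V" "fi_module R D" "fi_epi V D q" "y \<in> kz_part n D a"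
  shows "\<exists>x\<in>kz_part n V a. kz_map n q x = y"
  using assms
proof (induction n arbitrary: V D q a y)
  case 0
  interpret G: abelian_group "fi_obj V {}" using 0 by (intro fi_module.obj_group) auto
  obtain v where v: "y = Leaf v" "v \<in> carrier (fi_obj D {})" "a \<noteq> 0 \<longrightarrow> v = \<zero>\<^bsub>fi_obj D {}\<^esub>"
    using 0 by auto
  show ?case
  proof (cases "a = 0")
    case True
    obtain u where "u \<in> carrier (fi_obj V {})" "q {} u = v"
      using fi_epiD[OF 0(4) finite.emptyI v(2)] by blast
    with v True show ?thesis by (intro bexI[of _ "Leaf u"]) auto
  next
    case False
    with v fi_morphisms_zero[OF 0(1-3)] show ?thesis
      by (intro bexI[of _ "Leaf \<zero>\<^bsub>fi_obj V {}\<^esub>"]) auto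
  qed
next
  case (Suc n)
  obtain s t where y: "y = Node s t" "s \<in> kz_part n (fi_shift D) a" "t \<in> kz_part n D (a - 1)"
    using Suc.prems(5) by auto
  have "fi_epi (fi_shift V) (fi_shift D) (\<lambda>X. q (add_star X))"
    using Suc.prems(4) by (auto simp: fi_epi_def fi_image_def)
  from Suc.IH[OF fi_morphisms_shift[OF Suc.prems(1)] Suc.prems(2,3)[THEN fi_shift_module] this y(2)]
    Suc.IH[OF Suc.prems(1-4) y(3)]
  obtain s' t' where "s' \<in> kz_part n (fi_shift V) a" "kz_map n (\<lambda>X. q (add_star X)) s' = s"
    "t' \<in> kz_part n V (a - 1)" "kz_map n q t' = t" by auto
  then show ?case using y(1) by (intro bexI[of _ "Node s' t'"]) auto
qed

lemma kz_map_part_exact: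
  assumes "i \<in> fi_morphisms R U V" "q \<in> fi_morphisms R V D"
    and "fi_module R U" "fi_module R V" "fi_module R D" "fi_exact U i V q D"
    and "x \<in> kz_part n V a" "kz_map n q x = \<zero>\<^bsub>kz n D\<^esub>"
  shows "\<exists>y\<in>kz_part n U a. kz_map n i y = x"
  using assms
proof (induction n arbitrary: U V D q i a x)
  case 0
  interpret G: abelian_group "fi_obj U {}" using 0 by (intro fi_module.obj_group) auto
  obtain v where v: "x = Leaf v" "v \<in> carrier (fi_obj V {})" "a \<noteq> 0 \<longrightarrow> v = \<zero>\<^bsub>fi_obj V {}\<^esub>"
    using 0 by auto
  show ?case
  proof (cases "a = 0")
    case True
    obtain u where "u \<in> carrier (fi_obj U {})" "i {} u = v"
      using fi_exactD[OF 0(6) finite.emptyI v(2)] v 0(8) by auto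
    with v True show ?thesis by (intro bexI[of _ "Leaf u"]) auto
  next
    case False
    with v fi_morphisms_zero[OF 0(1,3,4)] show ?thesis
      by (intro bexI[of _ "Leaf \<zero>\<^bsub>fi_obj U {}\<^esub>"]) auto
  qed
next
  case (Suc n)
  obtain s t where x: "x = Node s t" "s \<in> kz_part n (fi_shift V) a" "t \<in> kz_part n V (a - 1)"
    using Suc.prems(7) by auto
  have "fi_exact (fi_shift U) (\<lambda>X. i (add_star X)) (fi_shift V) (\<lambda>X. q (add_star X)) (fi_shift D)"
    using Suc.prems(6) by (auto simp: fi_exact_def fi_image_def fi_kernel_def)
  from Suc.IH[OF Suc.prems(1,2)[THEN fi_morphisms_shift] Suc.prems(3-5)[THEN fi_shift_module] this x(2)]
    Suc.IH[OF Suc.prems(1-6) x(3)] Suc.prems(8) x(1)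
  obtain s' t' where "s' \<in> kz_part n (fi_shift U) a" "kz_map n (\<lambda>X. i (add_star X)) s' = s"
    "t' \<in> kz_part n U (a - 1)" "kz_map n i t' = t" by auto
  then show ?case using x(1) by (intro bexI[of _ "Node s' t'"]) auto
qed

lemma kz_map_exact_zero:
  assumes "i \<in> fi_morphisms R U V" "q \<in> fi_morphisms R V D"
    and "fi_module R U" "fi_module R V" "fi_module R D" "fi_exact U i V q D"
    and "x \<in> carrier (kz n U)"
  shows "kz_map n q (kz_map n i x) = \<zero>\<^bsub>kz n D\<^esub>"
  using assms
proof (induction n arbitrary: U V D q i x)
  case 0
  then obtain v where v: "x = Leaf v" "v \<in> carrier (fi_obj U {})" by (auto elim: leaf_groupE)
  then have "i {} v \<in> fi_kernel V D q {}"
    using 0(6) by (auto simp: fi_exact_def fi_image_def)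
  then show ?case using v by (auto simp: fi_kernel_def)
next
  case (Suc n)
  obtain s t where x: "x = Node s t" "s \<in> carrier (kz n (fi_shift U))" "t \<in> carrier (kz n U)"
    using Suc.prems(7) by (auto elim: node_groupE)
  have "fi_exact (fi_shift U) (\<lambda>X. i (add_star X)) (fi_shift V) (\<lambda>X. q (add_star X)) (fi_shift D)"
    using Suc.prems(6) by (auto simp: fi_exact_def fi_image_def fi_kernel_def)
  from Suc.IH[OF Suc.prems(1,2)[THEN fi_morphisms_shift] Suc.prems(3-5)[THEN fi_shift_module] this x(2)]
    Suc.IH[OF Suc.prems(1-6) x(3)] x(1) show ?case by simp
qed

text \<open>The part of degree a is a finite sum of values of V on sets of size n - a, so
  injectivity in that single size suffices. This is the origin of the summand a in the bound td(V) +
  a. For a > n the hypothesis is vacuous and the part is zero.\<close>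

lemma kz_map_part_inj:
  assumes "fi_module R V" "\<phi> \<in> fi_morphisms R V W"
    and "\<And>m v. int m = int n - a \<Longrightarrow> v \<in> carrier (fi_obj V {0..<m}) \<Longrightarrow>
      \<phi> {0..<m} v = \<zero>\<^bsub>fi_obj W {0..<m}\<^esub> \<Longrightarrow> v = \<zero>\<^bsub>fi_obj V {0..<m}\<^esub>"
    and "x \<in> kz_part n V a" "kz_map n \<phi> x = \<zero>\<^bsub>kz n W\<^esub>"
  shows "x = \<zero>\<^bsub>kz n V\<^esub>"
  using assms
proof (induction n arbitrary: V W \<phi> a x)
  case 0
  then show ?case by (cases "a = 0") (auto dest: 0(3)[of 0])
next
  case (Suc n)
  obtain s t where x: "x = Node s t" "s \<in> kz_part n (fi_shift V) a" "t \<in> kz_part n V (a - 1)"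
    using Suc.prems(4) by auto
  have "s = \<zero>\<^bsub>kz n (fi_shift V)\<^esub>"
  proof (rule Suc.IH[OF fi_shift_module[OF Suc.prems(1)] fi_morphisms_shift[OF Suc.prems(2)] _ x(2)])
    fix m v
    assume "int m = int n - a" "v \<in> carrier (fi_obj (fi_shift V) {0..<m})"
      "\<phi> (add_star {0..<m}) v = \<zero>\<^bsub>fi_obj (fi_shift W) {0..<m}\<^esub>"
    then show "v = \<zero>\<^bsub>fi_obj (fi_shift V) {0..<m}\<^esub>"
      using Suc.prems(3)[of "Suc m" v] by simp
  qed (use Suc.prems(5) x(1) in simp)
  moreover have "t = \<zero>\<^bsub>kz n V\<^esub>"
    by (rule Suc.IH[OF Suc.prems(1,2) _ x(3)]) (use Suc.prems(3,5) x(1) in auto)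
  ultimately show ?case using x(1) by simp
qed

lemma kz_part_trivial:
  assumes "fi_module R V"
    and "\<And>m v. int m = int n - a \<Longrightarrow> v \<in> carrier (fi_obj V {0..<m}) \<Longrightarrow> v = \<zero>\<^bsub>fi_obj V {0..<m}\<^esub>"
    and "x \<in> kz_part n V a"
  shows "x = \<zero>\<^bsub>kz n V\<^esub>"
  using assms
proof (induction n arbitrary: V a x)
  case 0
  then show ?case by (cases "a = 0") (auto dest: 0(2)[of 0])
next
  case (Suc n)
  obtain s t where x: "x = Node s t" "s \<in> kz_part n (fi_shift V) a" "t \<in> kz_part n V (a - 1)"
    using Suc.prems(3) by auto
  have "s = \<zero>\<^bsub>kz n (fi_shift V)\<^esub>"
  proof (rule Suc.IH[OF fi_shift_module[OF Suc.prems(1)] _ x(2)])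
    fix m v assume "int m = int n - a" "v \<in> carrier (fi_obj (fi_shift V) {0..<m})"
    then show "v = \<zero>\<^bsub>fi_obj (fi_shift V) {0..<m}\<^esub>"
      using Suc.prems(2)[of "Suc m" v] by simp
  qed
  moreover have "t = \<zero>\<^bsub>kz n V\<^esub>"
    by (rule Suc.IH[OF Suc.prems(1) _ x(3)]) (use Suc.prems(2) in auto)
  ultimately show ?case using x(1) by simp
qed

text \<open>The two embeddings of \<open>X \<union> {\<star>}\<close> into \<open>X \<union> {\<star>, \<star>}\<close> differ by a transposition.\<close>

lemma kz_d_iota_zero:
  assumes "fi_module R V" "x \<in> carrier (kz n V)" "kz_map n (fi_iota V) x = \<zero>\<^bsub>kz n (fi_shift V)\<^esub>"
  shows "kz_d n V x = \<zero>\<^bsub>kz n V\<^esub>"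
  using assms
proof (induction n arbitrary: V x)
  case 0
  then show ?case by simp
next
  case (Suc n)
  note V = Suc.prems(1)
  have S: "fi_module R (fi_shift V)" using V by (rule fi_shift_module)
  have SS: "fi_module R (fi_shift (fi_shift V))" using S by (rule fi_shift_module)
  interpret G: abelian_group "kz n V" by (rule kz_group[OF V])
  interpret H: abelian_group "kz n (fi_shift V)" by (rule kz_group[OF S])
  obtain s t where x: "x = Node s t" "s \<in> carrier (kz n (fi_shift V))" "t \<in> carrier (kz n V)"
    using Suc.prems(2) by (auto elim!: node_groupE)
  have z: "kz_map n (\<lambda>X. fi_iota V (add_star X)) s = \<zero>\<^bsub>kz n (fi_shift (fi_shift V))\<^esub>"
    "kz_map n (fi_iota V) t = \<zero>\<^bsub>kz n (fi_shift V)\<^esub>"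
    using Suc.prems(3) x by simp_all
  \<comment> \<open>The hypothesis speaks of the shift of iota, the induction hypothesis for S V of
    iota of S V.\<close>
  have "kz_map n (fi_iota (fi_shift V)) s
      = kz_map n (\<lambda>X v. fi_swap V X (fi_iota V (add_star X) v)) s"
    by (rule kz_map_cong[OF x(2)]) (simp add: fi_swap_iota[OF V])
  also have "\<dots> = kz_map n (fi_swap V) (kz_map n (\<lambda>X. fi_iota V (add_star X)) s)"
    by (rule kz_map_comp[OF x(2)])
  also have "\<dots> = \<zero>\<^bsub>kz n (fi_shift (fi_shift V))\<^esub>"
    unfolding z by (rule add_homs_zero[OF kz_map_hom[OF fi_swap_morphism[OF V] SS SS]
        kz_group[OF SS] kz_group[OF SS]])
  finally have "kz_d n (fi_shift V) s = \<zero>\<^bsub>kz n (fi_shift V)\<^esub>"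
    using Suc.IH[OF S x(2)] by simp
  with Suc.IH[OF V x(3) z(2)] z x show ?case by simp
qed

text \<open>The summand of the empty subset I. It fills the part of degree 0, since the other
  factors lie in negative degree there.\<close>

fun kz_unit :: "nat \<Rightarrow> ('a, 'b) fi_mod \<Rightarrow> 'b \<Rightarrow> 'b ktree" where
  "kz_unit 0 V v = Leaf v"
| "kz_unit (Suc n) V v = Node (kz_unit n (fi_shift V) v) \<zero>\<^bsub>kz n V\<^esub>"

lemma kz_unit_part:
  "fi_module R V \<Longrightarrow> v \<in> carrier (fi_obj V {0..<n}) \<Longrightarrow> kz_unit n V v \<in> kz_part n V 0"
proof (induction n arbitrary: V)
  case (Suc n)
  then show ?case using Suc.IH[OF fi_shift_module[OF Suc.prems(1)]]
    by (simp add: kz_part_zero[OF Suc.prems(1)])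
qed auto

lemma kz_unit_surj:
  "fi_module R V \<Longrightarrow> x \<in> kz_part n V 0 \<Longrightarrow> \<exists>v\<in>carrier (fi_obj V {0..<n}). x = kz_unit n V v"
proof (induction n arbitrary: V x)
  case (Suc n)
  then obtain s t where x: "x = Node s t" "s \<in> kz_part n (fi_shift V) 0" "t \<in> kz_part n V (-1)"
    by auto
  with Suc.IH[OF fi_shift_module[OF Suc.prems(1)] x(2)] kz_part_neg_degree[OF Suc.prems(1) x(3)]
  show ?case by auto
qed auto

lemma kz_map_unit:
  "\<phi> \<in> fi_morphisms R V W \<Longrightarrow> fi_module R V \<Longrightarrow> fi_module R W \<Longrightarrow>
    kz_map n \<phi> (kz_unit n V v) = kz_unit n W (\<phi> {0..<n} v)"
proof (induction n arbitrary: V W \<phi>)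
  case (Suc n)
  then show ?case
    using Suc.IH[OF fi_morphisms_shift[OF Suc.prems(1)] Suc.prems(2,3)[THEN fi_shift_module]]
      add_homs_zero[OF kz_map_hom[OF Suc.prems] Suc.prems(2,3)[THEN kz_group]]
    by simp
qed simp

lemma kz_unit_hom: "fi_module R V \<Longrightarrow> kz_unit n V \<in> add_homs (fi_obj V {0..<n}) (kz n V)"
proof (induction n arbitrary: V)
  case 0
  then show ?case by (auto intro: add_homsI)
next
  case (Suc n)
  interpret G: abelian_group "kz n V" by (rule kz_group[OF Suc.prems])
  show ?case
    using Suc.IH[OF fi_shift_module[OF Suc.prems]]
    by (auto simp: add_homs_def Pi_iff)
qed

lemma kz_unit_inj: "kz_unit n V v = kz_unit n V w \<longleftrightarrow> v = w"
  by (induction n arbitrary: V) auto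

section \<open>Subobjects and quotients\<close>

lemma submodule_facts:
  assumes "Module.module R M" "submodule N R M"
  shows "x \<in> N \<Longrightarrow> x \<in> carrier M" "\<zero>\<^bsub>M\<^esub> \<in> N" "x \<in> N \<Longrightarrow> y \<in> N \<Longrightarrow> x \<oplus>\<^bsub>M\<^esub> y \<in> N"
    "x \<in> N \<Longrightarrow> \<ominus>\<^bsub>M\<^esub> x \<in> N" "r \<in> carrier R \<Longrightarrow> x \<in> N \<Longrightarrow> r \<odot>\<^bsub>M\<^esub> x \<in> N"
proof -
  interpret M: Module.module R M by fact
  note N = M.submoduleE[OF assms(2)]
  show "x \<in> N \<Longrightarrow> x \<in> carrier M" "x \<in> N \<Longrightarrow> y \<in> N \<Longrightarrow> x \<oplus>\<^bsub>M\<^esub> y \<in> N"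
    "x \<in> N \<Longrightarrow> \<ominus>\<^bsub>M\<^esub> x \<in> N" "r \<in> carrier R \<Longrightarrow> x \<in> N \<Longrightarrow> r \<odot>\<^bsub>M\<^esub> x \<in> N"
    using N by auto
  obtain z where z: "z \<in> N" using N(2) by blast
  then have "z \<in> carrier M" using N(1) by blast
  then show "\<zero>\<^bsub>M\<^esub> \<in> N" using N(5)[OF z N(3)[OF z]] by (simp add: M.r_neg)
qed

lemma linear_image_submodule:
  assumes "Module.module R L" "Module.module R M" "h \<in> linear_maps R L M" "submodule N R L"
  shows "submodule (h ` N) R M"
proof -
  interpret L: Module.module R L by fact
  interpret M: Module.module R M by fact
  note a = linear_maps_add_homs[OF assms(3)] and N = submodule_facts[OF assms(1,4)]
  show ?thesis
  proof (rule M.submoduleI)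
    show "h ` N \<subseteq> carrier M" using add_homs_closed[OF a] N(1) by blast
    show "\<zero>\<^bsub>M\<^esub> \<in> h ` N"
      using add_homs_zero[OF a L.abelian_group_axioms M.abelian_group_axioms] N(2) by (metis imageI)
    show "\<ominus>\<^bsub>M\<^esub> x \<in> h ` N" if x: "x \<in> h ` N" for x
    proof -
      obtain y where y: "y \<in> N" "x = h y" using x by blast
      have "\<ominus>\<^bsub>M\<^esub> x = h (\<ominus>\<^bsub>L\<^esub> y)"
        using add_homs_neg[OF a L.abelian_group_axioms M.abelian_group_axioms N(1)[OF y(1)]] y(2)
        by simp
      then show ?thesis using N(4)[OF y(1)] by blast
    qed
    show "x \<oplus>\<^bsub>M\<^esub> y \<in> h ` N" if x: "x \<in> h ` N" "y \<in> h ` N" for x y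
    proof -
      obtain s t where y: "s \<in> N" "x = h s" "t \<in> N" "y = h t" using x by blast
      have "x \<oplus>\<^bsub>M\<^esub> y = h (s \<oplus>\<^bsub>L\<^esub> t)"
        using add_homs_add[OF a N(1)[OF y(1)] N(1)[OF y(3)]] y by simp
      then show ?thesis using N(3)[OF y(1,3)] by blast
    qed
    show "r \<odot>\<^bsub>M\<^esub> x \<in> h ` N" if x: "r \<in> carrier R" "x \<in> h ` N" for r x
    proof -
      obtain s where y: "s \<in> N" "x = h s" using x by blast
      have "r \<odot>\<^bsub>M\<^esub> x = h (r \<odot>\<^bsub>L\<^esub> s)"
        using linear_maps_smult[OF assms(3) x(1) N(1)[OF y(1)]] y by simp
      then show ?thesis using N(5)[OF x(1) y(1)] by blast
    qed
  qed
qed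

lemma linear_vimage_submodule:
  assumes "Module.module R L" "Module.module R M" "h \<in> linear_maps R L M" "submodule N R M"
  shows "submodule {x \<in> carrier L. h x \<in> N} R L"
proof -
  interpret L: Module.module R L by fact
  interpret M: Module.module R M by fact
  note a = linear_maps_add_homs[OF assms(3)] and N = submodule_facts[OF assms(2,4)]
  show ?thesis
    by (rule L.submoduleI)
       (auto simp: add_homs_zero[OF a L.abelian_group_axioms M.abelian_group_axioms] N
          add_homs_neg[OF a L.abelian_group_axioms M.abelian_group_axioms] add_homs_add[OF a]
          linear_maps_smult[OF assms(3)])
qed

lemma zero_submodule: "Module.module R M \<Longrightarrow> submodule {\<zero>\<^bsub>M\<^esub>} R M"
proof -
  assume "Module.module R M"
  then interpret M: Module.module R M .
  show ?thesis by (rule M.submoduleI) auto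
qed

lemma coset_rep_mem:
  assumes "Module.module R M" "submodule N R M" "x \<in> carrier M"
  shows "\<exists>h\<in>N. coset_rep M N x = h \<oplus>\<^bsub>M\<^esub> x"
proof -
  interpret M: Module.module R M by fact
  have "x \<in> N +>\<^bsub>M\<^esub> x"
    using submodule_facts(2)[OF assms(1,2)] assms(3) by (force simp: a_r_coset_def')
  then have "coset_rep M N x \<in> N +>\<^bsub>M\<^esub> x" unfolding coset_rep_def by (rule someI)
  then show ?thesis by (auto simp: a_r_coset_def')
qed

lemma coset_rep_closed:
  assumes "Module.module R M" "submodule N R M" "x \<in> carrier M"
  shows "coset_rep M N x \<in> carrier M"
proof -
  interpret M: Module.module R M by fact
  show ?thesis using coset_rep_mem[OF assms] submodule_facts(1)[OF assms(1,2)] assms(3) by auto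
qed

lemma coset_rep_eq_iff:
  assumes "Module.module R M" "submodule N R M" "x \<in> carrier M" "y \<in> carrier M"
  shows "coset_rep M N x = coset_rep M N y \<longleftrightarrow> x \<oplus>\<^bsub>M\<^esub> \<ominus>\<^bsub>M\<^esub> y \<in> N"
proof -
  interpret M: Module.module R M by fact
  note N = submodule_facts[OF assms(1,2)] and [simp] = assms(3,4)
  have coset: "z \<in> N +>\<^bsub>M\<^esub> x \<longleftrightarrow> z \<in> carrier M \<and> z \<oplus>\<^bsub>M\<^esub> \<ominus>\<^bsub>M\<^esub> x \<in> N" if "x \<in> carrier M" for x z
  proof
    assume "z \<in> N +>\<^bsub>M\<^esub> x"
    then obtain h where "h \<in> N" "z = h \<oplus>\<^bsub>M\<^esub> x" by (auto simp: a_r_coset_def')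
    then show "z \<in> carrier M \<and> z \<oplus>\<^bsub>M\<^esub> \<ominus>\<^bsub>M\<^esub> x \<in> N"
      using that N(1) by (simp add: M.a_assoc M.r_neg)
  next
    assume z: "z \<in> carrier M \<and> z \<oplus>\<^bsub>M\<^esub> \<ominus>\<^bsub>M\<^esub> x \<in> N"
    then have "z = (z \<oplus>\<^bsub>M\<^esub> \<ominus>\<^bsub>M\<^esub> x) \<oplus>\<^bsub>M\<^esub> x" using that by (simp add: M.a_assoc M.l_neg)
    with z show "z \<in> N +>\<^bsub>M\<^esub> x" by (auto simp: a_r_coset_def')
  qed
  show ?thesis
  proof
    assume eq: "coset_rep M N x = coset_rep M N y"
    obtain h where h: "h \<in> N" "coset_rep M N x = h \<oplus>\<^bsub>M\<^esub> x"
      using coset_rep_mem[OF assms(1,2,3)] by blast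
    obtain k where k: "k \<in> N" "coset_rep M N y = k \<oplus>\<^bsub>M\<^esub> y"
      using coset_rep_mem[OF assms(1,2,4)] by blast
    note [simp] = N(1)[OF h(1)] N(1)[OF k(1)]
    have "x = \<ominus>\<^bsub>M\<^esub> h \<oplus>\<^bsub>M\<^esub> (k \<oplus>\<^bsub>M\<^esub> y)"
      unfolding k(2)[symmetric] eq[symmetric] h(2) by (simp add: M.r_neg1)
    then have "x \<oplus>\<^bsub>M\<^esub> \<ominus>\<^bsub>M\<^esub> y = \<ominus>\<^bsub>M\<^esub> h \<oplus>\<^bsub>M\<^esub> k"
      by (simp add: M.a_assoc M.r_neg)
    then show "x \<oplus>\<^bsub>M\<^esub> \<ominus>\<^bsub>M\<^esub> y \<in> N" using N(3)[OF N(4)[OF h(1)] k(1)] by simp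
  next
    assume xy: "x \<oplus>\<^bsub>M\<^esub> \<ominus>\<^bsub>M\<^esub> y \<in> N"
    have "z \<oplus>\<^bsub>M\<^esub> \<ominus>\<^bsub>M\<^esub> x \<in> N \<longleftrightarrow> z \<oplus>\<^bsub>M\<^esub> \<ominus>\<^bsub>M\<^esub> y \<in> N" if z: "z \<in> carrier M" for z
    proof
      assume "z \<oplus>\<^bsub>M\<^esub> \<ominus>\<^bsub>M\<^esub> x \<in> N"
      from N(3)[OF this xy] show "z \<oplus>\<^bsub>M\<^esub> \<ominus>\<^bsub>M\<^esub> y \<in> N"
        using z by (simp add: M.a_assoc M.r_neg1)
    next
      assume "z \<oplus>\<^bsub>M\<^esub> \<ominus>\<^bsub>M\<^esub> y \<in> N"
      from N(3)[OF this N(4)[OF xy]] show "z \<oplus>\<^bsub>M\<^esub> \<ominus>\<^bsub>M\<^esub> x \<in> N"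
        using z M.a_lcomm[of "\<ominus>\<^bsub>M\<^esub> y" "\<ominus>\<^bsub>M\<^esub> x" y]
        by (simp add: M.a_assoc M.minus_add M.l_neg)
    qed
    then have "N +>\<^bsub>M\<^esub> x = N +>\<^bsub>M\<^esub> y" using coset[OF assms(3)] coset[OF assms(4)] by blast
    then show "coset_rep M N x = coset_rep M N y" by (simp add: coset_rep_def)
  qed
qed

lemma coset_rep_idem:
  assumes "Module.module R M" "submodule N R M" "x \<in> carrier M"
  shows "coset_rep M N (coset_rep M N x) = coset_rep M N x"
proof -
  interpret M: Module.module R M by fact
  obtain h where h: "h \<in> N" "coset_rep M N x = h \<oplus>\<^bsub>M\<^esub> x"
    using coset_rep_mem[OF assms] by blast
  with submodule_facts(1)[OF assms(1,2)] assms(3) show ?thesis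
    by (subst coset_rep_eq_iff[OF assms(1,2) coset_rep_closed[OF assms]])
       (auto simp: M.a_assoc M.r_neg)
qed

text \<open>Maps into quotients end with a choice of representative; this equation absorbs every
  inner choice into the outermost one, and functoriality of quotients rests on it.\<close>

lemma coset_rep_hom:
  assumes "Module.module R M" "submodule N R M" "Module.module R L" "submodule N' R L"
    and h: "h \<in> add_homs M L" "\<And>x. x \<in> N \<Longrightarrow> h x \<in> N'" and x: "x \<in> carrier M"
  shows "coset_rep L N' (h (coset_rep M N x)) = coset_rep L N' (h x)"
proof -
  interpret M: Module.module R M by fact
  interpret L: Module.module R L by fact
  obtain k where k: "k \<in> N" "coset_rep M N x = k \<oplus>\<^bsub>M\<^esub> x"
    using coset_rep_mem[OF assms(1,2) x] by blast
  note kM = submodule_facts(1)[OF assms(1,2) k(1)]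
  note c = add_homs_closed[OF h(1)]
  show ?thesis
    unfolding k(2)
    by (subst coset_rep_eq_iff[OF assms(3,4)])
       (auto simp: c kM x add_homs_add[OF h(1)] L.a_assoc L.r_neg h(2) k(1))
qed

lemma coset_rep_add:
  assumes "Module.module R M" "submodule N R M" "x \<in> carrier M" "y \<in> carrier M"
  shows "coset_rep M N (coset_rep M N x \<oplus>\<^bsub>M\<^esub> y) = coset_rep M N (x \<oplus>\<^bsub>M\<^esub> y)"
    and "coset_rep M N (x \<oplus>\<^bsub>M\<^esub> coset_rep M N y) = coset_rep M N (x \<oplus>\<^bsub>M\<^esub> y)"
proof -
  interpret M: Module.module R M by fact
  have *: "coset_rep M N (coset_rep M N x \<oplus>\<^bsub>M\<^esub> y) = coset_rep M N (x \<oplus>\<^bsub>M\<^esub> y)"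
    if [simp]: "x \<in> carrier M" "y \<in> carrier M" for x y
  proof -
    obtain k where k: "k \<in> N" "coset_rep M N x = k \<oplus>\<^bsub>M\<^esub> x"
      using coset_rep_mem[OF assms(1,2) \<open>x \<in> carrier M\<close>] by blast
    note [simp] = submodule_facts(1)[OF assms(1,2) k(1)]
    show ?thesis unfolding k(2)
      by (subst coset_rep_eq_iff[OF assms(1,2)]) (auto simp: M.a_assoc M.r_neg k(1))
  qed
  show "coset_rep M N (coset_rep M N x \<oplus>\<^bsub>M\<^esub> y) = coset_rep M N (x \<oplus>\<^bsub>M\<^esub> y)"
    by (rule *) fact+
  show "coset_rep M N (x \<oplus>\<^bsub>M\<^esub> coset_rep M N y) = coset_rep M N (x \<oplus>\<^bsub>M\<^esub> y)"
    using *[OF assms(4,3)] assms(3,4) coset_rep_closed[OF assms(1,2,4)]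
    by (simp add: M.a_comm)
qed

lemma coset_rep_smult:
  assumes "Module.module R M" "submodule N R M" "x \<in> carrier M" "r \<in> carrier R"
  shows "coset_rep M N (r \<odot>\<^bsub>M\<^esub> coset_rep M N x) = coset_rep M N (r \<odot>\<^bsub>M\<^esub> x)"
proof -
  interpret M: Module.module R M by fact
  show ?thesis
    by (rule coset_rep_hom[OF assms(1,2) assms(1,2) _ _ assms(3)])
       (auto intro: add_homsI simp: M.smult_r_distr assms submodule_facts[OF assms(1,2)])
qed

lemma quot_module_simps [simp]:
  "carrier (quot_module M N) = coset_rep M N ` carrier M"
  "\<zero>\<^bsub>quot_module M N\<^esub> = coset_rep M N \<zero>\<^bsub>M\<^esub>"
  "x \<oplus>\<^bsub>quot_module M N\<^esub> y = coset_rep M N (x \<oplus>\<^bsub>M\<^esub> y)"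
  "r \<odot>\<^bsub>quot_module M N\<^esub> x = coset_rep M N (r \<odot>\<^bsub>M\<^esub> x)"
  by (simp_all add: quot_module_def)

lemma quot_module_rep:
  assumes "Module.module R M" "submodule N R M" "x \<in> carrier M"
  shows "y \<in> carrier M \<Longrightarrow> coset_rep M N x \<oplus>\<^bsub>quot_module M N\<^esub> coset_rep M N y = coset_rep M N (x \<oplus>\<^bsub>M\<^esub> y)"
    and "r \<in> carrier R \<Longrightarrow> r \<odot>\<^bsub>quot_module M N\<^esub> coset_rep M N x = coset_rep M N (r \<odot>\<^bsub>M\<^esub> x)"
  using coset_rep_add[OF assms(1,2)] coset_rep_smult[OF assms] coset_rep_closed[OF assms] assms(3)
  by simp_all

lemma quot_module_module:
  assumes "Module.module R M" "submodule N R M"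
  shows "Module.module R (quot_module M N)"
proof -
  interpret M: Module.module R M by fact
  note c = quot_module_rep[OF assms]
  note [simp del] = quot_module_simps(3,4)
  have ag: "abelian_group (quot_module M N)"
  proof (rule abelian_groupI)
    fix x assume "x \<in> carrier (quot_module M N)"
    then obtain u where u: "u \<in> carrier M" "x = coset_rep M N u" by auto
    show "\<exists>y\<in>carrier (quot_module M N). y \<oplus>\<^bsub>quot_module M N\<^esub> x = \<zero>\<^bsub>quot_module M N\<^esub>"
      using u by (intro bexI[of _ "coset_rep M N (\<ominus>\<^bsub>M\<^esub> u)"]) (auto simp: c M.l_neg)
    show "x \<oplus>\<^bsub>quot_module M N\<^esub> y = y \<oplus>\<^bsub>quot_module M N\<^esub> x" if "y \<in> carrier (quot_module M N)" for y
      using that u by (auto simp: c M.a_comm)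
  qed (auto simp: c M.a_assoc)
  show ?thesis
    by (rule Module.moduleI[OF M.R.cring_axioms ag])
       (auto simp: c M.smult_l_distr M.smult_r_distr M.smult_assoc1)
qed

lemma coset_rep_linear:
  assumes "Module.module R M" "submodule N R M"
  shows "coset_rep M N \<in> linear_maps R M (quot_module M N)"
proof -
  interpret M: Module.module R M by fact
  note c = coset_rep_add[OF assms] coset_rep_smult[OF assms] coset_rep_closed[OF assms]
  show ?thesis by (rule linear_mapsI) (auto intro!: add_homsI simp: c)
qed

lemma coset_rep_zero_iff:
  assumes "Module.module R M" "submodule N R M" "x \<in> carrier M"
  shows "coset_rep M N x = \<zero>\<^bsub>quot_module M N\<^esub> \<longleftrightarrow> x \<in> N"
proof -
  interpret M: Module.module R M by fact
  show ?thesis using coset_rep_eq_iff[OF assms(1,2), of x "\<zero>\<^bsub>M\<^esub>"] assms(3) M.add.inv_one by (simp add: a_inv_def)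
qed

lemma linear_map_quot:
  assumes "Module.module R M" "submodule N R M" "Module.module R L" "submodule N' R L"
    and h: "h \<in> linear_maps R M L" "\<And>x. x \<in> N \<Longrightarrow> h x \<in> N'"
  shows "(\<lambda>x. coset_rep L N' (h x)) \<in> linear_maps R (quot_module M N) (quot_module L N')"
proof -
  interpret M: Module.module R M by fact
  interpret L: Module.module R L by fact
  note a = linear_maps_add_homs[OF h(1)]
  note [simp del] = quot_module_simps(3,4)
  note c = quot_module_rep[OF assms(3,4)] quot_module_rep[OF assms(1,2)]
    coset_rep_hom[OF assms(1-4) a h(2)] add_homs_closed[OF a] add_homs_add[OF a]
    linear_maps_smult[OF h(1)]
  show ?thesis
    by (rule linear_mapsI; (rule add_homsI)?) (auto simp: c)
qed

section \<open>Images, kernels, submodules and quotients of FI-modules\<close>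

definition fi_subobject ::
  "('a, 'x) ring_scheme \<Rightarrow> ('a, 'b) fi_mod \<Rightarrow> (nat set \<Rightarrow> 'b set) \<Rightarrow> bool" where
  "fi_subobject R V N \<longleftrightarrow> (\<forall>X. finite X \<longrightarrow> submodule (N X) R (fi_obj V X)) \<and>
     (\<forall>X Y f v. finite X \<longrightarrow> finite Y \<longrightarrow> f \<in> fi_hom X Y \<longrightarrow> v \<in> N X \<longrightarrow> fi_act V X Y f v \<in> N Y)"

lemma fi_subobject_submodule: "fi_subobject R V N \<Longrightarrow> finite X \<Longrightarrow> submodule (N X) R (fi_obj V X)"
  by (simp add: fi_subobject_def)

lemma fi_subobject_act:
  "fi_subobject R V N \<Longrightarrow> finite X \<Longrightarrow> finite Y \<Longrightarrow> f \<in> fi_hom X Y \<Longrightarrow> v \<in> N X \<Longrightarrow> fi_act V X Y f v \<in> N Y"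
  by (simp add: fi_subobject_def)

lemma fi_moduleI:
  assumes "cring R" "\<And>X. finite X \<Longrightarrow> Module.module R (fi_obj V X)"
    and "\<And>X Y f. finite X \<Longrightarrow> finite Y \<Longrightarrow> f \<in> fi_hom X Y \<Longrightarrow>
      fi_act V X Y f \<in> linear_maps R (fi_obj V X) (fi_obj V Y)"
    and "\<And>X v. finite X \<Longrightarrow> v \<in> carrier (fi_obj V X) \<Longrightarrow> fi_act V X X (\<lambda>x\<in>X. x) v = v"
    and "\<And>X Y Z f g v. finite X \<Longrightarrow> finite Y \<Longrightarrow> finite Z \<Longrightarrow> f \<in> fi_hom X Y \<Longrightarrow> g \<in> fi_hom Y Z \<Longrightarrow>
        v \<in> carrier (fi_obj V X) \<Longrightarrow>
        fi_act V X Z (compose X g f) v = fi_act V Y Z g (fi_act V X Y f v)"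
  shows "fi_module R V"
  using assms by (intro fi_module.intro fi_module_axioms.intro)

lemma fi_subobject_image:
  assumes \<phi>: "\<phi> \<in> fi_morphisms R U V" and U: "fi_module R U" and V: "fi_module R V"
  shows "fi_subobject R V (fi_image U \<phi>)"
proof -
  interpret U: fi_module R U by fact
  interpret V: fi_module R V by fact
  have "submodule (fi_image U \<phi> X) R (fi_obj V X)" if X: "finite X" for X
    unfolding fi_image_def
    by (rule linear_image_submodule[OF U.obj_module[OF X] V.obj_module[OF X] fi_morphisms_linear[OF \<phi> X]
          Module.module.carrier_is_submodule[OF U.obj_module[OF X]]])
  moreover have "fi_act V X Y f v \<in> fi_image U \<phi> Y"
    if "finite X" "finite Y" "f \<in> fi_hom X Y" "v \<in> fi_image U \<phi> X" for X Y f v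
    using that U.act_closed[OF that(1-3)]
    by (auto simp: fi_image_def fi_morphisms_natural[OF \<phi>, symmetric])
  ultimately show ?thesis by (simp add: fi_subobject_def)
qed

lemma fi_subobject_kernel:
  assumes \<phi>: "\<phi> \<in> fi_morphisms R V W" and V: "fi_module R V" and W: "fi_module R W"
  shows "fi_subobject R V (fi_kernel V W \<phi>)"
proof -
  interpret V: fi_module R V by fact
  interpret W: fi_module R W by fact
  have "submodule (fi_kernel V W \<phi> X) R (fi_obj V X)" if X: "finite X" for X
    using linear_vimage_submodule[OF V.obj_module[OF X] W.obj_module[OF X] fi_morphisms_linear[OF \<phi> X]
          zero_submodule[OF W.obj_module[OF X]]]
    by (simp add: fi_kernel_def)
  moreover have "fi_act V X Y f v \<in> fi_kernel V W \<phi> Y"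
    if "finite X" "finite Y" "f \<in> fi_hom X Y" "v \<in> fi_kernel V W \<phi> X" for X Y f v
    using that V.act_closed[OF that(1-3)]
    by (auto simp: fi_kernel_def fi_morphisms_natural[OF \<phi>] W.act_zero)
  ultimately show ?thesis by (simp add: fi_subobject_def)
qed

lemma fi_sub_simps [simp]:
  "fi_obj (fi_sub V N) X = (fi_obj V X)\<lparr>carrier := N X\<rparr>" "fi_act (fi_sub V N) = fi_act V"
  by (simp_all add: fi_sub_def)

lemma fi_sub_module:
  assumes V: "fi_module R V" and N: "fi_subobject R V N"
  shows "fi_module R (fi_sub V N)"
proof -
  interpret V: fi_module R V by fact
  have sub: "v \<in> N X \<Longrightarrow> v \<in> carrier (fi_obj V X)" if "finite X" for X v
    using submodule_facts(1)[OF V.obj_module[OF that] fi_subobject_submodule[OF N that]] .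
  show ?thesis
  proof (rule fi_moduleI)
    show "cring R" by (rule V.cring_axioms)
    fix X :: "nat set" assume X: "finite X"
    show "Module.module R (fi_obj (fi_sub V N) X)"
      using submodule.submodule_is_module[OF fi_subobject_submodule[OF N X] V.obj_module[OF X]] by simp
  next
    fix X Y :: "nat set" and f assume f: "finite X" "finite Y" "f \<in> fi_hom X Y"
    show "fi_act (fi_sub V N) X Y f \<in> linear_maps R (fi_obj (fi_sub V N) X) (fi_obj (fi_sub V N) Y)"
      using V.act_linear[OF f] sub[OF f(1)] fi_subobject_act[OF N f]
      by (auto simp: linear_maps_def)
  next
    fix X Y Z :: "nat set" and f g v assume "finite X" "finite Y" "finite Z" "f \<in> fi_hom X Y" "g \<in> fi_hom Y Z"
      "v \<in> carrier (fi_obj (fi_sub V N) X)"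
    then show "fi_act (fi_sub V N) X Z (compose X g f) v
      = fi_act (fi_sub V N) Y Z g (fi_act (fi_sub V N) X Y f v)"
      using V.act_compose[of X Y Z f g v] sub by simp
  qed (auto simp: sub V.act_id)
qed

lemma fi_sub_incl:
  assumes V: "fi_module R V" and N: "fi_subobject R V N"
  shows "(\<lambda>X v. v) \<in> fi_morphisms R (fi_sub V N) V"
proof -
  interpret V: fi_module R V by fact
  have sub: "v \<in> N X \<Longrightarrow> v \<in> carrier (fi_obj V X)" if "finite X" for X v
    using submodule_facts(1)[OF V.obj_module[OF that] fi_subobject_submodule[OF N that]] .
  show ?thesis by (rule fi_morphismsI) (auto simp: linear_maps_def sub)
qed

lemma fi_quot_simps [simp]:
  "fi_obj (fi_quot V N) X = quot_module (fi_obj V X) (N X)"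
  "fi_act (fi_quot V N) X Y f v = coset_rep (fi_obj V Y) (N Y) (fi_act V X Y f v)"
  by (simp_all add: fi_quot_def)

lemma fi_quot_module:
  assumes V: "fi_module R V" and N: "fi_subobject R V N"
  shows "fi_module R (fi_quot V N)"
proof -
  interpret V: fi_module R V by fact
  note M = V.obj_module fi_subobject_submodule[OF N]
  show ?thesis
  proof (rule fi_moduleI)
    show "cring R" by (rule V.cring_axioms)
    fix X :: "nat set" assume X: "finite X"
    show "Module.module R (fi_obj (fi_quot V N) X)"
      using quot_module_module[OF M(1)[OF X] M(2)[OF X]] by simp
  next
    fix X Y :: "nat set" and f assume f: "finite X" "finite Y" "f \<in> fi_hom X Y"
    show "fi_act (fi_quot V N) X Y f \<in> linear_maps R (fi_obj (fi_quot V N) X) (fi_obj (fi_quot V N) Y)"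
      using linear_map_quot[OF M(1)[OF f(1)] M(2)[OF f(1)] M(1)[OF f(2)] M(2)[OF f(2)] V.act_linear[OF f]
          fi_subobject_act[OF N f]]
      by (simp add: fi_quot_def)
  next
    fix X v assume X: "finite X" and v: "v \<in> carrier (fi_obj (fi_quot V N) X)"
    then show "fi_act (fi_quot V N) X X (\<lambda>x\<in>X. x) v = v"
      using coset_rep_closed[OF M(1)[OF X] M(2)[OF X]] coset_rep_idem[OF M(1)[OF X] M(2)[OF X]]
      by (auto simp: V.act_id)
  next
    fix X Y Z :: "nat set" and f g v assume *: "finite X" "finite Y" "finite Z" "f \<in> fi_hom X Y" "g \<in> fi_hom Y Z"
      "v \<in> carrier (fi_obj (fi_quot V N) X)"
    then have v: "v \<in> carrier (fi_obj V X)"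
      using coset_rep_closed[OF M(1)[OF *(1)] M(2)[OF *(1)]] by auto
    show "fi_act (fi_quot V N) X Z (compose X g f) v
      = fi_act (fi_quot V N) Y Z g (fi_act (fi_quot V N) X Y f v)"
      using coset_rep_hom[OF M(1)[OF *(2)] M(2)[OF *(2)] M(1)[OF *(3)] M(2)[OF *(3)]
          V.act_hom[OF *(2,3,5)] fi_subobject_act[OF N *(2,3,5)] V.act_closed[OF *(1,2,4) v]]
      by (simp add: V.act_compose[OF *(1-5) v])
  qed
qed

lemma fi_quot_proj:
  assumes V: "fi_module R V" and N: "fi_subobject R V N"
  shows "(\<lambda>X. coset_rep (fi_obj V X) (N X)) \<in> fi_morphisms R V (fi_quot V N)"
proof -
  interpret V: fi_module R V by fact
  note M = V.obj_module fi_subobject_submodule[OF N]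
  show ?thesis
  proof (rule fi_morphismsI)
    fix X Y f v assume *: "finite X" "finite Y" "f \<in> fi_hom X Y" "v \<in> carrier (fi_obj V X)"
    show "coset_rep (fi_obj V Y) (N Y) (fi_act V X Y f v)
      = fi_act (fi_quot V N) X Y f (coset_rep (fi_obj V X) (N X) v)"
      using coset_rep_hom[OF M(1)[OF *(1)] M(2)[OF *(1)] M(1)[OF *(2)] M(2)[OF *(2)] V.act_hom[OF *(1-3)]
          fi_subobject_act[OF N *(1-3)] *(4)] by simp
  qed (simp add: coset_rep_linear M)
qed

lemma fi_quot_proj_epi: "fi_epi V (fi_quot V N) (\<lambda>X. coset_rep (fi_obj V X) (N X))"
  by (simp add: fi_epi_def fi_image_def)

lemma fi_quot_map:
  assumes V: "fi_module R V" and N: "fi_subobject R V N" and W: "fi_module R W" and N': "fi_subobject R W N'"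
    and \<phi>: "\<phi> \<in> fi_morphisms R V W" "\<And>X v. finite X \<Longrightarrow> v \<in> N X \<Longrightarrow> \<phi> X v \<in> N' X"
  shows "(\<lambda>X v. coset_rep (fi_obj W X) (N' X) (\<phi> X v)) \<in> fi_morphisms R (fi_quot V N) (fi_quot W N')"
proof -
  interpret V: fi_module R V by fact
  interpret W: fi_module R W by fact
  note M = V.obj_module fi_subobject_submodule[OF N]
  note M' = W.obj_module fi_subobject_submodule[OF N']
  show ?thesis
  proof (rule fi_morphismsI)
    fix X :: "nat set" assume X: "finite X"
    show "(\<lambda>v. coset_rep (fi_obj W X) (N' X) (\<phi> X v))
      \<in> linear_maps R (fi_obj (fi_quot V N) X) (fi_obj (fi_quot W N') X)"
      using linear_map_quot[OF M(1)[OF X] M(2)[OF X] M'(1)[OF X] M'(2)[OF X]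
          fi_morphisms_linear[OF \<phi>(1) X] \<phi>(2)[OF X]] by simp
  next
    fix X Y f v assume *: "finite X" "finite Y" "f \<in> fi_hom X Y" "v \<in> carrier (fi_obj (fi_quot V N) X)"
    then have v: "v \<in> carrier (fi_obj V X)"
      using coset_rep_closed[OF M(1)[OF *(1)] M(2)[OF *(1)]] by auto
    have "coset_rep (fi_obj W Y) (N' Y) (\<phi> Y (coset_rep (fi_obj V Y) (N Y) (fi_act V X Y f v)))
      = coset_rep (fi_obj W Y) (N' Y) (\<phi> Y (fi_act V X Y f v))"
      by (rule coset_rep_hom[OF M(1)[OF *(2)] M(2)[OF *(2)] M'(1)[OF *(2)] M'(2)[OF *(2)]
          fi_morphisms_hom[OF \<phi>(1) *(2)] \<phi>(2)[OF *(2)] V.act_closed[OF *(1-3) v]])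
    also have "\<dots> = coset_rep (fi_obj W Y) (N' Y) (fi_act W X Y f (\<phi> X v))"
      by (simp add: fi_morphisms_natural[OF \<phi>(1) *(1-3) v])
    also have "\<dots> = coset_rep (fi_obj W Y) (N' Y) (fi_act W X Y f (coset_rep (fi_obj W X) (N' X) (\<phi> X v)))"
      by (rule coset_rep_hom[OF M'(1)[OF *(1)] M'(2)[OF *(1)] M'(1)[OF *(2)] M'(2)[OF *(2)]
          W.act_hom[OF *(1-3)] fi_subobject_act[OF N' *(1-3)]
          fi_morphisms_closed[OF \<phi>(1) *(1) v], symmetric])
    finally show "coset_rep (fi_obj W Y) (N' Y) (\<phi> Y (fi_act (fi_quot V N) X Y f v))
      = fi_act (fi_quot W N') X Y f (coset_rep (fi_obj W X) (N' X) (\<phi> X v))"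
      by simp
  qed
qed

text \<open>No injectivity of \<open>i\<close> is included, because V -> S V -> D V -> 0 has to be
  an instance.\<close>

definition fi_right_exact ::
  "('a, 'x) ring_scheme \<Rightarrow> ('a, 'b) fi_mod \<Rightarrow> ('b, 'c) fi_map \<Rightarrow> ('a, 'c) fi_mod \<Rightarrow> ('c, 'd) fi_map
    \<Rightarrow> ('a, 'd) fi_mod \<Rightarrow> bool" where
  "fi_right_exact R U i V q D \<longleftrightarrow> fi_module R U \<and> fi_module R V \<and> fi_module R D \<and>
     i \<in> fi_morphisms R U V \<and> q \<in> fi_morphisms R V D \<and> fi_exact U i V q D \<and> fi_epi V D q"

definition fi_deriv_proj :: "('a, 'b) fi_mod \<Rightarrow> ('b, 'b) fi_map" where
  "fi_deriv_proj V X = coset_rep (fi_obj V (add_star X)) (fi_image V (fi_iota V) X)"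

lemma fi_iota_subobject:
  "fi_module R V \<Longrightarrow> fi_subobject R (fi_shift V) (fi_image V (fi_iota V))"
  by (intro fi_subobject_image fi_iota_morphism fi_shift_module)

lemma fi_deriv_module: "fi_module R V \<Longrightarrow> fi_module R (fi_deriv V)"
  unfolding fi_deriv_def by (intro fi_quot_module fi_shift_module fi_iota_subobject)

lemma fi_deriv_right_exact:
  assumes V: "fi_module R V"
  shows "fi_right_exact R V (fi_iota V) (fi_shift V) (fi_deriv_proj V) (fi_deriv V)"
proof -
  note S = fi_shift_module[OF V]
  have "fi_deriv_proj V \<in> fi_morphisms R (fi_shift V) (fi_deriv V)"
    using fi_quot_proj[OF S fi_iota_subobject[OF V]]
    by (simp add: fi_deriv_def fi_deriv_proj_def[abs_def])
  moreover have "fi_epi (fi_shift V) (fi_deriv V) (fi_deriv_proj V)"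
    using fi_quot_proj_epi[of "fi_shift V" "fi_image V (fi_iota V)"]
    by (simp add: fi_deriv_def fi_deriv_proj_def[abs_def])
  moreover have "fi_exact V (fi_iota V) (fi_shift V) (fi_deriv_proj V) (fi_deriv V)"
    unfolding fi_exact_def
  proof (intro allI impI)
    fix X :: "nat set" assume X: "finite X"
    note sub = fi_subobject_submodule[OF fi_iota_subobject[OF V] X]
    note m = fi_module.obj_module[OF S X]
    show "fi_image V (fi_iota V) X = fi_kernel (fi_shift V) (fi_deriv V) (fi_deriv_proj V) X"
      using coset_rep_zero_iff[OF m sub] submodule_facts(1)[OF m sub]
      by (auto simp: fi_kernel_def fi_deriv_def fi_deriv_proj_def)
  qed
  ultimately show ?thesis
    using V by (simp add: fi_right_exact_def S fi_deriv_module fi_iota_morphism)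
qed

section \<open>Exactness of the Koszul complex\<close>

lemma (in abelian_group) neg_zero: "\<ominus> \<zero> = \<zero>"
  by (rule minus_equality) simp_all

text \<open>Vanishing of the a-th Koszul homology of V on a set of size n, the form in which all
  degree bounds are derived.\<close>

definition koszul_exact :: "nat \<Rightarrow> ('a, 'b) fi_mod \<Rightarrow> int \<Rightarrow> bool" where
  "koszul_exact n V a \<longleftrightarrow> (\<forall>x\<in>kz_part n V a. kz_d n V x = \<zero>\<^bsub>kz n V\<^esub> \<longrightarrow>
     (\<exists>y\<in>kz_part n V (a + 1). kz_d n V y = x))"

lemma koszul_exactD:
  "koszul_exact n V a \<Longrightarrow> x \<in> kz_part n V a \<Longrightarrow> kz_d n V x = \<zero>\<^bsub>kz n V\<^esub> \<Longrightarrow>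
    \<exists>y\<in>kz_part n V (a + 1). kz_d n V y = x"
  by (simp add: koszul_exact_def)

lemma koszul_exact_0: "a \<noteq> 0 \<Longrightarrow> koszul_exact 0 V a"
  by (auto simp: koszul_exact_def)

text \<open>The complex of D is that of V modulo the image of that of U. A cycle of D lifts to a
  relative cycle s, with differential in this image, and it bounds exactly when s is a boundary up
  to this image. The right side makes sense for a noninjective \<open>i\<close>, in particular for
  \<open>fi_iota\<close>.\<close>

lemma koszul_exact_quotient_iff:
  assumes "fi_right_exact R U i V q D"
  shows "koszul_exact n D a \<longleftrightarrow>
    (\<forall>s\<in>kz_part n V a. \<forall>u\<in>kz_part n U (a - 1). kz_d n V s = kz_map n i u \<longrightarrow>
       (\<exists>t\<in>kz_part n V (a + 1). \<exists>w\<in>kz_part n U a. s = kz_d n V t \<oplus>\<^bsub>kz n V\<^esub> kz_map n i w))"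
    (is "?L \<longleftrightarrow> ?R")
proof -
  have U: "fi_module R U" and V: "fi_module R V" and D: "fi_module R D"
    and i: "i \<in> fi_morphisms R U V" and q: "q \<in> fi_morphisms R V D"
    and ex: "fi_exact U i V q D" and epi: "fi_epi V D q"
    using assms by (auto simp: fi_right_exact_def)
  interpret GV: abelian_group "kz n V" by (rule kz_group[OF V])
  interpret GD: abelian_group "kz n D" by (rule kz_group[OF D])
  note cV = kz_part_carrier[OF _ V] and cU = kz_part_carrier[OF _ U]
  note dV = add_homs_closed[OF kz_d_hom[OF V]] and dU = add_homs_closed[OF kz_d_hom[OF U]]
  note qh = kz_map_hom[OF q V D, of n] and ih = kz_map_hom[OF i U V, of n]
  note qc = add_homs_closed[OF qh] and ic = add_homs_closed[OF ih]
  note qi = kz_map_exact_zero[OF i q U V D ex]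
  show ?thesis
  proof
    assume L: ?L
    show ?R
    proof (intro ballI impI)
      fix s u assume s: "s \<in> kz_part n V a" and u: "u \<in> kz_part n U (a - 1)"
        and eq: "kz_d n V s = kz_map n i u"
      have "kz_d n D (kz_map n q s) = \<zero>\<^bsub>kz n D\<^esub>"
        using kz_d_natural[OF q V D cV[OF s]] eq qi[OF cU[OF u]] by simp
      from koszul_exactD[OF L kz_map_part[OF q V D s] this]
      obtain y where y: "y \<in> kz_part n D (a + 1)" "kz_d n D y = kz_map n q s" by blast
      obtain t where t: "t \<in> kz_part n V (a + 1)" "kz_map n q t = y"
        using kz_map_part_surj[OF q V D epi y(1)] by blast
      have dt: "kz_d n V t \<in> kz_part n V a" using kz_d_part[OF V t(1)] by simp
      let ?x = "s \<oplus>\<^bsub>kz n V\<^esub> \<ominus>\<^bsub>kz n V\<^esub> kz_d n V t"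
      have x: "?x \<in> kz_part n V a"
        by (intro kz_part_add[OF V] kz_part_neg[OF V] s dt)
      have "kz_map n q ?x = \<zero>\<^bsub>kz n D\<^esub>"
        using kz_d_natural[OF q V D cV[OF t(1)]] t(2) y(2) cV[OF s] cV[OF dt] qc[OF cV[OF s]]
        by (simp add: add_homs_add[OF qh] add_homs_neg[OF qh kz_group[OF V] kz_group[OF D]] GD.r_neg)
      from kz_map_part_exact[OF i q U V D ex x this]
      obtain w where w: "w \<in> kz_part n U a" "kz_map n i w = ?x" by blast
      have "s = kz_d n V t \<oplus>\<^bsub>kz n V\<^esub> kz_map n i w"
        using w(2) cV[OF s] cV[OF dt] ic[OF cU[OF w(1)]] by (subst GV.eq_add_iff) auto
      with t(1) w(1) show "\<exists>t\<in>kz_part n V (a + 1). \<exists>w\<in>kz_part n U a.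
          s = kz_d n V t \<oplus>\<^bsub>kz n V\<^esub> kz_map n i w" by blast
    qed
  next
    assume R: ?R
    show ?L
      unfolding koszul_exact_def
    proof (intro ballI impI)
      fix y assume y: "y \<in> kz_part n D a" "kz_d n D y = \<zero>\<^bsub>kz n D\<^esub>"
      obtain s where s: "s \<in> kz_part n V a" "kz_map n q s = y"
        using kz_map_part_surj[OF q V D epi y(1)] by blast
      have "kz_map n q (kz_d n V s) = \<zero>\<^bsub>kz n D\<^esub>"
        using kz_d_natural[OF q V D cV[OF s(1)]] s(2) y(2) by simp
      from kz_map_part_exact[OF i q U V D ex kz_d_part[OF V s(1)] this]
      obtain u where "u \<in> kz_part n U (a - 1)" "kz_map n i u = kz_d n V s" by blast
      then obtain t w where t: "t \<in> kz_part n V (a + 1)" and w: "w \<in> kz_part n U a"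
        and eq: "s = kz_d n V t \<oplus>\<^bsub>kz n V\<^esub> kz_map n i w"
        using R s(1) by metis
      have "y = kz_d n D (kz_map n q t)"
        unfolding s(2)[symmetric] eq
        using kz_d_natural[OF q V D cV[OF t]] qi[OF cU[OF w]] qc[OF dV[OF cV[OF t]]]
        by (simp add: add_homs_add[OF qh dV[OF cV[OF t]] ic[OF cU[OF w]]])
      then show "\<exists>x\<in>kz_part n D (a + 1). kz_d n D x = y"
        using kz_map_part[OF q V D t] by metis
    qed
  qed
qed

text \<open>The following two lemmas replace the long exact sequence of a short exact sequence.\<close>

lemma koszul_boundary_lift:
  assumes re: "fi_right_exact R U i V q D" and mono: "fi_mono U i"
    and ex: "koszul_exact n D (a + 1)"
    and z: "z \<in> kz_part n U a" and p: "p \<in> kz_part n V (a + 1)" "kz_d n V p = kz_map n i z"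
  shows "\<exists>y\<in>kz_part n U (a + 1). kz_d n U y = z"
proof -
  have U: "fi_module R U" and V: "fi_module R V" and i: "i \<in> fi_morphisms R U V"
    using re by (auto simp: fi_right_exact_def)
  interpret GU: abelian_group "kz n U" by (rule kz_group[OF U])
  interpret GV: abelian_group "kz n V" by (rule kz_group[OF V])
  note cV = kz_part_carrier[OF _ V] and cU = kz_part_carrier[OF _ U]
  note dV = add_homs_closed[OF kz_d_hom[OF V]] and dU = add_homs_closed[OF kz_d_hom[OF U]]
  note ih = kz_map_hom[OF i U V, of n] and ic = add_homs_closed[OF kz_map_hom[OF i U V, of n]]
  \<comment> \<open>p is a relative cycle for D, its differential being the image of z. After d t is
    subtracted from p, only the image of w is left, and w is the chain sought.\<close>
  obtain t w where t: "t \<in> kz_part n V (a + 1 + 1)" and w: "w \<in> kz_part n U (a + 1)"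
    and eq: "p = kz_d n V t \<oplus>\<^bsub>kz n V\<^esub> kz_map n i w"
    using ex[unfolded koszul_exact_quotient_iff[OF re], rule_format, OF p(1) _ p(2)] z by auto
  have "kz_map n i z = kz_map n i (kz_d n U w)"
    using p(2) unfolding eq
    by (simp add: add_homs_add[OF kz_d_hom[OF V]] dV cV[OF t] ic dU cU[OF w] kz_d_d[OF V]
        kz_d_natural[OF i U V])
  then have "kz_map n i (z \<oplus>\<^bsub>kz n U\<^esub> \<ominus>\<^bsub>kz n U\<^esub> kz_d n U w) = \<zero>\<^bsub>kz n V\<^esub>"
    by (simp add: add_homs_add[OF ih] add_homs_neg[OF ih kz_group[OF U] kz_group[OF V]]
        cU[OF z] dU cU[OF w] ic GV.r_neg)
  then have "z \<oplus>\<^bsub>kz n U\<^esub> \<ominus>\<^bsub>kz n U\<^esub> kz_d n U w = \<zero>\<^bsub>kz n U\<^esub>"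
  proof (rule kz_map_part_inj[OF U i, rotated -1])
    show "z \<oplus>\<^bsub>kz n U\<^esub> \<ominus>\<^bsub>kz n U\<^esub> kz_d n U w \<in> kz_part n U a"
      using kz_d_part[OF U w] by (intro kz_part_add[OF U] kz_part_neg[OF U] z) simp
    fix m v assume v: "v \<in> carrier (fi_obj U {0..<m})" "i {0..<m} v = \<zero>\<^bsub>fi_obj V {0..<m}\<^esub>"
    interpret M: abelian_group "fi_obj U {0..<m}" using U by (intro fi_module.obj_group) auto
    show "v = \<zero>\<^bsub>fi_obj U {0..<m}\<^esub>"
      using mono v fi_morphisms_zero[OF i U V, of "{0..<m}"]
      by (auto simp: fi_mono_def dest!: spec[of _ "{0..<m}"] intro: inj_onD)
  qed
  then have "kz_d n U w = z"
    using GU.sum_zero_iff[OF cU[OF z]] dU[OF cU[OF w]] by simp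
  with w show ?thesis by blast
qed

lemma koszul_exact_one:
  assumes re: "fi_right_exact R U i V q D" and U0: "koszul_exact n U 0" and V1: "koszul_exact n V 1"
  shows "koszul_exact n D 1"
  unfolding koszul_exact_quotient_iff[OF re]
proof (intro ballI impI)
  have U: "fi_module R U" and V: "fi_module R V" and i: "i \<in> fi_morphisms R U V"
    using re by (auto simp: fi_right_exact_def)
  interpret GU: abelian_group "kz n U" by (rule kz_group[OF U])
  interpret GV: abelian_group "kz n V" by (rule kz_group[OF V])
  note cV = kz_part_carrier[OF _ V] and cU = kz_part_carrier[OF _ U]
  note dV = add_homs_closed[OF kz_d_hom[OF V]] and dU = add_homs_closed[OF kz_d_hom[OF U]]
  note ih = kz_map_hom[OF i U V, of n] and ic = add_homs_closed[OF kz_map_hom[OF i U V, of n]]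
  fix s u assume s: "s \<in> kz_part n V 1" and u: "u \<in> kz_part n U (1 - 1)"
    and eq: "kz_d n V s = kz_map n i u"
  \<comment> \<open>u has degree 0, hence is a cycle, and exactness for U makes it a boundary d y;
    subtracting the image of y turns the relative cycle s into a cycle of V.\<close>
  have "kz_d n U u = \<zero>\<^bsub>kz n U\<^esub>"
    using kz_part_neg_degree[OF U kz_d_part[OF U u]] by simp
  with U0 u obtain y where y: "y \<in> kz_part n U 1" "kz_d n U y = u"
    by (auto dest: koszul_exactD)
  have iy: "kz_map n i y \<in> kz_part n V 1" by (rule kz_map_part[OF i U V y(1)])
  let ?x = "s \<oplus>\<^bsub>kz n V\<^esub> \<ominus>\<^bsub>kz n V\<^esub> kz_map n i y"
  have "?x \<in> kz_part n V 1" by (intro kz_part_add[OF V] kz_part_neg[OF V] s iy)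
  moreover have "kz_d n V ?x = \<zero>\<^bsub>kz n V\<^esub>"
    using kz_d_natural[OF i U V cU[OF y(1)]] y(2) eq cV[OF s] cV[OF iy] dV[OF cV[OF s]]
    by (simp add: add_homs_add[OF kz_d_hom[OF V]]
        add_homs_neg[OF kz_d_hom[OF V] kz_group[OF V] kz_group[OF V]] GV.r_neg)
  ultimately obtain t where t: "t \<in> kz_part n V (1 + 1)" "kz_d n V t = ?x"
    using koszul_exactD[OF V1] by blast
  have "s = kz_d n V t \<oplus>\<^bsub>kz n V\<^esub> kz_map n i y"
    unfolding t(2) using cV[OF s] cV[OF iy] by (simp add: GV.a_assoc GV.l_neg)
  with t(1) y(1) show "\<exists>t\<in>kz_part n V (1 + 1). \<exists>w\<in>kz_part n U 1.
      s = kz_d n V t \<oplus>\<^bsub>kz n V\<^esub> kz_map n i w" by blast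
qed

text \<open>Absence in degree n of the torsion that \<open>fi_td\<close> measures; the equivalence
  is \<open>fi_torsion_iff\<close>.\<close>

definition iota_inj :: "('a, 'b) fi_mod \<Rightarrow> nat \<Rightarrow> bool" where
  "iota_inj V n \<longleftrightarrow> (\<forall>v\<in>carrier (fi_obj V {0..<n}).
     fi_iota V {0..<n} v = \<zero>\<^bsub>fi_obj V {0..<Suc n}\<^esub> \<longrightarrow> v = \<zero>\<^bsub>fi_obj V {0..<n}\<^esub>)"

text \<open>This is hd_a(V) <= max(td(V) + a, hd_a(D V) + 1). A cycle (s, v) of the cone satisfies d
  s = - iota v, so s is a relative cycle for D V and s = d t + iota w. Then d w + v lies in the
  kernel of iota, on values of V at sets of size n - (a - 1); injectivity there gives (s, v) = d (t,
  w).\<close>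

lemma koszul_exact_Suc:
  assumes V: "fi_module R V" and inj: "\<And>m. int m = int n - (a - 1) \<Longrightarrow> iota_inj V m"
    and ex: "koszul_exact n (fi_deriv V) a"
  shows "koszul_exact (Suc n) V a"
  unfolding koszul_exact_def
proof (intro ballI impI)
  note S = fi_shift_module[OF V] and i = fi_iota_morphism[OF V]
  interpret GV: abelian_group "kz n V" by (rule kz_group[OF V])
  interpret GS: abelian_group "kz n (fi_shift V)" by (rule kz_group[OF S])
  note cV = kz_part_carrier[OF _ V] and cS = kz_part_carrier[OF _ S]
  note dV = add_homs_closed[OF kz_d_hom[OF V]] and dS = add_homs_closed[OF kz_d_hom[OF S]]
  note ih = kz_iota_hom[OF V, of n] and ic = add_homs_closed[OF kz_iota_hom[OF V, of n]]
  fix x assume x: "x \<in> kz_part (Suc n) V a" "kz_d (Suc n) V x = \<zero>\<^bsub>kz (Suc n) V\<^esub>"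
  then obtain s v where sv: "x = Node s v" "s \<in> kz_part n (fi_shift V) a" "v \<in> kz_part n V (a - 1)"
    by auto
  note [simp] = cV[OF sv(3)] cS[OF sv(2)]
  have 1: "kz_d n (fi_shift V) s \<oplus>\<^bsub>kz n (fi_shift V)\<^esub> kz_map n (fi_iota V) v = \<zero>\<^bsub>kz n (fi_shift V)\<^esub>"
    using x sv by simp
  then have 2: "kz_d n (fi_shift V) s = kz_map n (fi_iota V) (\<ominus>\<^bsub>kz n V\<^esub> v)"
    by (simp add: add_homs_neg[OF ih kz_group[OF V] kz_group[OF S]] GS.sum_zero_iff dS ic)
  obtain t w where t: "t \<in> kz_part n (fi_shift V) (a + 1)" and w: "w \<in> kz_part n V a"
    and eq: "s = kz_d n (fi_shift V) t \<oplus>\<^bsub>kz n (fi_shift V)\<^esub> kz_map n (fi_iota V) w"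
    using ex[unfolded koszul_exact_quotient_iff[OF fi_deriv_right_exact[OF V]], rule_format,
        OF sv(2) kz_part_neg[OF V sv(3)] 2] by blast
  note [simp] = cV[OF w] cS[OF t]
  have "kz_d n (fi_shift V) s = kz_map n (fi_iota V) (kz_d n V w)"
    unfolding eq
    by (simp add: add_homs_add[OF kz_d_hom[OF S]] dS ic kz_d_d[OF S] kz_d_natural[OF i V S] dV)
  with 1 have "kz_map n (fi_iota V) (kz_d n V w \<oplus>\<^bsub>kz n V\<^esub> v) = \<zero>\<^bsub>kz n (fi_shift V)\<^esub>"
    by (simp add: add_homs_add[OF ih] dV)
  then have "kz_d n V w \<oplus>\<^bsub>kz n V\<^esub> v = \<zero>\<^bsub>kz n V\<^esub>"
  proof (rule kz_map_part_inj[OF V i, rotated -1])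
    show "kz_d n V w \<oplus>\<^bsub>kz n V\<^esub> v \<in> kz_part n V (a - 1)"
      by (intro kz_part_add[OF V] kz_d_part[OF V] w sv)
  qed (use inj in \<open>auto simp: iota_inj_def\<close>)
  then have "v = \<ominus>\<^bsub>kz n V\<^esub> kz_d n V w"
    by (subst GV.sum_zero_iff[symmetric]) (auto simp: dV GV.a_comm)
  then have "kz_d (Suc n) V (Node t w) = x"
    using sv(1) eq by simp
  moreover have "Node t w \<in> kz_part (Suc n) V (a + 1)" using t w by simp
  ultimately show "\<exists>y\<in>kz_part (Suc n) V (a + 1). kz_d (Suc n) V y = x" by blast
qed

text \<open>This is td(V) <= max(hd_2(D V), hd_1(V) - 1). If iota kills u, then (0, u) is a cycle of
  the cone, hence equals d (s, v). Exactness for D V in degree 2 yields w such that iota kills d w +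
  v; the differential vanishes on such elements, so d v = 0, whereas u = - d v.\<close>

lemma koszul_exact_iota_inj:
  assumes V: "fi_module R V" and D2: "koszul_exact n (fi_deriv V) 2"
    and V1: "koszul_exact (Suc n) V 1"
  shows "iota_inj V n"
  unfolding iota_inj_def
proof (intro ballI impI)
  note S = fi_shift_module[OF V] and i = fi_iota_morphism[OF V]
  interpret GV: abelian_group "kz n V" by (rule kz_group[OF V])
  interpret GS: abelian_group "kz n (fi_shift V)" by (rule kz_group[OF S])
  note cV = kz_part_carrier[OF _ V] and cS = kz_part_carrier[OF _ S]
  note dV = add_homs_closed[OF kz_d_hom[OF V]] and dS = add_homs_closed[OF kz_d_hom[OF S]]
  note ih = kz_iota_hom[OF V, of n] and ic = add_homs_closed[OF kz_iota_hom[OF V, of n]]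
  fix u assume u: "u \<in> carrier (fi_obj V {0..<n})" "fi_iota V {0..<n} u = \<zero>\<^bsub>fi_obj V {0..<Suc n}\<^esub>"
  let ?u = "kz_unit n V u"
  have uz: "kz_unit n W \<zero>\<^bsub>fi_obj W {0..<n}\<^esub> = \<zero>\<^bsub>kz n W\<^esub>" if "fi_module R W" for W :: "('a, 'c) fi_mod"
    by (rule add_homs_zero[OF kz_unit_hom[OF that] fi_module.obj_group[OF that] kz_group[OF that]]) simp
  have up: "?u \<in> kz_part n V 0" by (rule kz_unit_part[OF V u(1)])
  have ui: "kz_map n (fi_iota V) ?u = \<zero>\<^bsub>kz n (fi_shift V)\<^esub>"
    using kz_map_unit[OF i V S] uz[OF S] u(2) by simp
  have du: "kz_d n V ?u = \<zero>\<^bsub>kz n V\<^esub>" by (rule kz_d_iota_zero[OF V cV[OF up] ui])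
  have "Node \<zero>\<^bsub>kz n (fi_shift V)\<^esub> ?u \<in> kz_part (Suc n) V 1"
    using up kz_part_zero[OF S] by simp
  moreover have "kz_d (Suc n) V (Node \<zero>\<^bsub>kz n (fi_shift V)\<^esub> ?u) = \<zero>\<^bsub>kz (Suc n) V\<^esub>"
    using ui du add_homs_zero[OF kz_d_hom[OF S] kz_group[OF S] kz_group[OF S]]
    by (simp add: GV.neg_zero)
  ultimately obtain y where y: "y \<in> kz_part (Suc n) V (1 + 1)"
    "kz_d (Suc n) V y = Node \<zero>\<^bsub>kz n (fi_shift V)\<^esub> ?u"
    using koszul_exactD[OF V1] by blast
  then obtain s v where sv: "y = Node s v" "s \<in> kz_part n (fi_shift V) 2" "v \<in> kz_part n V 1"
    by auto
  note [simp] = cV[OF sv(3)] cS[OF sv(2)]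
  have 1: "kz_d n (fi_shift V) s \<oplus>\<^bsub>kz n (fi_shift V)\<^esub> kz_map n (fi_iota V) v = \<zero>\<^bsub>kz n (fi_shift V)\<^esub>"
    and 3: "\<ominus>\<^bsub>kz n V\<^esub> kz_d n V v = ?u"
    using y(2) sv(1) by simp_all
  from 1 have 2: "kz_d n (fi_shift V) s = kz_map n (fi_iota V) (\<ominus>\<^bsub>kz n V\<^esub> v)"
    by (simp add: add_homs_neg[OF ih kz_group[OF V] kz_group[OF S]] GS.sum_zero_iff dS ic)
  have "\<ominus>\<^bsub>kz n V\<^esub> v \<in> kz_part n V (2 - 1)" using kz_part_neg[OF V sv(3)] by simp
  from D2[unfolded koszul_exact_quotient_iff[OF fi_deriv_right_exact[OF V]], rule_format,
        OF sv(2) this 2]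
  obtain t w where t: "t \<in> kz_part n (fi_shift V) (2 + 1)" and w: "w \<in> kz_part n V 2"
    and eq: "s = kz_d n (fi_shift V) t \<oplus>\<^bsub>kz n (fi_shift V)\<^esub> kz_map n (fi_iota V) w"
    by blast
  note [simp] = cV[OF w] cS[OF t]
  have "kz_d n (fi_shift V) s = kz_map n (fi_iota V) (kz_d n V w)"
    unfolding eq
    by (simp add: add_homs_add[OF kz_d_hom[OF S]] dS ic kz_d_d[OF S] kz_d_natural[OF i V S] dV)
  with 1 have "kz_map n (fi_iota V) (kz_d n V w \<oplus>\<^bsub>kz n V\<^esub> v) = \<zero>\<^bsub>kz n (fi_shift V)\<^esub>"
    by (simp add: add_homs_add[OF ih] dV)
  \<comment> \<open>The differential vanishes on the kernel of iota; the same fact made (0, u) a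
    cycle above.\<close>
  from kz_d_iota_zero[OF V _ this] have "kz_d n V v = \<zero>\<^bsub>kz n V\<^esub>"
    by (simp add: add_homs_add[OF kz_d_hom[OF V]] dV kz_d_d[OF V])
  with 3 have "?u = \<zero>\<^bsub>kz n V\<^esub>" by (simp add: GV.neg_zero)
  with uz[OF V] show "u = \<zero>\<^bsub>fi_obj V {0..<n}\<^esub>" by (metis kz_unit_inj)
qed

text \<open>For a <= 1 the component u has degree at most 0 and is automatically a cycle, so a
  relative cycle for D V is a cycle of the cone; in the long exact sequence the obstruction is
  H_{a-2}(K V) = 0. For a = 0 and a = 1 this lowers the degrees of generators and of relations by
  one.\<close>

lemma koszul_exact_deriv:
  assumes V: "fi_module R V" and a: "a \<le> 1" and ex: "koszul_exact (Suc n) V a"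
  shows "koszul_exact n (fi_deriv V) a"
  unfolding koszul_exact_quotient_iff[OF fi_deriv_right_exact[OF V]]
proof (intro ballI impI)
  note S = fi_shift_module[OF V] and i = fi_iota_morphism[OF V]
  interpret GV: abelian_group "kz n V" by (rule kz_group[OF V])
  interpret GS: abelian_group "kz n (fi_shift V)" by (rule kz_group[OF S])
  note cV = kz_part_carrier[OF _ V] and cS = kz_part_carrier[OF _ S]
  note ih = kz_iota_hom[OF V, of n] and ic = add_homs_closed[OF kz_iota_hom[OF V, of n]]
  fix s u assume s: "s \<in> kz_part n (fi_shift V) a" and u: "u \<in> kz_part n V (a - 1)"
    and eq: "kz_d n (fi_shift V) s = kz_map n (fi_iota V) u"
  let ?x = "Node s (\<ominus>\<^bsub>kz n V\<^esub> u)"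
  have "kz_d n V (\<ominus>\<^bsub>kz n V\<^esub> u) = \<zero>\<^bsub>kz n V\<^esub>"
    using kz_part_neg_degree[OF V kz_d_part[OF V kz_part_neg[OF V u]]] a by simp
  then have "kz_d (Suc n) V ?x = \<zero>\<^bsub>kz (Suc n) V\<^esub>"
    using eq cV[OF u]
    by (simp add: add_homs_neg[OF ih kz_group[OF V] kz_group[OF S]] GS.r_neg ic GV.neg_zero)
  moreover have "?x \<in> kz_part (Suc n) V a" using s kz_part_neg[OF V u] by simp
  ultimately obtain y where "y \<in> kz_part (Suc n) V (a + 1)" "kz_d (Suc n) V y = ?x"
    using koszul_exactD[OF ex] by blast
  then show "\<exists>t\<in>kz_part n (fi_shift V) (a + 1). \<exists>w\<in>kz_part n V a.
      s = kz_d n (fi_shift V) t \<oplus>\<^bsub>kz n (fi_shift V)\<^esub> kz_map n (fi_iota V) w"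
    by (cases y) (simp, simp, blast)
qed

text \<open>Nakayama's lemma for FI-modules: once V vanishes on all smaller sets, the part of degree
  1 is zero, so only zero can be a boundary in degree 0.\<close>

lemma koszul_exact_all_zero:
  assumes V: "fi_module R V" and ex: "\<And>n. koszul_exact n V 0"
  shows "v \<in> carrier (fi_obj V {0..<n}) \<Longrightarrow> v = \<zero>\<^bsub>fi_obj V {0..<n}\<^esub>"
proof (induction n arbitrary: v rule: less_induct)
  case (less n)
  have up: "kz_unit n V v \<in> kz_part n V 0" by (rule kz_unit_part[OF V less.prems])
  have "kz_d n V (kz_unit n V v) = \<zero>\<^bsub>kz n V\<^esub>"
    using kz_part_neg_degree[OF V kz_d_part[OF V up]] by simp
  then obtain y where y: "y \<in> kz_part n V (0 + 1)" "kz_d n V y = kz_unit n V v"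
    using koszul_exactD[OF ex up] by blast
  have "y = \<zero>\<^bsub>kz n V\<^esub>"
    by (rule kz_part_trivial[OF V _ y(1)]) (use less.IH in auto)
  then have "kz_unit n V v = \<zero>\<^bsub>kz n V\<^esub>"
    using y(2) add_homs_zero[OF kz_d_hom[OF V] kz_group[OF V] kz_group[OF V]] by simp
  also have "\<dots> = kz_unit n V \<zero>\<^bsub>fi_obj V {0..<n}\<^esub>"
    using add_homs_zero[OF kz_unit_hom[OF V] fi_module.obj_group[OF V] kz_group[OF V], of n] by simp
  finally show ?case by (simp add: kz_unit_inj)
qed

section \<open>Degree bounds\<close>

lemma koszul_exact_trivial:
  assumes V: "fi_module R V" and z: "\<And>n v. v \<in> carrier (fi_obj V {0..<n}) \<Longrightarrow> v = \<zero>\<^bsub>fi_obj V {0..<n}\<^esub>"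
  shows "koszul_exact n V a"
  unfolding koszul_exact_def
proof (intro ballI impI)
  fix x assume "x \<in> kz_part n V a"
  then have "x = \<zero>\<^bsub>kz n V\<^esub>" by (rule kz_part_trivial[OF V, rotated]) (rule z)
  then show "\<exists>y\<in>kz_part n V (a + 1). kz_d n V y = x"
    using kz_part_zero[OF V] add_homs_zero[OF kz_d_hom[OF V] kz_group[OF V] kz_group[OF V]] by blast
qed

text \<open>Torsion of V needs H_2(D V), and homology of V needs torsion of V and homology of D V,
  so both claims share one induction. Here g exceeds the degree of generation by one, so that g = 0
  means V = 0. The integer d may become negative as derivatives are taken; the case
  \<open>d < 0\<close> records that H_1 vanishes everywhere, which the numerical bound alone would
  forget.\<close>

lemma torsion_regularity_bound:
  assumes "fi_module R V" "\<And>m. g \<le> m \<Longrightarrow> koszul_exact m V 0" "\<And>m. d < int m \<Longrightarrow> koszul_exact m V 1"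
  shows "(\<forall>n. d < 0 \<or> min (int g - 1) d + d - 1 < int n \<longrightarrow> iota_inj V n) \<and>
    (\<forall>a\<ge>1. \<forall>n. d < 0 \<or> a + min (int g - 1) d + d - 1 < int n \<longrightarrow> koszul_exact n V a)"
  using assms
proof (induction g arbitrary: V d)
  case 0
  note z = koszul_exact_all_zero[OF 0(1,2)]
  show ?case using koszul_exact_trivial[OF 0(1) z] z by (auto simp: iota_inj_def)
next
  case (Suc g)
  note V = Suc.prems(1)
  note D = fi_deriv_module[OF V]
  have IH: "(\<forall>n. d - 1 < 0 \<or> min (int g - 1) (d - 1) + (d - 1) - 1 < int n \<longrightarrow> iota_inj (fi_deriv V) n) \<and>
    (\<forall>a\<ge>1. \<forall>n. d - 1 < 0 \<or> a + min (int g - 1) (d - 1) + (d - 1) - 1 < int n \<longrightarrow>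
      koszul_exact n (fi_deriv V) a)"
    by (rule Suc.IH[OF D]) (auto intro!: koszul_exact_deriv[OF V] Suc.prems(2,3))
  have inj: "iota_inj V n" if n: "d < 0 \<or> min (int g) d + d - 1 < int n" for n
  proof (rule koszul_exact_iota_inj[OF V])
    \<comment> \<open>The threshold for D V in degree 2 is 2 + min (g - 1) (d - 1) + (d - 1) - 1 =
      min g d + d - 1. For d <= 0 the relation bound of D V is negative and no threshold
      remains.\<close>
    show "koszul_exact n (fi_deriv V) 2" using IH n by auto
    show "koszul_exact (Suc n) V 1" using n by (intro Suc.prems(3)) auto
  qed
  have "koszul_exact n V a" if a: "1 \<le> a" and n: "d < 0 \<or> a + min (int g) d + d - 1 < int n" for a n
  proof (cases n)
    case 0
    then show ?thesis using a by (simp add: koszul_exact_0)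
  next
    case (Suc m)
    show ?thesis unfolding Suc
    proof (rule koszul_exact_Suc[OF V])
      show "koszul_exact m (fi_deriv V) a" using IH n a Suc by auto
      show "iota_inj V l" if "int l = int m - (a - 1)" for l
        using n Suc that by (intro inj) auto
    qed
  qed
  with inj show ?case by simp
qed

lemma fi_deriv_funpow_module: "fi_module R V \<Longrightarrow> fi_module R ((fi_deriv ^^ i) V)"
  by (induction i) (auto intro: fi_deriv_module)

lemma koszul_exact_deriv_funpow:
  assumes "fi_module R V" "a \<le> 1"
  shows "koszul_exact (n + i) V a \<Longrightarrow> koszul_exact n ((fi_deriv ^^ i) V) a"
proof (induction i arbitrary: n)
  case (Suc i)
  then show ?case
    using koszul_exact_deriv[OF fi_deriv_funpow_module[OF assms(1)] assms(2)] Suc.IH[of "Suc n"] by simp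
qed simp

text \<open>The cone argument trades homology of V for torsion of V and homology of D V, so torsion
  of the iterated derivatives controls all higher homology. Passing to D V lowers c by one, and the
  induction ends at an FI-module with g = 0, which is zero.\<close>

lemma regularity_le_torsion:
  assumes "fi_module R V" "\<And>m. g \<le> m \<Longrightarrow> koszul_exact m V 0"
    and "\<And>i n. i < g \<Longrightarrow> c - int i < int n \<Longrightarrow> iota_inj ((fi_deriv ^^ i) V) n"
    and "1 \<le> a" "a + c < int n"
  shows "koszul_exact n V a"
  using assms
proof (induction g arbitrary: V c n)
  case 0
  then show ?case using koszul_exact_trivial[OF 0(1)] koszul_exact_all_zero[OF 0(1,2)] by blast
next
  case (Suc g)
  note V = Suc.prems(1)
  note D = fi_deriv_module[OF V]
  show ?case
  proof (cases n)
    case 0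
    then show ?thesis using Suc.prems(4) by (simp add: koszul_exact_0)
  next
    case (Suc m)
    show ?thesis unfolding Suc
    proof (rule koszul_exact_Suc[OF V])
      show "koszul_exact m (fi_deriv V) a"
      proof (rule Suc.IH[OF D _ _ Suc.prems(4)])
        show "koszul_exact l (fi_deriv V) 0" if "g \<le> l" for l
          using that by (intro koszul_exact_deriv[OF V] Suc.prems(2)) auto
        show "iota_inj ((fi_deriv ^^ i) (fi_deriv V)) l" if "i < g" "c - 1 - int i < int l" for i l
          using Suc.prems(3)[of "Suc i" l] that by (simp add: funpow_swap1)
        show "a + (c - 1) < int m" using Suc.prems(5) Suc by simp
      qed
      show "iota_inj V l" if "int l = int m - (a - 1)" for l
        using Suc.prems(3)[of 0 l] that Suc Suc.prems(5) by simp
    qed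
  qed
qed

section \<open>Decomposable elements and Koszul boundaries\<close>

lemma fi_J_submodule:
  assumes V: "fi_module R V" and X: "finite X"
  shows "submodule (fi_J R V X) R (fi_obj V X)"
proof -
  interpret V: fi_module R V by fact
  interpret M: Module.module R "fi_obj V X" by (rule V.obj_module[OF X])
  let ?N = "{N. submodule N R (fi_obj V X) \<and> (\<forall>Y f. finite Y \<and> card Y < card X \<and> f \<in> fi_hom Y X \<longrightarrow>
        fi_act V Y X f ` carrier (fi_obj V Y) \<subseteq> N)}"
  have top: "carrier (fi_obj V X) \<in> ?N"
    using V.act_closed X by (auto intro: M.carrier_is_submodule)
  note N = submodule_facts[OF M.module_axioms]
  show ?thesis
    unfolding fi_J_def
  proof (rule M.submoduleI)
    show "\<Inter> ?N \<subseteq> carrier (fi_obj V X)" using top by (rule Inter_lower)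
  qed (auto intro: N)
qed

lemma fi_J_act:
  assumes "finite Y" "card Y < card X" "f \<in> fi_hom Y X" "v \<in> carrier (fi_obj V Y)"
  shows "fi_act V Y X f v \<in> fi_J R V X"
  using assms unfolding fi_J_def by blast

lemma fi_J_least:
  assumes "submodule N R (fi_obj V X)"
    and "\<And>Y f v. finite Y \<Longrightarrow> card Y < card X \<Longrightarrow> f \<in> fi_hom Y X \<Longrightarrow> v \<in> carrier (fi_obj V Y) \<Longrightarrow>
      fi_act V Y X f v \<in> N"
  shows "fi_J R V X \<subseteq> N"
proof -
  have "N \<in> {N. submodule N R (fi_obj V X) \<and> (\<forall>Y f. finite Y \<and> card Y < card X \<and> f \<in> fi_hom Y X \<longrightarrow>
        fi_act V Y X f ` carrier (fi_obj V Y) \<subseteq> N)}"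
    using assms by auto
  then show ?thesis unfolding fi_J_def by (rule Inter_lower)
qed

lemma fi_J_carrier:
  "fi_module R V \<Longrightarrow> finite X \<Longrightarrow> v \<in> fi_J R V X \<Longrightarrow> v \<in> carrier (fi_obj V X)"
  by (rule submodule_facts(1)[OF fi_module.obj_module fi_J_submodule])

lemma fi_J_subobject:
  assumes V: "fi_module R V" shows "fi_subobject R V (fi_J R V)"
proof -
  interpret V: fi_module R V by fact
  have "fi_act V X Y f v \<in> fi_J R V Y"
    if *: "finite X" "finite Y" "f \<in> fi_hom X Y" "v \<in> fi_J R V X" for X Y f v
  proof -
    have "fi_J R V X \<subseteq> {x \<in> carrier (fi_obj V X). fi_act V X Y f x \<in> fi_J R V Y}"
    proof (rule fi_J_least)
      fix Z g u assume g: "finite Z" "card Z < card X" "g \<in> fi_hom Z X" "u \<in> carrier (fi_obj V Z)"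
      have "fi_act V Z Y (compose Z f g) u \<in> fi_J R V Y"
        using fi_hom_card[OF *(3,2)] g by (intro fi_J_act fi_hom_compose[OF g(3) *(3)]) auto
      then show "fi_act V Z X g u \<in> {x \<in> carrier (fi_obj V X). fi_act V X Y f x \<in> fi_J R V Y}"
        using V.act_compose[OF g(1) *(1,2) g(3) *(3) g(4)] V.act_closed[OF g(1) *(1) g(3,4)] by simp
    qed (rule linear_vimage_submodule[OF V.obj_module[OF *(1)] V.obj_module[OF *(2)]
          V.act_linear[OF *(1-3)] fi_J_submodule[OF V *(2)]])
    with *(4) show ?thesis by blast
  qed
  then show ?thesis using fi_J_submodule[OF V] by (simp add: fi_subobject_def)
qed

lemma fi_J_morphism:
  assumes V: "fi_module R V" and W: "fi_module R W" and \<phi>: "\<phi> \<in> fi_morphisms R V W"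
    and X: "finite X" "v \<in> fi_J R V X"
  shows "\<phi> X v \<in> fi_J R W X"
proof -
  interpret V: fi_module R V by fact
  interpret W: fi_module R W by fact
  have "fi_J R V X \<subseteq> {x \<in> carrier (fi_obj V X). \<phi> X x \<in> fi_J R W X}"
  proof (rule fi_J_least)
    fix Z g u assume g: "finite Z" "card Z < card X" "g \<in> fi_hom Z X" "u \<in> carrier (fi_obj V Z)"
    have "fi_act W Z X g (\<phi> Z u) \<in> fi_J R W X"
      using fi_J_act[OF g(1-3) fi_morphisms_closed[OF \<phi> g(1,4)]] .
    then show "fi_act V Z X g u \<in> {x \<in> carrier (fi_obj V X). \<phi> X x \<in> fi_J R W X}"
      using V.act_closed[OF g(1) X(1) g(3,4)] fi_morphisms_natural[OF \<phi> g(1) X(1) g(3,4)] by simp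
  qed (rule linear_vimage_submodule[OF V.obj_module[OF X(1)] W.obj_module[OF X(1)]
        fi_morphisms_linear[OF \<phi> X(1)] fi_J_submodule[OF W X(1)]])
  with X(2) show ?thesis by blast
qed

lemma fi_J_epi:
  assumes V: "fi_module R V" and W: "fi_module R W" and \<phi>: "\<phi> \<in> fi_morphisms R V W"
    and epi: "fi_epi V W \<phi>" and X: "finite X" "w \<in> fi_J R W X"
  shows "\<exists>v\<in>fi_J R V X. \<phi> X v = w"
proof -
  interpret V: fi_module R V by fact
  interpret W: fi_module R W by fact
  have "fi_J R W X \<subseteq> \<phi> X ` fi_J R V X"
  proof (rule fi_J_least)
    fix Z g u assume g: "finite Z" "card Z < card X" "g \<in> fi_hom Z X" "u \<in> carrier (fi_obj W Z)"
    obtain v where v: "v \<in> carrier (fi_obj V Z)" "\<phi> Z v = u"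
      using fi_epiD[OF epi g(1,4)] by blast
    have "fi_act W Z X g u = \<phi> X (fi_act V Z X g v)"
      using fi_morphisms_natural[OF \<phi> g(1) X(1) g(3) v(1)] v(2) by simp
    then show "fi_act W Z X g u \<in> \<phi> X ` fi_J R V X"
      using fi_J_act[OF g(1-3) v(1)] by blast
  qed (rule linear_image_submodule[OF V.obj_module[OF X(1)] W.obj_module[OF X(1)]
        fi_morphisms_linear[OF \<phi> X(1)] fi_J_submodule[OF V X(1)]])
  with X(2) show ?thesis by blast
qed

text \<open>The identity F D = S F on objects: modulo the image of iota, decomposables of V at
  \<open>add_star X\<close> are decomposables of S V at X. An injection from a smaller set either
  misses the added point and factors through iota, or hits it and factors through a shifted
  inclusion.\<close>

lemma fi_J_shift:
  assumes V: "fi_module R V" and X: "finite X"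
  shows "v \<in> fi_J R V (add_star X) \<longleftrightarrow> v \<in> carrier (fi_obj V (add_star X)) \<and>
    (\<exists>w\<in>carrier (fi_obj V X).
      v \<oplus>\<^bsub>fi_obj V (add_star X)\<^esub> \<ominus>\<^bsub>fi_obj V (add_star X)\<^esub> fi_iota V X w \<in> fi_J R (fi_shift V) X)"
proof -
  interpret V: fi_module R V by fact
  note S = fi_shift_module[OF V] and i = fi_iota_morphism[OF V]
  interpret S: fi_module R "fi_shift V" by (rule S)
  let ?M = "fi_obj V (add_star X)" and ?J = "fi_J R (fi_shift V) X"
  interpret M: Module.module R ?M using X by (intro V.obj_module) simp
  have J: "submodule ?J R ?M" using fi_J_submodule[OF S X] by simp
  note Jf = submodule_facts[OF M.module_axioms J]
  let ?q = "coset_rep ?M ?J"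
  let ?Q = "quot_module ?M ?J"
  let ?N = "{v \<in> carrier ?M. ?q v \<in> (\<lambda>w. ?q (fi_iota V X w)) ` carrier (fi_obj V X)}"
  have ic: "fi_iota V X w \<in> carrier ?M" if "w \<in> carrier (fi_obj V X)" for w
    using fi_morphisms_closed[OF i X that] by simp
  have N_iff: "v \<in> ?N \<longleftrightarrow> v \<in> carrier ?M \<and>
      (\<exists>w\<in>carrier (fi_obj V X). v \<oplus>\<^bsub>?M\<^esub> \<ominus>\<^bsub>?M\<^esub> fi_iota V X w \<in> ?J)" for v
    by (auto simp: image_iff coset_rep_eq_iff[OF M.module_axioms J] ic)
  have q: "?q \<in> linear_maps R ?M ?Q" by (rule coset_rep_linear[OF M.module_axioms J])
  have iq: "(\<lambda>w. ?q (fi_iota V X w)) \<in> linear_maps R (fi_obj V X) ?Q"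
    using linear_maps_comp[OF fi_morphisms_linear[OF i X]] q by simp
  have Q: "Module.module R ?Q" by (rule quot_module_module[OF M.module_axioms J])
  have "submodule ((\<lambda>w. ?q (fi_iota V X w)) ` carrier (fi_obj V X)) R ?Q"
    by (rule linear_image_submodule[OF V.obj_module[OF X] Q iq
        Module.module.carrier_is_submodule[OF V.obj_module[OF X]]])
  note N = linear_vimage_submodule[OF M.module_axioms Q q this]
  have "fi_J R V (add_star X) \<subseteq> ?N"
  proof (rule fi_J_least[OF N])
    fix Y f u assume f: "finite Y" "card Y < card (add_star X)" "f \<in> fi_hom Y (add_star X)"
      "u \<in> carrier (fi_obj V Y)"
    have fc: "fi_act V Y (add_star X) f u \<in> carrier ?M"
      using V.act_closed[OF f(1) _ f(3,4)] X by simp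
    have V0: "fi_obj (fi_shift V) X = ?M" by simp
    show "fi_act V Y (add_star X) f u \<in> ?N"
    proof (cases "0 \<in> f ` Y")
      case False
      let ?g = "\<lambda>y\<in>Y. f y - 1"
      have pos: "f y \<noteq> 0" "f y \<in> add_star X" if "y \<in> Y" for y
        using False fi_hom_mem[OF f(3) that] that by (metis imageI)+
      have g: "?g \<in> fi_hom Y X"
      proof (rule fi_homI)
        show "f y - 1 \<in> X" if "y \<in> Y" for y using pos[OF that] by (auto elim: add_star_cases)
        show "inj_on (\<lambda>y. f y - 1) Y"
        proof (rule inj_onI)
          fix x y assume "x \<in> Y" "y \<in> Y" "f x - 1 = f y - 1"
          then have "f x = f y" using pos(1)[of x] pos(1)[of y] by simp
          with \<open>x \<in> Y\<close> \<open>y \<in> Y\<close> show "x = y" using inj_onD[OF fi_hom_inj[OF f(3)]] by blast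
        qed
      qed
      have "f = compose Y (succ_map X) ?g"
        by (rule fi_hom_eqI[OF f(3) fi_hom_compose[OF g succ_map_fi_hom]])
           (use pos fi_hom_mem[OF g] in \<open>simp add: compose_def\<close>)
      then have eq: "fi_act V Y (add_star X) f u = fi_iota V X (fi_act V Y X ?g u)"
        using V.act_compose[OF f(1) X _ g succ_map_fi_hom f(4)] X
        by (simp add: fi_iota_def)
      have gu: "fi_act V Y X ?g u \<in> carrier (fi_obj V X)"
        by (rule V.act_closed[OF f(1) X g f(4)])
      have "fi_iota V X (fi_act V Y X ?g u) \<oplus>\<^bsub>?M\<^esub> \<ominus>\<^bsub>?M\<^esub> fi_iota V X (fi_act V Y X ?g u) \<in> ?J"
        using ic[OF gu] Jf(2) by (simp add: M.r_neg)
      then show ?thesis unfolding N_iff eq using ic[OF gu] gu by blast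
    next
      case True
      \<comment> \<open>The image of f is \<open>add_star Z\<close>, so f is a bijection onto it
        followed by the shift of the inclusion of Z, a set smaller than X.\<close>
      define Z where "Z = {x. Suc x \<in> f ` Y}"
      have fY: "f ` Y = add_star Z"
      proof (rule Set.set_eqI)
        fix x show "x \<in> f ` Y \<longleftrightarrow> x \<in> add_star Z"
          using True by (cases x) (auto simp: Z_def)
      qed
      have Zf: "finite Z" using f(1) fY finite_add_star by (metis finite_imageI)
      have "card Y = Suc (card Z)"
        using fY Zf card_image[OF fi_hom_inj[OF f(3)]] by simp
      with f(2) X have cZ: "card Z < card X" by simp
      have ZX: "Z \<subseteq> X"
        using fi_hom_mem[OF f(3)] by (auto simp: Z_def) (metis add_star_map_simps(2))
      let ?j = "\<lambda>z\<in>Z. z"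
      have j: "?j \<in> fi_hom Z X" using ZX by (intro fi_homI) auto
      have fZ: "f \<in> fi_hom Y (add_star Z)"
        using f(3) fY by (auto simp: fi_hom_def PiE_iff)
      have "f = compose Y (add_star_map Z ?j) f"
      proof (rule fi_hom_eqI[OF f(3) fi_hom_compose[OF fZ add_star_map_fi_hom[OF j]]])
        fix y assume y: "y \<in> Y"
        from fi_hom_mem[OF fZ y] show "f y = compose Y (add_star_map Z ?j) f y"
          by (cases rule: add_star_cases) (use y in \<open>simp_all add: compose_def\<close>)
      qed
      then have eq: "fi_act V Y (add_star X) f u
          = fi_act (fi_shift V) Z X ?j (fi_act V Y (add_star Z) f u)"
        using V.act_compose[OF f(1) _ _ fZ add_star_map_fi_hom[OF j] f(4)] Zf X by simp
      have "fi_act V Y (add_star X) f u \<in> ?J"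
        unfolding eq using V.act_closed[OF f(1) _ fZ f(4)] Zf
        by (intro fi_J_act[OF Zf cZ j]) simp
      moreover have "fi_act V Y (add_star X) f u \<oplus>\<^bsub>?M\<^esub> \<ominus>\<^bsub>?M\<^esub> fi_iota V X \<zero>\<^bsub>fi_obj V X\<^esub>
          = fi_act V Y (add_star X) f u"
        using fi_morphisms_zero[OF i V S X] fc M.neg_zero by (simp only: fi_shift_simps M.r_zero)
      moreover have "\<zero>\<^bsub>fi_obj V X\<^esub> \<in> carrier (fi_obj V X)"
        using abelian_monoid.zero_closed[OF abelian_group.axioms(1)[OF V.obj_group[OF X]]] .
      ultimately show ?thesis unfolding N_iff using fc by (intro conjI bexI[of _ "\<zero>\<^bsub>fi_obj V X\<^esub>"]) auto
    qed
  qed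
  moreover have "v \<in> fi_J R V (add_star X)" if v: "v \<in> ?N" for v
  proof -
    have JV: "submodule (fi_J R V (add_star X)) R ?M" using X by (intro fi_J_submodule[OF V]) simp
    note JVf = submodule_facts[OF M.module_axioms JV]
    obtain w where w: "w \<in> carrier (fi_obj V X)" "v \<oplus>\<^bsub>?M\<^esub> \<ominus>\<^bsub>?M\<^esub> fi_iota V X w \<in> ?J" and vc: "v \<in> carrier ?M"
      using v unfolding N_iff by auto
    have "?J \<subseteq> fi_J R V (add_star X)"
    proof (rule fi_J_least)
      show "submodule (fi_J R V (add_star X)) R (fi_obj (fi_shift V) X)" using JV by simp
      fix Z g u assume g: "finite Z" "card Z < card X" "g \<in> fi_hom Z X" "u \<in> carrier (fi_obj (fi_shift V) Z)"
      then show "fi_act (fi_shift V) Z X g u \<in> fi_J R V (add_star X)"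
        using X by (auto intro!: fi_J_act add_star_map_fi_hom)
    qed
    moreover have "fi_iota V X w \<in> fi_J R V (add_star X)"
      unfolding fi_iota_def using w X by (intro fi_J_act succ_map_fi_hom) auto
    ultimately have "(v \<oplus>\<^bsub>?M\<^esub> \<ominus>\<^bsub>?M\<^esub> fi_iota V X w) \<oplus>\<^bsub>?M\<^esub> fi_iota V X w \<in> fi_J R V (add_star X)"
      using w(2) JVf(3) by blast
    then show ?thesis using vc ic[OF w(1)] by (simp add: M.a_assoc M.l_neg)
  qed
  ultimately show ?thesis using N_iff by blast
qed

text \<open>The zeroth Koszul homology is F(V). Both sides obey the same recursion: v bounds in the
  cone when v = d s + iota w, and by \<open>fi_J_shift\<close> v is decomposable when v - iota w is
  decomposable in S V for some w.\<close>

lemma fi_J_koszul: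
  assumes "fi_module R V"
  shows "v \<in> fi_J R V {0..<n} \<longleftrightarrow> v \<in> carrier (fi_obj V {0..<n}) \<and>
    (\<exists>y\<in>kz_part n V 1. kz_d n V y = kz_unit n V v)"
  using assms
proof (induction n arbitrary: V v)
  case 0
  interpret fi_module R V by fact
  have M: "Module.module R (fi_obj V {0..<0})" by (rule obj_module) simp
  have J: "submodule (fi_J R V {0..<0}) R (fi_obj V {0..<0})" by (rule fi_J_submodule[OF 0]) simp
  have "fi_J R V {0..<0} \<subseteq> {\<zero>\<^bsub>fi_obj V {0..<0}\<^esub>}" by (rule fi_J_least[OF zero_submodule[OF M]]) simp
  then have "fi_J R V {0..<0} = {\<zero>\<^bsub>fi_obj V {}\<^esub>}" using submodule_facts(2)[OF M J] by auto
  moreover have "\<zero>\<^bsub>fi_obj V {}\<^esub> \<in> carrier (fi_obj V {})"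
    using submodule_facts(1)[OF M J submodule_facts(2)[OF M J]] by simp
  ultimately show ?case by auto
next
  case (Suc n)
  note V = Suc.prems
  note S = fi_shift_module[OF V] and i = fi_iota_morphism[OF V]
  let ?M = "fi_obj V {0..<Suc n}"
  interpret GV: abelian_group "kz n V" by (rule kz_group[OF V])
  interpret GS: abelian_group "kz n (fi_shift V)" by (rule kz_group[OF S])
  interpret M: abelian_group ?M by (rule fi_module.obj_group[OF V]) simp
  have uh: "kz_unit n (fi_shift V) \<in> add_homs ?M (kz n (fi_shift V))"
    using kz_unit_hom[OF S, of n] by simp
  note uc = add_homs_closed[OF uh]
  have ic: "fi_iota V {0..<n} w \<in> carrier ?M" if "w \<in> carrier (fi_obj V {0..<n})" for w
    using fi_morphisms_closed[OF i _ that] by simp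
  have step: "kz_d n (fi_shift V) s = kz_unit n (fi_shift V) (v \<oplus>\<^bsub>?M\<^esub> \<ominus>\<^bsub>?M\<^esub> fi_iota V {0..<n} w)
    \<longleftrightarrow> kz_d n (fi_shift V) s \<oplus>\<^bsub>kz n (fi_shift V)\<^esub> kz_map n (fi_iota V) (kz_unit n V w) = kz_unit n (fi_shift V) v"
    if v: "v \<in> carrier ?M" and w: "w \<in> carrier (fi_obj V {0..<n})" and s: "s \<in> kz_part n (fi_shift V) 1" for s w
  proof -
    have ds: "kz_d n (fi_shift V) s \<in> carrier (kz n (fi_shift V))"
      using add_homs_closed[OF kz_d_hom[OF S] kz_part_carrier[OF s S]] .
    have "kz_unit n (fi_shift V) (v \<oplus>\<^bsub>?M\<^esub> \<ominus>\<^bsub>?M\<^esub> fi_iota V {0..<n} w)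
      = kz_unit n (fi_shift V) v \<oplus>\<^bsub>kz n (fi_shift V)\<^esub> \<ominus>\<^bsub>kz n (fi_shift V)\<^esub> kz_unit n (fi_shift V) (fi_iota V {0..<n} w)"
      using v ic[OF w] by (simp add: add_homs_add[OF uh] add_homs_neg[OF uh M.abelian_group_axioms kz_group[OF S]])
    then have "kz_d n (fi_shift V) s = kz_unit n (fi_shift V) (v \<oplus>\<^bsub>?M\<^esub> \<ominus>\<^bsub>?M\<^esub> fi_iota V {0..<n} w)
      \<longleftrightarrow> kz_unit n (fi_shift V) v \<oplus>\<^bsub>kz n (fi_shift V)\<^esub> \<ominus>\<^bsub>kz n (fi_shift V)\<^esub>
        kz_unit n (fi_shift V) (fi_iota V {0..<n} w) = kz_d n (fi_shift V) s"
      by (simp only: eq_commute)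
    also have "\<dots> \<longleftrightarrow> kz_unit n (fi_shift V) v
      = kz_unit n (fi_shift V) (fi_iota V {0..<n} w) \<oplus>\<^bsub>kz n (fi_shift V)\<^esub> kz_d n (fi_shift V) s"
      by (rule GS.eq_add_iff[OF uc[OF v] uc[OF ic[OF w]] ds, symmetric])
    finally show ?thesis
      by (simp only: GS.a_comm[OF ds uc[OF ic[OF w]]] kz_map_unit[OF i V S, of n w] eq_commute)
  qed
  have mid: "v \<oplus>\<^bsub>?M\<^esub> \<ominus>\<^bsub>?M\<^esub> fi_iota V {0..<n} w \<in> fi_J R (fi_shift V) {0..<n} \<longleftrightarrow>
      (\<exists>s\<in>kz_part n (fi_shift V) 1. kz_d n (fi_shift V) s \<oplus>\<^bsub>kz n (fi_shift V)\<^esub>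
        kz_map n (fi_iota V) (kz_unit n V w) = kz_unit n (fi_shift V) v)"
    if v: "v \<in> carrier ?M" and w: "w \<in> carrier (fi_obj V {0..<n})" for w
  proof -
    have "v \<oplus>\<^bsub>?M\<^esub> \<ominus>\<^bsub>?M\<^esub> fi_iota V {0..<n} w \<in> carrier (fi_obj (fi_shift V) {0..<n})"
      using v ic[OF w] by simp
    then have "v \<oplus>\<^bsub>?M\<^esub> \<ominus>\<^bsub>?M\<^esub> fi_iota V {0..<n} w \<in> fi_J R (fi_shift V) {0..<n} \<longleftrightarrow>
      (\<exists>s\<in>kz_part n (fi_shift V) 1. kz_d n (fi_shift V) s
        = kz_unit n (fi_shift V) (v \<oplus>\<^bsub>?M\<^esub> \<ominus>\<^bsub>?M\<^esub> fi_iota V {0..<n} w))"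
      using Suc.IH[OF S] by blast
    also have "\<dots> \<longleftrightarrow> (\<exists>s\<in>kz_part n (fi_shift V) 1. kz_d n (fi_shift V) s \<oplus>\<^bsub>kz n (fi_shift V)\<^esub>
        kz_map n (fi_iota V) (kz_unit n V w) = kz_unit n (fi_shift V) v)"
      by (rule bex_cong[OF refl step[OF v w]])
    finally show ?thesis .
  qed
  have "v \<in> fi_J R V {0..<Suc n} \<longleftrightarrow> v \<in> carrier ?M \<and> (\<exists>w\<in>carrier (fi_obj V {0..<n}).
      v \<oplus>\<^bsub>?M\<^esub> \<ominus>\<^bsub>?M\<^esub> fi_iota V {0..<n} w \<in> fi_J R (fi_shift V) {0..<n})"
    using fi_J_shift[OF V, of "{0..<n}" v] by simp
  also have "\<dots> \<longleftrightarrow> v \<in> carrier ?M \<and> (\<exists>w\<in>carrier (fi_obj V {0..<n}). \<exists>s\<in>kz_part n (fi_shift V) 1.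
      kz_d n (fi_shift V) s \<oplus>\<^bsub>kz n (fi_shift V)\<^esub> kz_map n (fi_iota V) (kz_unit n V w) = kz_unit n (fi_shift V) v)"
    using mid by blast
  also have "\<dots> \<longleftrightarrow> v \<in> carrier ?M \<and> (\<exists>s\<in>kz_part n (fi_shift V) 1. \<exists>t\<in>kz_part n V 0.
      kz_d n (fi_shift V) s \<oplus>\<^bsub>kz n (fi_shift V)\<^esub> kz_map n (fi_iota V) t = kz_unit n (fi_shift V) v)"
    using kz_unit_part[OF V] kz_unit_surj[OF V] by metis
  also have "\<dots> \<longleftrightarrow> v \<in> carrier ?M \<and> (\<exists>y\<in>kz_part (Suc n) V 1. kz_d (Suc n) V y = kz_unit (Suc n) V v)"
  proof -
    have "\<ominus>\<^bsub>kz n V\<^esub> kz_d n V t = \<zero>\<^bsub>kz n V\<^esub>" if "t \<in> kz_part n V 0" for t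
      using kz_part_neg_degree[OF V kz_d_part[OF V that]] GV.neg_zero by simp
    then show ?thesis by (auto 0 3) 
  qed
  finally show ?case .
qed

lemma koszul_exact_generated:
  assumes V: "fi_module R V" and J: "carrier (fi_obj V {0..<n}) \<subseteq> fi_J R V {0..<n}"
  shows "koszul_exact n V 0"
  unfolding koszul_exact_def
proof (intro ballI impI)
  fix x assume "x \<in> kz_part n V 0"
  then obtain v where "v \<in> carrier (fi_obj V {0..<n})" "x = kz_unit n V v"
    using kz_unit_surj[OF V] by blast
  then show "\<exists>y\<in>kz_part n V (0 + 1). kz_d n V y = x"
    using J fi_J_koszul[OF V, of v n] by auto
qed

section \<open>Acyclicity of FI-modules with a retraction of the shift\<close>

text \<open>The one consequence of projectivity that acyclicity uses: it forces iota to be injective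
  and is inherited by retracts and by D.\<close>

definition fi_split :: "('a, 'x) ring_scheme \<Rightarrow> ('a, 'b) fi_mod \<Rightarrow> bool" where
  "fi_split R V \<longleftrightarrow> (\<exists>\<rho>\<in>fi_morphisms R (fi_shift V) V.
     \<forall>X. finite X \<longrightarrow> (\<forall>v\<in>carrier (fi_obj V X). \<rho> X (fi_iota V X v) = v))"

lemma fi_shift_quot: "fi_shift (fi_quot V N) = fi_quot (fi_shift V) (\<lambda>X. N (add_star X))"
  by (simp add: fi_shift_def fi_quot_def)

lemma fi_subobject_shift:
  "fi_subobject R V N \<Longrightarrow> fi_subobject R (fi_shift V) (\<lambda>X. N (add_star X))"
  by (simp add: fi_subobject_def add_star_map_fi_hom)

text \<open>The retraction for D V is the swap followed by the shift of \<open>\<rho>\<close>. The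
  swap turns the shift of iota, whose image is divided out, into iota of S V, where naturality of
  \<open>\<rho>\<close> shows that the map descends. Conversely it turns iota of S V into the shift
  of iota, which the shift of \<open>\<rho>\<close> retracts.\<close>

lemma fi_split_deriv:
  assumes V: "fi_module R V" and split: "fi_split R V"
  shows "fi_split R (fi_deriv V)"
proof -
  obtain \<rho> where \<rho>: "\<rho> \<in> fi_morphisms R (fi_shift V) V"
    and \<rho>\<iota>: "\<And>X v. finite X \<Longrightarrow> v \<in> carrier (fi_obj V X) \<Longrightarrow> \<rho> X (fi_iota V X v) = v"
    using split by (auto simp: fi_split_def)
  note S = fi_shift_module[OF V] and SS = fi_shift_module[OF fi_shift_module[OF V]]
  interpret S: fi_module R "fi_shift V" by (rule S)
  interpret SS: fi_module R "fi_shift (fi_shift V)" by (rule SS)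
  let ?N = "fi_image V (fi_iota V)" and ?N' = "\<lambda>X. fi_image V (fi_iota V) (add_star X)"
  let ?\<sigma> = "\<lambda>X v. \<rho> (add_star X) (fi_swap V X v)"
  have N: "fi_subobject R (fi_shift V) ?N" by (rule fi_iota_subobject[OF V])
  have N': "fi_subobject R (fi_shift (fi_shift V)) ?N'" by (rule fi_subobject_shift[OF N])
  have \<sigma>: "?\<sigma> \<in> fi_morphisms R (fi_shift (fi_shift V)) (fi_shift V)"
    by (rule fi_morphisms_comp[OF fi_swap_morphism[OF V] fi_morphisms_shift[OF \<rho>]])
  have \<sigma>N: "?\<sigma> X v \<in> ?N X" if X: "finite X" and v: "v \<in> ?N' X" for X v
  proof -
    obtain u where u: "u \<in> carrier (fi_obj (fi_shift V) X)" "v = fi_iota V (add_star X) u"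
      using v by (auto simp: fi_image_def)
    have "?\<sigma> X v = \<rho> (add_star X) (fi_iota (fi_shift V) X u)"
      using u fi_swap_iota(1)[OF V X] by simp
    also have "\<dots> = fi_iota V X (\<rho> X u)" by (rule fi_iota_natural[OF \<rho> X u(1)])
    finally show ?thesis
      using fi_morphisms_closed[OF \<rho> X u(1)] by (simp add: fi_image_def)
  qed
  let ?\<rho> = "\<lambda>X v. coset_rep (fi_obj (fi_shift V) X) (?N X) (?\<sigma> X v)"
  have "?\<rho> \<in> fi_morphisms R (fi_shift (fi_deriv V)) (fi_deriv V)"
    unfolding fi_deriv_def fi_shift_quot by (rule fi_quot_map[OF SS N' S N \<sigma> \<sigma>N])
  moreover have "?\<rho> X (fi_iota (fi_deriv V) X y) = y"
    if X: "finite X" and y: "y \<in> carrier (fi_obj (fi_deriv V) X)" for X y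
  proof -
    have Xs: "finite (add_star X)" using X by simp
    note m = S.obj_module[OF X] and n = fi_subobject_submodule[OF N X]
    obtain x where x: "x \<in> carrier (fi_obj (fi_shift V) X)" "y = coset_rep (fi_obj (fi_shift V) X) (?N X) x"
      using y by (auto simp: fi_deriv_def)
    have yc: "y \<in> carrier (fi_obj (fi_shift V) X)" unfolding x(2) by (rule coset_rep_closed[OF m n x(1)])
    have yy: "coset_rep (fi_obj (fi_shift V) X) (?N X) y = y"
      unfolding x(2) by (rule coset_rep_idem[OF m n x(1)])
    have "fi_iota (fi_deriv V) X y = coset_rep (fi_obj (fi_shift (fi_shift V)) X) (?N' X) (fi_iota (fi_shift V) X y)"
      by (simp add: fi_iota_def fi_deriv_def)
    then have "?\<rho> X (fi_iota (fi_deriv V) X y) = ?\<rho> X (fi_iota (fi_shift V) X y)"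
      using coset_rep_hom[OF SS.obj_module[OF X] fi_subobject_submodule[OF N' X] m n
          fi_morphisms_hom[OF \<sigma> X] \<sigma>N[OF X] fi_morphisms_closed[OF fi_iota_morphism[OF S] X yc]]
      by simp
    also have "\<dots> = coset_rep (fi_obj (fi_shift V) X) (?N X) (\<rho> (add_star X) (fi_iota V (add_star X) y))"
      using fi_swap_iota(2)[OF V X] yc by simp
    also have "\<dots> = y" using \<rho>\<iota>[OF Xs] yc yy by simp
    finally show ?thesis .
  qed
  ultimately show ?thesis unfolding fi_split_def by (intro bexI[of _ ?\<rho>]) simp_all
qed

text \<open>The retraction makes iota injective in every size and passes to D V, so the cone
  argument applies at each n.\<close>

lemma koszul_exact_split:
  assumes "fi_module R V" "fi_split R V" "1 \<le> a"
  shows "koszul_exact n V a"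
  using assms
proof (induction n arbitrary: V)
  case 0
  then show ?case by (simp add: koszul_exact_0)
next
  case (Suc n)
  note V = Suc.prems(1)
  show ?case
  proof (rule koszul_exact_Suc[OF V])
    show "koszul_exact n (fi_deriv V) a"
      by (rule Suc.IH[OF fi_deriv_module[OF V] fi_split_deriv[OF V Suc.prems(2)] Suc.prems(3)])
    fix m
    obtain \<rho> where \<rho>: "\<rho> \<in> fi_morphisms R (fi_shift V) V"
      and \<rho>\<iota>: "\<And>v. v \<in> carrier (fi_obj V {0..<m}) \<Longrightarrow> \<rho> {0..<m} (fi_iota V {0..<m} v) = v"
      using Suc.prems(2) by (auto simp: fi_split_def)
    show "iota_inj V m"
      unfolding iota_inj_def
    proof (intro ballI impI)
      fix v assume v: "v \<in> carrier (fi_obj V {0..<m})" "fi_iota V {0..<m} v = \<zero>\<^bsub>fi_obj V {0..<Suc m}\<^esub>"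
      show "v = \<zero>\<^bsub>fi_obj V {0..<m}\<^esub>"
        using \<rho>\<iota>[OF v(1)] v(2) fi_morphisms_zero[OF \<rho> fi_shift_module[OF V] V, of "{0..<m}"] by simp
    qed
  qed
qed

section \<open>Free FI-modules\<close>

definition free_index :: "(nat \<Rightarrow> 'l set) \<Rightarrow> nat set \<Rightarrow> (nat list \<times> 'l) set" where
  "free_index B X = {(l, b). distinct l \<and> set l \<subseteq> X \<and> b \<in> B (length l)}"

text \<open>
  In the free FI-module a pair \<open>(l, b)\<close> stands for the image of the generator \<open>b\<close> over \<open>{0..<length l}\<close> under the
  injection with list of values \<open>l\<close>.
\<close>

definition fi_free :: "('a, 'x) ring_scheme \<Rightarrow> (nat \<Rightarrow> 'l set) \<Rightarrow> ('a, nat list \<times> 'l \<Rightarrow> 'a) fi_mod" where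
  "fi_free R B = \<lparr>
     fi_obj = (\<lambda>X. \<lparr>carrier = {g. finite {p. g p \<noteq> \<zero>\<^bsub>R\<^esub>} \<and> range g \<subseteq> carrier R \<and>
         {p. g p \<noteq> \<zero>\<^bsub>R\<^esub>} \<subseteq> free_index B X},
       mult = undefined, one = undefined, zero = (\<lambda>p. \<zero>\<^bsub>R\<^esub>), add = (\<lambda>g h p. g p \<oplus>\<^bsub>R\<^esub> h p),
       smult = (\<lambda>r g p. r \<otimes>\<^bsub>R\<^esub> g p)\<rparr>),
     fi_act = (\<lambda>X Y f g p. if set (fst p) \<subseteq> f ` X then g (map (inv_into X f) (fst p), snd p) else \<zero>\<^bsub>R\<^esub>)\<rparr>"

definition free_gen :: "('a, 'x) ring_scheme \<Rightarrow> nat list \<times> 'l \<Rightarrow> nat list \<times> 'l \<Rightarrow> 'a" where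
  "free_gen R p = (\<lambda>q. if q = p then \<one>\<^bsub>R\<^esub> else \<zero>\<^bsub>R\<^esub>)"

lemma fi_free_simps [simp]:
  "\<zero>\<^bsub>fi_obj (fi_free R B) X\<^esub> = (\<lambda>p. \<zero>\<^bsub>R\<^esub>)"
  "g \<oplus>\<^bsub>fi_obj (fi_free R B) X\<^esub> h = (\<lambda>p. g p \<oplus>\<^bsub>R\<^esub> h p)"
  "r \<odot>\<^bsub>fi_obj (fi_free R B) X\<^esub> g = (\<lambda>p. r \<otimes>\<^bsub>R\<^esub> g p)"
  by (simp_all add: fi_free_def)

lemma fi_free_carrier:
  "g \<in> carrier (fi_obj (fi_free R B) X) \<longleftrightarrow> finite {p. g p \<noteq> \<zero>\<^bsub>R\<^esub>} \<and> (\<forall>p. g p \<in> carrier R) \<and>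
    {p. g p \<noteq> \<zero>\<^bsub>R\<^esub>} \<subseteq> free_index B X"
  by (auto simp: fi_free_def)

lemma fi_free_coeff: "g \<in> carrier (fi_obj (fi_free R B) X) \<Longrightarrow> g p \<in> carrier R"
  unfolding fi_free_carrier by blast

lemma fi_free_supp:
  "g \<in> carrier (fi_obj (fi_free R B) X) \<Longrightarrow> finite {p. g p \<noteq> \<zero>\<^bsub>R\<^esub>}"
  "g \<in> carrier (fi_obj (fi_free R B) X) \<Longrightarrow> {p. g p \<noteq> \<zero>\<^bsub>R\<^esub>} \<subseteq> free_index B X"
  unfolding fi_free_carrier by blast+

lemma fi_free_act:
  "fi_act (fi_free R B) X Y f g (l, b)
    = (if set l \<subseteq> f ` X then g (map (inv_into X f) l, b) else \<zero>\<^bsub>R\<^esub>)"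
  by (simp add: fi_free_def)

lemma fi_free_carrier_subset:
  assumes g: "g \<in> carrier (fi_obj (fi_free R B) X)" and h: "\<And>p. h p \<in> carrier R"
    and z: "\<And>p. g p = \<zero>\<^bsub>R\<^esub> \<Longrightarrow> h p = \<zero>\<^bsub>R\<^esub>"
  shows "h \<in> carrier (fi_obj (fi_free R B) X)"
proof -
  have "{p. h p \<noteq> \<zero>\<^bsub>R\<^esub>} \<subseteq> {p. g p \<noteq> \<zero>\<^bsub>R\<^esub>}" using z by auto
  then show ?thesis using h fi_free_supp[OF g] unfolding fi_free_carrier
    by (meson finite_subset order_trans)
qed

context cring
begin

lemma fi_free_add_closed:
  assumes g: "g \<in> carrier (fi_obj (fi_free R B) X)" and h: "h \<in> carrier (fi_obj (fi_free R B) X)"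
  shows "(\<lambda>p. g p \<oplus> h p) \<in> carrier (fi_obj (fi_free R B) X)"
proof -
  have "{p. g p \<oplus> h p \<noteq> \<zero>} \<subseteq> {p. g p \<noteq> \<zero>} \<union> {p. h p \<noteq> \<zero>}" by auto
  then show ?thesis
    using g h unfolding fi_free_carrier
    by (auto intro: finite_subset[of _ "{p. g p \<noteq> \<zero>} \<union> {p. h p \<noteq> \<zero>}"])
qed

lemma fi_free_obj_module: "Module.module R (fi_obj (fi_free R B) X)"
proof -
  have C: "g p \<in> carrier R" if "g \<in> carrier (fi_obj (fi_free R B) X)" for g p
    using that by (rule fi_free_coeff)
  have zero: "(\<lambda>p. \<zero>) \<in> carrier (fi_obj (fi_free R B) X)" by (simp add: fi_free_carrier)
  have "abelian_group (fi_obj (fi_free R B) X)"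
  proof (rule abelian_groupI)
    fix g assume g: "g \<in> carrier (fi_obj (fi_free R B) X)"
    have "(\<lambda>p. \<ominus> g p) \<in> carrier (fi_obj (fi_free R B) X)"
      by (rule fi_free_carrier_subset[OF g]) (auto simp: C[OF g])
    then show "\<exists>h\<in>carrier (fi_obj (fi_free R B) X). h \<oplus>\<^bsub>fi_obj (fi_free R B) X\<^esub> g = \<zero>\<^bsub>fi_obj (fi_free R B) X\<^esub>"
      by (intro bexI[of _ "\<lambda>p. \<ominus> g p"]) (simp_all add: l_neg C[OF g])
  next
    fix g h k assume "g \<in> carrier (fi_obj (fi_free R B) X)" "h \<in> carrier (fi_obj (fi_free R B) X)"
      "k \<in> carrier (fi_obj (fi_free R B) X)"
    note c = this[THEN C]
    show "g \<oplus>\<^bsub>fi_obj (fi_free R B) X\<^esub> h \<oplus>\<^bsub>fi_obj (fi_free R B) X\<^esub> k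
      = g \<oplus>\<^bsub>fi_obj (fi_free R B) X\<^esub> (h \<oplus>\<^bsub>fi_obj (fi_free R B) X\<^esub> k)"
      by (simp add: c a_assoc)
  next
    fix g h assume "g \<in> carrier (fi_obj (fi_free R B) X)" "h \<in> carrier (fi_obj (fi_free R B) X)"
    note c = this[THEN C]
    show "g \<oplus>\<^bsub>fi_obj (fi_free R B) X\<^esub> h = h \<oplus>\<^bsub>fi_obj (fi_free R B) X\<^esub> g"
      by (simp add: c a_comm)
  qed (auto simp: C zero fi_free_add_closed)
  then show ?thesis
  proof (rule Module.moduleI[OF cring_axioms], goal_cases)
    case (1 a g)
    then show ?case using fi_free_carrier_subset[OF 1(2), of "\<lambda>p. a \<otimes> g p"] by (simp add: C)
  qed (auto simp: C l_distr r_distr m_assoc)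
qed

lemma fi_free_act_closed:
  assumes f: "f \<in> fi_hom X Y" and g: "g \<in> carrier (fi_obj (fi_free R B) X)"
  shows "fi_act (fi_free R B) X Y f g \<in> carrier (fi_obj (fi_free R B) Y)"
proof -
  let ?h = "fi_act (fi_free R B) X Y f g" and ?m = "\<lambda>p. (map f (fst p), snd p)"
  have supp: "p \<in> ?m ` {p. g p \<noteq> \<zero>}" "p \<in> free_index B Y" if p: "?h p \<noteq> \<zero>" for p
  proof -
    obtain l b where lb: "p = (l, b)" by (cases p)
    have l: "set l \<subseteq> f ` X" and nz: "g (map (inv_into X f) l, b) \<noteq> \<zero>"
      using p by (auto simp: lb fi_free_act split: if_splits)
    have "map f (map (inv_into X f) l) = l"
      using l by (simp only: map_map, intro map_idI) (auto simp: f_inv_into_f)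
    then have "p = ?m (map (inv_into X f) l, b)" using lb by simp
    with nz show 1: "p \<in> ?m ` {p. g p \<noteq> \<zero>}" by blast
    have "(map (inv_into X f) l, b) \<in> free_index B X" using g nz by (auto simp: fi_free_carrier)
    then have "distinct l" "b \<in> B (length l)" by (auto simp: free_index_def distinct_map)
    moreover have "set l \<subseteq> Y" using l fi_hom_mem[OF f] by auto
    ultimately show "p \<in> free_index B Y" by (auto simp: lb free_index_def)
  qed
  have "finite (?m ` {p. g p \<noteq> \<zero>})" using g by (auto simp: fi_free_carrier)
  moreover have "{p. ?h p \<noteq> \<zero>} \<subseteq> ?m ` {p. g p \<noteq> \<zero>}" using supp(1) by blast
  ultimately have "finite {p. ?h p \<noteq> \<zero>}" by (rule rev_finite_subset)
  moreover have "?h p \<in> carrier R" for p using fi_free_coeff[OF g] by (cases p) (auto simp: fi_free_act)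
  ultimately show ?thesis using supp(2) unfolding fi_free_carrier by blast
qed

lemma fi_free_module:
  fixes B :: "nat \<Rightarrow> 'l set"
  shows "fi_module R (fi_free R B)"
proof (rule fi_moduleI[OF cring_axioms fi_free_obj_module])
  fix X Y :: "nat set" and f assume f: "finite X" "finite Y" "f \<in> fi_hom X Y"
  show "fi_act (fi_free R B) X Y f \<in> linear_maps R (fi_obj (fi_free R B) X) (fi_obj (fi_free R B) Y)"
    by (intro linear_mapsI add_homsI fi_free_act_closed[OF f(3)])
       (auto simp: fun_eq_iff fi_free_act dest: fi_free_coeff)
next
  fix X :: "nat set" and g :: "nat list \<times> 'l \<Rightarrow> 'a"
  assume "finite X" and g: "g \<in> carrier (fi_obj (fi_free R B) X)"
  show "fi_act (fi_free R B) X X (\<lambda>x\<in>X. x) g = g"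
  proof (rule ext, clarify)
    fix l b
    have img: "(\<lambda>x\<in>X. x) ` X = X" by auto
    have "inv_into X (\<lambda>x\<in>X. x) x = x" if "x \<in> X" for x
      using inv_into_f_f[of "\<lambda>x\<in>X. x" X x] that by (simp add: inj_on_def)
    then have "map (inv_into X (\<lambda>x\<in>X. x)) l = l" if "set l \<subseteq> X" using that by (intro map_idI) auto
    moreover have "g (l, b) = \<zero>" if "\<not> set l \<subseteq> X"
      using g that by (auto simp: fi_free_carrier free_index_def)
    ultimately show "fi_act (fi_free R B) X X (\<lambda>x\<in>X. x) g (l, b) = g (l, b)"
      by (simp only: fi_free_act img split: if_split) simp
  qed
next
  fix X Y Z :: "nat set" and f g and v :: "nat list \<times> 'l \<Rightarrow> 'a"
  assume f: "f \<in> fi_hom X Y" and g: "g \<in> fi_hom Y Z"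
  show "fi_act (fi_free R B) X Z (compose X g f) v
    = fi_act (fi_free R B) Y Z g (fi_act (fi_free R B) X Y f v)"
  proof (rule ext, clarify)
    fix l b
    have inj: "inj_on f X" "inj_on g Y" "f ` X \<subseteq> Y" using f g by (auto simp: fi_hom_def)
    have img: "compose X g f ` X = g ` f ` X" by (auto simp: compose_def)
    have inv: "inv_into X (compose X g f) (g (f x)) = x" if "x \<in> X" for x
      using inv_into_f_f[OF fi_hom_inj[OF fi_hom_compose[OF f g]] that] that by (simp add: compose_def)
    have gi: "inv_into Y g (g y) = y" if "y \<in> Y" for y using inj that by simp
    have fi: "inv_into X f (f x) = x" if "x \<in> X" for x using inj that by simp
    have fY: "f x \<in> Y" if "x \<in> X" for x using inj that by auto
    have sub: "set l \<subseteq> compose X g f ` X \<longleftrightarrow>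
        set l \<subseteq> g ` Y \<and> set (map (inv_into Y g) l) \<subseteq> f ` X"
    proof
      assume "set l \<subseteq> compose X g f ` X"
      then show "set l \<subseteq> g ` Y \<and> set (map (inv_into Y g) l) \<subseteq> f ` X"
        unfolding img using inj(3) by (fastforce simp: gi fY)
    next
      assume a: "set l \<subseteq> g ` Y \<and> set (map (inv_into Y g) l) \<subseteq> f ` X"
      show "set l \<subseteq> compose X g f ` X"
      proof
        fix z assume z: "z \<in> set l"
        then have "z = g (inv_into Y g z)" using a by (auto simp: f_inv_into_f)
        moreover have "inv_into Y g z \<in> f ` X" using a z by auto
        ultimately show "z \<in> compose X g f ` X" unfolding img by blast
      qed
    qed
    have "map (inv_into X (compose X g f)) l = map (inv_into X f) (map (inv_into Y g) l)"
      if "set l \<subseteq> compose X g f ` X"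
    proof -
      have "inv_into X (compose X g f) z = inv_into X f (inv_into Y g z)" if z: "z \<in> set l" for z
      proof -
        obtain x where "x \<in> X" "z = g (f x)" using \<open>set l \<subseteq> compose X g f ` X\<close> z unfolding img by blast
        then show ?thesis by (simp add: inv gi fi fY)
      qed
      then show ?thesis by simp
    qed
    then show "fi_act (fi_free R B) X Z (compose X g f) v (l, b)
      = fi_act (fi_free R B) Y Z g (fi_act (fi_free R B) X Y f v) (l, b)"
      unfolding fi_free_act using sub by metis
  qed
qed

lemma free_gen_closed: "p \<in> free_index B X \<Longrightarrow> free_gen R p \<in> carrier (fi_obj (fi_free R B) X)"
  by (auto simp: fi_free_carrier free_gen_def intro: finite_subset[of _ "{p}"])

lemma fi_free_act_gen:
  assumes f: "f \<in> fi_hom X Y" and l: "set l \<subseteq> X"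
  shows "fi_act (fi_free R B) X Y f (free_gen R (l, b)) = free_gen R (map f l, b)"
proof (rule ext, clarify)
  fix l' b'
  have inj: "inv_into X f (f x) = x" if "x \<in> X" for x using fi_hom_inj[OF f] that by simp
  have "map (inv_into X f) l' = l \<longleftrightarrow> l' = map f l" if l': "set l' \<subseteq> f ` X"
  proof
    assume "map (inv_into X f) l' = l"
    moreover have "map f (map (inv_into X f) l') = l'"
      using l' by (simp only: map_map, intro map_idI) (auto simp: f_inv_into_f)
    ultimately show "l' = map f l" by simp
  next
    assume "l' = map f l"
    then show "map (inv_into X f) l' = l" using l by (simp only: map_map, intro map_idI) (auto simp: inj)
  qed
  moreover have "set (map f l) \<subseteq> f ` X" using l by auto
  ultimately show "fi_act (fi_free R B) X Y f (free_gen R (l, b)) (l', b')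
    = free_gen R (map f l, b) (l', b')"
    unfolding fi_free_act by (auto simp: free_gen_def)
qed

lemma fi_free_ext:
  assumes M: "Module.module R M" and h: "h \<in> linear_maps R (fi_obj (fi_free R B) X) M"
    and k: "k \<in> linear_maps R (fi_obj (fi_free R B) X) M"
    and eq: "\<And>p. p \<in> free_index B X \<Longrightarrow> h (free_gen R p) = k (free_gen R p)"
    and g: "g \<in> carrier (fi_obj (fi_free R B) X)"
  shows "h g = k g"
proof -
  note ha = linear_maps_add_homs[OF h] and ka = linear_maps_add_homs[OF k]
  note F = fi_free_obj_module[of B X]
  have ag: "abelian_group (fi_obj (fi_free R B) X)" "abelian_group M"
    using F M by (auto simp: Module.module_def)
  have "h g = k g" if "finite S" "g \<in> carrier (fi_obj (fi_free R B) X)" "{p. g p \<noteq> \<zero>} \<subseteq> S" for S g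
    using that
  proof (induction S arbitrary: g rule: finite_induct)
    case empty
    then have "g = \<zero>\<^bsub>fi_obj (fi_free R B) X\<^esub>" by auto
    then show ?case using add_homs_zero[OF ha ag] add_homs_zero[OF ka ag] by simp
  next
    case (insert p S)
    show ?case
    proof (cases "g p = \<zero>")
      case True
      then show ?thesis using insert.prems by (intro insert.IH) auto
    next
      case False
      then have p: "p \<in> free_index B X" using insert.prems by (auto simp: fi_free_carrier)
      have gc: "g q \<in> carrier R" for q by (rule fi_free_coeff[OF insert.prems(1)])
      have g': "g(p := \<zero>) \<in> carrier (fi_obj (fi_free R B) X)"
        by (rule fi_free_carrier_subset[OF insert.prems(1)]) (auto simp: gc)
      note dp = free_gen_closed[OF p]
      have sc: "g p \<odot>\<^bsub>fi_obj (fi_free R B) X\<^esub> free_gen R p \<in> carrier (fi_obj (fi_free R B) X)"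
        by (rule Module.module.smult_closed[OF F gc dp])
      have dec: "g = g(p := \<zero>) \<oplus>\<^bsub>fi_obj (fi_free R B) X\<^esub> (g p \<odot>\<^bsub>fi_obj (fi_free R B) X\<^esub> free_gen R p)"
        by (auto simp: fun_eq_iff free_gen_def gc)
      have "h (g(p := \<zero>)) = k (g(p := \<zero>))"
        using insert.prems(2) by (intro insert.IH[OF g']) auto
      then show ?thesis
        by (subst (1 2) dec)
           (simp only: add_homs_add[OF ha g' sc] add_homs_add[OF ka g' sc]
             linear_maps_smult[OF h gc dp] linear_maps_smult[OF k gc dp] eq[OF p])
    qed
  qed
  then show ?thesis using g by (auto simp: fi_free_carrier)
qed

end

section \<open>Morphisms out of a free FI-module\<close>

definition list_inj :: "nat list \<Rightarrow> nat \<Rightarrow> nat" where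
  "list_inj l = (\<lambda>i\<in>{0..<length l}. l ! i)"

lemma list_inj_fi_hom: "distinct l \<Longrightarrow> set l \<subseteq> X \<Longrightarrow> list_inj l \<in> fi_hom {0..<length l} X"
  unfolding list_inj_def by (intro fi_homI) (auto simp: inj_on_def nth_eq_iff_index_eq)

lemma map_list_inj: "map (list_inj l) [0..<length l] = l"
  by (auto simp: list_inj_def intro: nth_equalityI)

lemma list_inj_compose: "compose {0..<length l} f (list_inj l) = list_inj (map f l)"
  by (auto simp: fun_eq_iff compose_def list_inj_def)

text \<open>The value that naturality forces at the pair \<open>p\<close> once each generator b over
  \<open>{0..<n}\<close> is sent to \<open>a n b\<close>.\<close>

definition free_point :: "('a, 'b) fi_mod \<Rightarrow> (nat \<Rightarrow> 'l \<Rightarrow> 'b) \<Rightarrow> nat set \<Rightarrow> nat list \<times> 'l \<Rightarrow> 'b" where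
  "free_point A a X p = fi_act A {0..<length (fst p)} X (list_inj (fst p)) (a (length (fst p)) (snd p))"

definition free_eval ::
  "('a, 'x) ring_scheme \<Rightarrow> ('a, 'b) fi_mod \<Rightarrow> (nat \<Rightarrow> 'l \<Rightarrow> 'b) \<Rightarrow> (nat list \<times> 'l \<Rightarrow> 'a, 'b) fi_map" where
  "free_eval R A a X g
    = (\<Oplus>\<^bsub>fi_obj A X\<^esub> p\<in>{p. g p \<noteq> \<zero>\<^bsub>R\<^esub>}. g p \<odot>\<^bsub>fi_obj A X\<^esub> free_point A a X p)"

context fi_module
begin

lemma free_point_closed:
  assumes "\<And>n b. b \<in> B n \<Longrightarrow> a n b \<in> carrier (fi_obj V {0..<n})" "finite X" "p \<in> free_index B X"
  shows "free_point V a X p \<in> carrier (fi_obj V X)"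
  using assms unfolding free_point_def free_index_def
  by (intro act_closed list_inj_fi_hom) auto

lemma free_point_act:
  assumes a: "\<And>n b. b \<in> B n \<Longrightarrow> a n b \<in> carrier (fi_obj V {0..<n})" and X: "finite X" "finite Y"
    and f: "f \<in> fi_hom X Y" and p: "(l, b) \<in> free_index B X"
  shows "fi_act V X Y f (free_point V a X (l, b)) = free_point V a Y (map f l, b)"
proof -
  have l: "distinct l" "set l \<subseteq> X" "b \<in> B (length l)" using p by (auto simp: free_index_def)
  show ?thesis
    using act_compose[OF _ X list_inj_fi_hom[OF l(1,2)] f a[OF l(3)]]
    by (simp add: free_point_def list_inj_compose)
qed

text \<open>Supports change under addition and scaling; a common larger index set makes the sums
  comparable.\<close>

lemma free_eval_superset:
  assumes a: "\<And>n b. b \<in> B n \<Longrightarrow> a n b \<in> carrier (fi_obj V {0..<n})" and X: "finite X"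
    and g: "g \<in> carrier (fi_obj (fi_free R B) X)"
    and S: "finite S" "{p. g p \<noteq> \<zero>} \<subseteq> S" "S \<subseteq> free_index B X"
  shows "free_eval R V a X g = (\<Oplus>\<^bsub>fi_obj V X\<^esub> p\<in>S. g p \<odot>\<^bsub>fi_obj V X\<^esub> free_point V a X p)"
proof -
  interpret M: Module.module R "fi_obj V X" by (rule obj_module[OF X])
  have c: "g p \<odot>\<^bsub>fi_obj V X\<^esub> free_point V a X p \<in> carrier (fi_obj V X)" if "p \<in> S" for p
    using fi_free_coeff[OF g] S that free_point_closed[of B a X p, OF a X] by (intro M.smult_closed) auto
  show ?thesis
    unfolding free_eval_def
  proof (rule M.add.finprod_mono_neutral_cong_left[OF S(1,2)])
    show "g p \<odot>\<^bsub>fi_obj V X\<^esub> free_point V a X p = \<zero>\<^bsub>fi_obj V X\<^esub>" if "p \<in> S - {p. g p \<noteq> \<zero>}" for p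
      using S(3) that free_point_closed[of B a X p, OF a X] by (auto intro!: M.smult_l_null)
  qed (use c in auto)
qed

lemma free_eval_linear:
  assumes a: "\<And>n b. b \<in> B n \<Longrightarrow> a n b \<in> carrier (fi_obj V {0..<n})" and X: "finite X"
  shows "free_eval R V a X \<in> linear_maps R (fi_obj (fi_free R B) X) (fi_obj V X)"
proof -
  interpret M: Module.module R "fi_obj V X" by (rule obj_module[OF X])
  interpret F: Module.module R "fi_obj (fi_free R B) X" by (rule fi_free_obj_module)
  note pc = free_point_closed[of B a X, OF a X]
  have gR: "g p \<in> carrier R" if "g \<in> carrier (fi_obj (fi_free R B) X)" for g p
    using that by (rule fi_free_coeff)
  have gS: "finite {p. g p \<noteq> \<zero>}" "{p. g p \<noteq> \<zero>} \<subseteq> free_index B X"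
    if "g \<in> carrier (fi_obj (fi_free R B) X)" for g
    using fi_free_supp[OF that] by simp_all
  show ?thesis
  proof (intro linear_mapsI add_homsI)
    fix g assume g: "g \<in> carrier (fi_obj (fi_free R B) X)"
    show "free_eval R V a X g \<in> carrier (fi_obj V X)"
      unfolding free_eval_def using gS[OF g] gR[OF g] pc by (intro M.finsum_closed Pi_I M.smult_closed) blast+
  next
    fix g h assume g: "g \<in> carrier (fi_obj (fi_free R B) X)" and h: "h \<in> carrier (fi_obj (fi_free R B) X)"
    let ?S = "{p. g p \<noteq> \<zero>} \<union> {p. h p \<noteq> \<zero>}" and ?t = "free_point V a X"
    have S: "finite ?S" "?S \<subseteq> free_index B X" using gS[OF g] gS[OF h] by auto
    have gh: "g \<oplus>\<^bsub>fi_obj (fi_free R B) X\<^esub> h \<in> carrier (fi_obj (fi_free R B) X)"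
      by (rule F.a_closed[OF g h])
    have "free_eval R V a X (g \<oplus>\<^bsub>fi_obj (fi_free R B) X\<^esub> h)
      = (\<Oplus>\<^bsub>fi_obj V X\<^esub> p\<in>?S. (g \<oplus>\<^bsub>fi_obj (fi_free R B) X\<^esub> h) p \<odot>\<^bsub>fi_obj V X\<^esub> ?t p)"
      by (rule free_eval_superset[OF a X gh S(1) _ S(2)]) auto
    also have "\<dots> = (\<Oplus>\<^bsub>fi_obj V X\<^esub> p\<in>?S. g p \<odot>\<^bsub>fi_obj V X\<^esub> ?t p \<oplus>\<^bsub>fi_obj V X\<^esub> h p \<odot>\<^bsub>fi_obj V X\<^esub> ?t p)"
      using S(2) gR[OF g] gR[OF h] pc
      by (intro M.finsum_cong') (auto simp: subset_iff intro!: M.smult_l_distr)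
    also have "\<dots> = (\<Oplus>\<^bsub>fi_obj V X\<^esub> p\<in>?S. g p \<odot>\<^bsub>fi_obj V X\<^esub> ?t p) \<oplus>\<^bsub>fi_obj V X\<^esub>
        (\<Oplus>\<^bsub>fi_obj V X\<^esub> p\<in>?S. h p \<odot>\<^bsub>fi_obj V X\<^esub> ?t p)"
      using S gR[OF g] gR[OF h] pc by (intro M.finsum_addf) (auto simp: subset_iff)
    also have "\<dots> = free_eval R V a X g \<oplus>\<^bsub>fi_obj V X\<^esub> free_eval R V a X h"
      using free_eval_superset[OF a X g S(1) _ S(2)] free_eval_superset[OF a X h S(1) _ S(2)] by simp
    finally show "free_eval R V a X (g \<oplus>\<^bsub>fi_obj (fi_free R B) X\<^esub> h)
      = free_eval R V a X g \<oplus>\<^bsub>fi_obj V X\<^esub> free_eval R V a X h" .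
  next
    fix r g assume r: "r \<in> carrier R" and g: "g \<in> carrier (fi_obj (fi_free R B) X)"
    let ?S = "{p. g p \<noteq> \<zero>}" and ?t = "free_point V a X"
    have "free_eval R V a X (r \<odot>\<^bsub>fi_obj (fi_free R B) X\<^esub> g)
      = (\<Oplus>\<^bsub>fi_obj V X\<^esub> p\<in>?S. (r \<odot>\<^bsub>fi_obj (fi_free R B) X\<^esub> g) p \<odot>\<^bsub>fi_obj V X\<^esub> ?t p)"
      by (rule free_eval_superset[OF a X F.smult_closed[OF r g] gS(1)[OF g] _ gS(2)[OF g]])
         (auto simp: r)
    also have "\<dots> = (\<Oplus>\<^bsub>fi_obj V X\<^esub> p\<in>?S. r \<odot>\<^bsub>fi_obj V X\<^esub> (g p \<odot>\<^bsub>fi_obj V X\<^esub> ?t p))"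
      using gS(2)[OF g] gR[OF g] pc r
      by (intro M.finsum_cong') (auto simp: subset_iff intro!: M.smult_assoc1)
    also have "\<dots> = r \<odot>\<^bsub>fi_obj V X\<^esub> free_eval R V a X g"
      unfolding free_eval_def using gS[OF g] gR[OF g] pc r
      by (intro M.finsum_smult_ldistr[symmetric]) (auto simp: subset_iff)
    finally show "free_eval R V a X (r \<odot>\<^bsub>fi_obj (fi_free R B) X\<^esub> g) = r \<odot>\<^bsub>fi_obj V X\<^esub> free_eval R V a X g" .
  qed
qed

lemma free_eval_gen:
  assumes a: "\<And>n b. b \<in> B n \<Longrightarrow> a n b \<in> carrier (fi_obj V {0..<n})" and X: "finite X"
    and p: "p \<in> free_index B X"
  shows "free_eval R V a X (free_gen R p) = free_point V a X p"
proof -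
  interpret M: Module.module R "fi_obj V X" by (rule obj_module[OF X])
  have "free_eval R V a X (free_gen R p)
    = (\<Oplus>\<^bsub>fi_obj V X\<^esub> q\<in>{p}. free_gen R p q \<odot>\<^bsub>fi_obj V X\<^esub> free_point V a X q)"
    by (rule free_eval_superset[OF a X free_gen_closed[OF p]]) (auto simp: p free_gen_def)
  then show ?thesis using free_point_closed[of B a X, OF a X p] by (simp add: free_gen_def)
qed

lemma free_eval_morphism:
  assumes a: "\<And>n b. b \<in> B n \<Longrightarrow> a n b \<in> carrier (fi_obj V {0..<n})"
  shows "free_eval R V a \<in> fi_morphisms R (fi_free R B) V"
proof (rule fi_morphismsI[OF free_eval_linear[OF a]])
  fix X Y :: "nat set" and f g
  assume *: "finite X" "finite Y" "f \<in> fi_hom X Y" "g \<in> carrier (fi_obj (fi_free R B) X)"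
  interpret F: fi_module R "fi_free R B" by (rule fi_free_module)
  show "free_eval R V a Y (fi_act (fi_free R B) X Y f g) = fi_act V X Y f (free_eval R V a X g)"
  proof (rule fi_free_ext[OF obj_module[OF *(2)] _ _ _ *(4)])
    fix p assume p: "p \<in> free_index B X"
    obtain l b where lb: "p = (l, b)" by (cases p)
    have "(map f l, b) \<in> free_index B Y"
      using p lb fi_hom_mem[OF *(3)] fi_hom_inj[OF *(3)]
      by (auto simp: free_index_def distinct_map intro: inj_on_subset)
    then show "free_eval R V a Y (fi_act (fi_free R B) X Y f (free_gen R p))
      = fi_act V X Y f (free_eval R V a X (free_gen R p))"
      using p fi_free_act_gen[OF *(3), where l = l and B = B and b = b] free_point_act[of B a X Y f l b, OF a *(1-3)]
      by (simp add: lb free_eval_gen[OF a] *(1,2)) (auto simp: free_index_def free_eval_gen[OF a] *(2))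
  next
    show "(\<lambda>g. free_eval R V a Y (fi_act (fi_free R B) X Y f g)) \<in> linear_maps R (fi_obj (fi_free R B) X) (fi_obj V Y)"
      by (rule linear_maps_comp[OF F.act_linear[OF *(1-3)] free_eval_linear[of B a, OF a *(2)]])
    show "(\<lambda>g. fi_act V X Y f (free_eval R V a X g)) \<in> linear_maps R (fi_obj (fi_free R B) X) (fi_obj V Y)"
      by (rule linear_maps_comp[OF free_eval_linear[of B a, OF a *(1)] act_linear[OF *(1-3)]])
  qed
qed simp

end

text \<open>Preimages under \<open>\<pi>\<close> are chosen for the generators
  \<open>([0..<n], b)\<close> only; every other basis pair is the image of such a generator under an
  injection.\<close>

lemma fi_free_lift:
  assumes A: "fi_module R A" and C: "fi_module R C" and \<pi>: "\<pi> \<in> fi_morphisms R A C" "fi_epi A C \<pi>"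
    and \<psi>: "\<psi> \<in> fi_morphisms R (fi_free R B) C"
  shows "\<exists>\<chi>\<in>fi_morphisms R (fi_free R B) A.
    \<forall>X. finite X \<longrightarrow> (\<forall>v\<in>carrier (fi_obj (fi_free R B) X). \<pi> X (\<chi> X v) = \<psi> X v)"
proof -
  interpret A: fi_module R A by fact
  interpret C: fi_module R C by fact
  interpret F: fi_module R "fi_free R B" by (rule A.fi_free_module)
  have gen: "([0..<n], b) \<in> free_index B {0..<n}" if "b \<in> B n" for n b
    using that by (auto simp: free_index_def)
  let ?gen = "\<lambda>n b. free_gen R ([0..<n], b)"
  have "\<exists>x. b \<in> B n \<longrightarrow> x \<in> carrier (fi_obj A {0..<n}) \<and> \<pi> {0..<n} x = \<psi> {0..<n} (?gen n b)" for n b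
    using fi_epiD[OF \<pi>(2), of "{0..<n}"] fi_morphisms_closed[OF \<psi> _ A.free_gen_closed[OF gen]] by blast
  then have "\<forall>n b. \<exists>x. b \<in> B n \<longrightarrow> x \<in> carrier (fi_obj A {0..<n}) \<and> \<pi> {0..<n} x = \<psi> {0..<n} (?gen n b)"
    by simp
  then have "\<exists>a. \<forall>n b. b \<in> B n \<longrightarrow> a n b \<in> carrier (fi_obj A {0..<n}) \<and>
      \<pi> {0..<n} (a n b) = \<psi> {0..<n} (?gen n b)"
    by (simp only: choice_iff)
  then obtain a where a: "\<And>n b. b \<in> B n \<Longrightarrow> a n b \<in> carrier (fi_obj A {0..<n})"
    "\<And>n b. b \<in> B n \<Longrightarrow> \<pi> {0..<n} (a n b) = \<psi> {0..<n} (?gen n b)" by auto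
  note e = A.free_eval_morphism[of B a, OF a(1)]
  have "\<pi> X (free_eval R A a X v) = \<psi> X v" if X: "finite X" and v: "v \<in> carrier (fi_obj (fi_free R B) X)" for X v
  proof (rule A.fi_free_ext[OF C.obj_module[OF X] _ fi_morphisms_linear[OF \<psi> X] _ v])
    show "(\<lambda>v. \<pi> X (free_eval R A a X v)) \<in> linear_maps R (fi_obj (fi_free R B) X) (fi_obj C X)"
      by (rule linear_maps_comp[OF A.free_eval_linear[OF a(1) X] fi_morphisms_linear[OF \<pi>(1) X]])
    fix p assume p: "p \<in> free_index B X"
    obtain l b where lb: "p = (l, b)" by (cases p)
    have l: "distinct l" "set l \<subseteq> X" "b \<in> B (length l)" using p by (auto simp: free_index_def lb)
    let ?n = "length l"
    have h: "list_inj l \<in> fi_hom {0..<?n} X" by (rule list_inj_fi_hom[OF l(1,2)])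
    have "\<pi> X (free_eval R A a X (free_gen R p)) = \<pi> X (fi_act A {0..<?n} X (list_inj l) (a ?n b))"
      by (simp only: A.free_eval_gen[of B a, OF a(1) X p]) (simp add: lb free_point_def)
    also have "\<dots> = fi_act C {0..<?n} X (list_inj l) (\<psi> {0..<?n} (?gen ?n b))"
      using fi_morphisms_natural[OF \<pi>(1) _ X h a(1)[OF l(3)]] a(2)[OF l(3)] by simp
    also have "\<dots> = \<psi> X (fi_act (fi_free R B) {0..<?n} X (list_inj l) (?gen ?n b))"
      using fi_morphisms_natural[OF \<psi> _ X h A.free_gen_closed[OF gen[OF l(3)]]] by simp
    also have "fi_act (fi_free R B) {0..<?n} X (list_inj l) (?gen ?n b) = free_gen R p"
      using A.fi_free_act_gen[OF h, where l = "[0..<?n]" and B = B and b = b] by (simp add: map_list_inj lb)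
    finally show "\<pi> X (free_eval R A a X (free_gen R p)) = \<psi> X (free_gen R p)" .
  qed
  with e show ?thesis by blast
qed

text \<open>The retraction drops all basis pairs whose list contains the added point 0 and lowers
  the entries of the others by one. It is natural because \<open>add_star_map\<close> fixes 0 and
  sends no other point to it.\<close>

lemma fi_free_split:
  fixes B :: "nat \<Rightarrow> 'l set"
  assumes R: "cring R" shows "fi_split R (fi_free R B)"
proof -
  interpret cring R by fact
  let ?F = "fi_free R B"
  interpret F: fi_module R ?F by (rule fi_free_module)
  let ?\<rho> = "\<lambda>X (g :: nat list \<times> 'l \<Rightarrow> 'a) (l, b). g (map Suc l, b)"
  have c: "?\<rho> X g \<in> carrier (fi_obj ?F X)" if g: "g \<in> carrier (fi_obj ?F (add_star X))" for X g
  proof -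
    have "{p. ?\<rho> X g p \<noteq> \<zero>\<^bsub>R\<^esub>} \<subseteq> (\<lambda>(l, b). (map Suc l, b)) -` {p. g p \<noteq> \<zero>\<^bsub>R\<^esub>}" by auto
    moreover have "finite ((\<lambda>(l, b). (map Suc l, b)) -` {p. g p \<noteq> \<zero>\<^bsub>R\<^esub>})"
      using g by (intro finite_vimageI) (auto simp: fi_free_carrier inj_on_def)
    ultimately have "finite {p. ?\<rho> X g p \<noteq> \<zero>\<^bsub>R\<^esub>}" by (rule finite_subset)
    moreover have "{p. ?\<rho> X g p \<noteq> \<zero>\<^bsub>R\<^esub>} \<subseteq> free_index B X"
    proof clarify
      fix l b assume "g (map Suc l, b) \<noteq> \<zero>\<^bsub>R\<^esub>"
      then have "(map Suc l, b) \<in> free_index B (add_star X)" using g by (auto simp: fi_free_carrier)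
      then show "(l, b) \<in> free_index B X"
        by (auto simp: free_index_def distinct_map subset_iff)
    qed
    ultimately show ?thesis using g by (auto simp: fi_free_carrier)
  qed
  have "?\<rho> \<in> fi_morphisms R (fi_shift ?F) ?F"
  proof (rule fi_morphismsI)
    fix X :: "nat set" assume "finite X"
    show "?\<rho> X \<in> linear_maps R (fi_obj (fi_shift ?F) X) (fi_obj ?F X)"
      by (intro linear_mapsI add_homsI c) (auto simp: fun_eq_iff)
  next
    fix X Y :: "nat set" and f g assume f: "f \<in> fi_hom X Y" and g: "g \<in> carrier (fi_obj (fi_shift ?F) X)"
    show "?\<rho> Y (fi_act (fi_shift ?F) X Y f g) = fi_act ?F X Y f (?\<rho> X g)"
    proof (rule ext)
      fix p :: "nat list \<times> 'l"
      obtain l b where lb: "p = (l, b)" by (cases p)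
      let ?f = "add_star_map X f"
      have fs: "?f \<in> fi_hom (add_star X) (add_star Y)" by (rule add_star_map_fi_hom[OF f])
      have sub: "set (map Suc l) \<subseteq> ?f ` add_star X \<longleftrightarrow> set l \<subseteq> f ` X"
      proof -
        have "Suc x \<in> ?f ` add_star X \<longleftrightarrow> x \<in> f ` X" for x
        proof
          assume "Suc x \<in> ?f ` add_star X"
          then obtain y where y: "y \<in> add_star X" "Suc x = ?f y" by auto
          then show "x \<in> f ` X" by (cases rule: add_star_cases[OF y(1)]) auto
        next
          assume "x \<in> f ` X"
          then obtain y where "y \<in> X" "x = f y" by auto
          then show "Suc x \<in> ?f ` add_star X" by (intro image_eqI[of _ _ "Suc y"]) auto
        qed
        then show ?thesis by (simp only: set_map image_subset_iff subset_iff[of "set l"] Ball_def)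
      qed
      have "inv_into (add_star X) ?f (Suc x) = Suc (inv_into X f x)" if x: "x \<in> f ` X" for x
        using inv_into_f_f[OF fi_hom_inj[OF fs], of "Suc (inv_into X f x)"] inv_into_into[OF x]
          f_inv_into_f[OF x] by simp
      then have inv: "map (inv_into (add_star X) ?f) (map Suc l) = map Suc (map (inv_into X f) l)"
        if "set l \<subseteq> f ` X" using that by (auto simp: subset_iff)
      show "?\<rho> Y (fi_act (fi_shift ?F) X Y f g) p = fi_act ?F X Y f (?\<rho> X g) p"
        unfolding lb
      proof (cases "set l \<subseteq> f ` X")
        case True
        then show "?\<rho> Y (fi_act (fi_shift ?F) X Y f g) (l, b) = fi_act ?F X Y f (?\<rho> X g) (l, b)"
          unfolding fi_shift_simps by (simp only: case_prod_conv fi_free_act sub inv if_True)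
      next
        case False
        then show "?\<rho> Y (fi_act (fi_shift ?F) X Y f g) (l, b) = fi_act ?F X Y f (?\<rho> X g) (l, b)"
          unfolding fi_shift_simps by (simp only: case_prod_conv fi_free_act sub if_False)
      qed
    qed
  qed
  moreover have "?\<rho> X (fi_iota ?F X g) = g" if g: "g \<in> carrier (fi_obj ?F X)" for X g
  proof (rule ext)
    fix p :: "nat list \<times> 'l"
    obtain l b where lb: "p = (l, b)" by (cases p)
    have sub: "set (map Suc l) \<subseteq> succ_map X ` X \<longleftrightarrow> set l \<subseteq> X" by (auto simp: subset_iff image_iff)
    have "inv_into X (succ_map X) (Suc x) = x" if "x \<in> X" for x
      using inv_into_f_f[OF fi_hom_inj[OF succ_map_fi_hom] that] that by simp
    then have inv: "map (inv_into X (succ_map X)) (map Suc l) = l" if "set l \<subseteq> X"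
      using that by (simp only: map_map, intro map_idI) auto
    have zero: "g (l, b) = \<zero>\<^bsub>R\<^esub>" if "\<not> set l \<subseteq> X"
      using g that by (auto simp: fi_free_carrier free_index_def)
    show "?\<rho> X (fi_iota ?F X g) p = g p"
    proof (cases "set l \<subseteq> X")
      case True
      then show ?thesis
        unfolding lb fi_iota_def by (simp only: case_prod_conv fi_free_act sub inv if_True)
    next
      case False
      then show ?thesis
        using zero[OF False] unfolding lb fi_iota_def
        by (simp only: case_prod_conv fi_free_act sub if_False)
    qed
  qed
  ultimately show ?thesis unfolding fi_split_def by (intro bexI[of _ ?\<rho>]) simp_all
qed

section \<open>Free covers in the universe of elements\<close>

text \<open>Transport of structure along an encoding of elements: free FI-modules consist of
  functions, a type in which iterated covers could not stay. The encoding has to be injective on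
  each carrier separately, hence decoding depends on X.\<close>

definition fi_copy :: "('b \<Rightarrow> 'd) \<Rightarrow> ('a, 'b) fi_mod \<Rightarrow> ('a, 'd) fi_mod" where
  "fi_copy e V = (let dec = (\<lambda>X. inv_into (carrier (fi_obj V X)) e) in \<lparr>
     fi_obj = (\<lambda>X. \<lparr>carrier = e ` carrier (fi_obj V X), mult = undefined, one = undefined,
       zero = e \<zero>\<^bsub>fi_obj V X\<^esub>, add = (\<lambda>x y. e (dec X x \<oplus>\<^bsub>fi_obj V X\<^esub> dec X y)),
       smult = (\<lambda>r x. e (r \<odot>\<^bsub>fi_obj V X\<^esub> dec X x))\<rparr>),
     fi_act = (\<lambda>X Y f x. e (fi_act V X Y f (dec X x)))\<rparr>)"

locale fi_encoding = fi_module R V for R :: "('a, 'x) ring_scheme" and V :: "('a, 'b) fi_mod" +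
  fixes e :: "'b \<Rightarrow> 'd"
  assumes e_inj: "finite X \<Longrightarrow> inj_on e (carrier (fi_obj V X))"
begin

abbreviation "decode X \<equiv> inv_into (carrier (fi_obj V X)) e"

lemma decode [simp]: "finite X \<Longrightarrow> u \<in> carrier (fi_obj V X) \<Longrightarrow> decode X (e u) = u"
  using e_inj by (rule inv_into_f_f)

lemma copy_simps:
  "carrier (fi_obj (fi_copy e V) X) = e ` carrier (fi_obj V X)"
  "\<zero>\<^bsub>fi_obj (fi_copy e V) X\<^esub> = e \<zero>\<^bsub>fi_obj V X\<^esub>"
  "x \<oplus>\<^bsub>fi_obj (fi_copy e V) X\<^esub> y = e (decode X x \<oplus>\<^bsub>fi_obj V X\<^esub> decode X y)"
  "r \<odot>\<^bsub>fi_obj (fi_copy e V) X\<^esub> x = e (r \<odot>\<^bsub>fi_obj V X\<^esub> decode X x)"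
  "fi_act (fi_copy e V) X Y f x = e (fi_act V X Y f (decode X x))"
  by (simp_all add: fi_copy_def Let_def)

lemma copy_obj_module: assumes X: "finite X" shows "Module.module R (fi_obj (fi_copy e V) X)"
proof -
  interpret M: Module.module R "fi_obj V X" by (rule obj_module[OF X])
  have "abelian_group (fi_obj (fi_copy e V) X)"
  proof (rule abelian_groupI)
    fix x assume "x \<in> carrier (fi_obj (fi_copy e V) X)"
    then obtain u where u: "u \<in> carrier (fi_obj V X)" "x = e u" by (auto simp: copy_simps)
    show "\<exists>y\<in>carrier (fi_obj (fi_copy e V) X). y \<oplus>\<^bsub>fi_obj (fi_copy e V) X\<^esub> x = \<zero>\<^bsub>fi_obj (fi_copy e V) X\<^esub>"
      using u X by (intro bexI[of _ "e (\<ominus>\<^bsub>fi_obj V X\<^esub> u)"]) (auto simp: copy_simps M.l_neg)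
    show "x \<oplus>\<^bsub>fi_obj (fi_copy e V) X\<^esub> y = y \<oplus>\<^bsub>fi_obj (fi_copy e V) X\<^esub> x"
      if "y \<in> carrier (fi_obj (fi_copy e V) X)" for y
      using that u X by (auto simp: copy_simps M.a_comm)
  qed (auto simp: copy_simps X M.a_assoc)
  then show ?thesis
    by (rule Module.moduleI[OF cring_axioms])
       (auto simp: copy_simps X M.smult_l_distr M.smult_r_distr M.smult_assoc1)
qed

lemma copy_module: "fi_module R (fi_copy e V)"
proof (rule fi_moduleI[OF cring_axioms copy_obj_module])
  fix X Y :: "nat set" and f assume f: "finite X" "finite Y" "f \<in> fi_hom X Y"
  interpret M: Module.module R "fi_obj V X" by (rule obj_module[OF f(1)])
  note a = act_hom[OF f]
  show "fi_act (fi_copy e V) X Y f \<in> linear_maps R (fi_obj (fi_copy e V) X) (fi_obj (fi_copy e V) Y)"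
    by (intro linear_mapsI add_homsI)
       (auto simp: copy_simps f add_homs_closed[OF a] add_homs_add[OF a]
         linear_maps_smult[OF act_linear[OF f]])
qed (auto simp: copy_simps act_id act_closed act_compose)

lemma encode_morphism: "(\<lambda>X. e) \<in> fi_morphisms R V (fi_copy e V)"
  by (rule fi_morphismsI; (intro linear_mapsI add_homsI)?) (auto simp: copy_simps)

lemma decode_morphism: "decode \<in> fi_morphisms R (fi_copy e V) V"
proof (rule fi_morphismsI)
  fix X :: "nat set" assume X: "finite X"
  interpret M: Module.module R "fi_obj V X" by (rule obj_module[OF X])
  show "decode X \<in> linear_maps R (fi_obj (fi_copy e V) X) (fi_obj V X)"
    by (intro linear_mapsI add_homsI) (auto simp: copy_simps X)
qed (auto simp: copy_simps act_closed)

lemma encode_decode: "finite X \<Longrightarrow> t \<in> carrier (fi_obj (fi_copy e V) X) \<Longrightarrow> e (decode X t) = t"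
  by (auto simp: copy_simps)

end

lemma fi_split_retract:
  assumes "fi_split R W" "fi_module R V" "fi_module R W"
    and i: "i \<in> fi_morphisms R V W" and p: "p \<in> fi_morphisms R W V"
    and pi: "\<And>X v. finite X \<Longrightarrow> v \<in> carrier (fi_obj V X) \<Longrightarrow> p X (i X v) = v"
  shows "fi_split R V"
proof -
  obtain \<rho> where \<rho>: "\<rho> \<in> fi_morphisms R (fi_shift W) W"
    and \<rho>\<iota>: "\<And>X v. finite X \<Longrightarrow> v \<in> carrier (fi_obj W X) \<Longrightarrow> \<rho> X (fi_iota W X v) = v"
    using assms(1) by (auto simp: fi_split_def)
  let ?\<rho> = "\<lambda>X v. p X (\<rho> X (i (add_star X) v))"
  have "?\<rho> \<in> fi_morphisms R (fi_shift V) V"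
    by (rule fi_morphisms_comp[OF fi_morphisms_comp[OF fi_morphisms_shift[OF i] \<rho>] p])
  moreover have "?\<rho> X (fi_iota V X v) = v" if "finite X" "v \<in> carrier (fi_obj V X)" for X v
    using fi_iota_natural[OF i that] \<rho>\<iota>[OF that(1) fi_morphisms_closed[OF i that]] pi[OF that] by simp
  ultimately show ?thesis unfolding fi_split_def by (intro bexI[of _ ?\<rho>]) simp_all
qed

definition free_code ::
  "('a, 'x) ring_scheme \<Rightarrow> (nat list \<times> ('a, 'b) fi_univ \<Rightarrow> 'a) \<Rightarrow> ('a, 'b) fi_univ" where
  "free_code R g = Comb (SOME xs. set xs = (\<lambda>p. (g p, fst p, snd p)) ` {p. g p \<noteq> \<zero>\<^bsub>R\<^esub>})"

text \<open>The chosen list depends only on the graph of the nonzero coefficients, and the set of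
  its entries gives that graph back.\<close>

lemma free_code_inj:
  assumes "finite {p. g p \<noteq> \<zero>\<^bsub>R\<^esub>}" "finite {p. h p \<noteq> \<zero>\<^bsub>R\<^esub>}" "free_code R g = free_code R h"
  shows "g = h"
proof -
  let ?G = "\<lambda>g. (\<lambda>p. (g p, fst p, snd p)) ` {p. g p \<noteq> \<zero>\<^bsub>R\<^esub>}"
  have list: "set (SOME xs. set xs = ?G k) = ?G k" if "finite {p. k p \<noteq> \<zero>\<^bsub>R\<^esub>}" for k
    by (rule someI_ex[OF finite_list]) (rule finite_imageI[OF that])
  have code: "(SOME xs. set xs = ?G g) = (SOME xs. set xs = ?G h)"
    using assms(3) unfolding free_code_def by (rule fi_univ.inject(2)[THEN iffD1])
  have "?G g = set (SOME xs. set xs = ?G g)" by (rule list[OF assms(1), symmetric])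
  also have "\<dots> = set (SOME xs. set xs = ?G h)" by (rule arg_cong[OF code])
  also have "\<dots> = ?G h" by (rule list[OF assms(2)])
  finally have eq: "?G g = ?G h" .
  have "g p = h p" if "?G g = ?G h" "g p \<noteq> \<zero>\<^bsub>R\<^esub>" for g h p
  proof -
    have "(g p, fst p, snd p) \<in> ?G h" unfolding that(1)[symmetric] using that(2) by blast
    then show ?thesis by auto
  qed
  from this[OF eq] this[OF eq[symmetric]] show ?thesis by (metis ext)
qed

abbreviation cover_labels :: "('a, 'c) fi_mod \<Rightarrow> nat \<Rightarrow> 'c set" where
  "cover_labels K n \<equiv> carrier (fi_obj K {0..<n})"

definition fi_cover ::
  "('a, 'x) ring_scheme \<Rightarrow> ('a, ('a, 'b) fi_univ) fi_mod \<Rightarrow> ('a, ('a, 'b) fi_univ) fi_mod" where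
  "fi_cover R K = fi_copy (free_code R) (fi_free R (cover_labels K))"

definition fi_cover_map ::
  "('a, 'x) ring_scheme \<Rightarrow> ('a, ('a, 'b) fi_univ) fi_mod \<Rightarrow> (('a, 'b) fi_univ, ('a, 'b) fi_univ) fi_map" where
  "fi_cover_map R K = (\<lambda>X t. free_eval R K (\<lambda>n b. b) X
     (inv_into (carrier (fi_obj (fi_free R (cover_labels K)) X)) (free_code R) t))"

lemma fi_free_encoding:
  assumes "cring R" shows "fi_encoding R (fi_free R B) (free_code R)"
proof -
  interpret cring R by fact
  interpret F: fi_module R "fi_free R B" by (rule fi_free_module)
  show ?thesis
    by unfold_locales (auto intro!: inj_onI free_code_inj simp: fi_free_supp(1))
qed

lemma fi_cover_module: "cring R \<Longrightarrow> fi_module R (fi_cover R K)"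
  unfolding fi_cover_def by (rule fi_encoding.copy_module[OF fi_free_encoding])

lemma fi_cover_split:
  assumes R: "cring R" shows "fi_split R (fi_cover R K)"
proof -
  interpret cring R by fact
  interpret E: fi_encoding R "fi_free R (cover_labels K)" "free_code R" by (rule fi_free_encoding[OF R])
  show ?thesis
    unfolding fi_cover_def
    by (rule fi_split_retract[OF fi_free_split[OF R] E.copy_module fi_free_module
          E.decode_morphism E.encode_morphism]) (rule E.encode_decode)
qed

lemma fi_cover_map_morphism:
  assumes "fi_module R K" shows "fi_cover_map R K \<in> fi_morphisms R (fi_cover R K) K"
proof -
  interpret K: fi_module R K by fact
  interpret E: fi_encoding R "fi_free R (cover_labels K)" "free_code R"
    by (rule fi_free_encoding[OF K.cring_axioms])
  show ?thesis
    unfolding fi_cover_def fi_cover_map_def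
    by (rule fi_morphisms_comp[OF E.decode_morphism K.free_eval_morphism])
qed

text \<open>An enumeration l of X carries v to an element of K over \<open>{0..<length l}\<close>,
  which is its own label; the basis pair formed by l and this label evaluates to v.\<close>

lemma fi_cover_map_epi:
  assumes "fi_module R K" shows "fi_epi (fi_cover R K) K (fi_cover_map R K)"
proof -
  interpret K: fi_module R K by fact
  let ?B = "cover_labels K"
  interpret E: fi_encoding R "fi_free R ?B" "free_code R"
    by (rule fi_free_encoding[OF K.cring_axioms])
  show ?thesis
    unfolding fi_epi_def
  proof (intro allI impI equalityI)
    fix X :: "nat set" assume X: "finite X"
    show "fi_image (fi_cover R K) (fi_cover_map R K) X \<subseteq> carrier (fi_obj K X)"
      using fi_morphisms_closed[OF fi_cover_map_morphism[OF assms] X] by (auto simp: fi_image_def)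
    show "carrier (fi_obj K X) \<subseteq> fi_image (fi_cover R K) (fi_cover_map R K) X"
    proof
      fix v assume v: "v \<in> carrier (fi_obj K X)"
      obtain l where l: "set l = X" "distinct l" using finite_distinct_list[OF X] by blast
      have h: "list_inj l \<in> fi_hom {0..<length l} X" using l by (intro list_inj_fi_hom) auto
      have bij: "card {0..<length l} = card X" using l distinct_card by fastforce
      have onto: "list_inj l ` {0..<length l} = X"
        using card_image[OF fi_hom_inj[OF h]] bij X h
        by (intro card_subset_eq) (auto simp: fi_hom_def)
      let ?k = "\<lambda>x\<in>X. inv_into {0..<length l} (list_inj l) x"
      have k: "?k \<in> fi_hom X {0..<length l}"
      proof (rule fi_homI)
        show "inv_into {0..<length l} (list_inj l) x \<in> {0..<length l}" if "x \<in> X" for x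
          using that by (intro inv_into_into) (simp add: onto)
      qed (simp add: onto inj_on_inv_into)
      have kh: "compose X (list_inj l) ?k = (\<lambda>x\<in>X. x)"
        using onto by (auto simp: compose_def fun_eq_iff f_inv_into_f)
      let ?b = "fi_act K X {0..<length l} ?k v"
      have b: "?b \<in> ?B (length l)" by (rule K.act_closed[OF X _ k v]) simp
      have p: "(l, ?b) \<in> free_index ?B X" using l b by (auto simp: free_index_def)
      let ?g = "free_gen R (l, ?b)"
      have g: "?g \<in> carrier (fi_obj (fi_free R ?B) X)" by (rule K.free_gen_closed[OF p])
      have "free_eval R K (\<lambda>n b. b) X ?g = free_point K (\<lambda>n b. b) X (l, ?b)"
        by (rule K.free_eval_gen[of ?B "\<lambda>n b. b", OF _ X p])
      also have "\<dots> = fi_act K {0..<length l} X (list_inj l) ?b" by (simp add: free_point_def)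
      also have "\<dots> = v"
        using K.act_compose[OF X _ X k h v] kh K.act_id[OF X v] by simp
      finally have "fi_cover_map R K X (free_code R ?g) = v"
        using E.decode[OF X g] by (simp add: fi_cover_map_def)
      moreover have "free_code R ?g \<in> carrier (fi_obj (fi_cover R K) X)"
        using g by (simp add: fi_cover_def E.copy_simps)
      ultimately show "v \<in> fi_image (fi_cover R K) (fi_cover_map R K) X"
        unfolding fi_image_def by (intro image_eqI[of _ _ "free_code R ?g"]) simp_all
    qed
  qed
qed

text \<open>The test objects live in the universe over the element type of the cover, one level
  above the cover itself; \<open>fi_free_lift\<close> is available there because it leaves the
  element types of its targets free.\<close>

lemma fi_cover_projective:
  assumes R: "cring R" shows "fi_projective R (fi_cover R K)"
  unfolding fi_projective_def
proof (intro conjI allI impI)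
  show "fi_module R (fi_cover R K)" by (rule fi_cover_module[OF R])
  let ?F = "fi_free R (cover_labels K)"
  interpret E: fi_encoding R ?F "free_code R" by (rule fi_free_encoding[OF R])
  fix A C :: "('a, ('a, ('a, 'c) fi_univ) fi_univ) fi_mod" and \<pi> \<psi>
  assume as: "fi_module R A \<and> fi_module R C \<and> \<pi> \<in> fi_morphisms R A C \<and> fi_epi A C \<pi> \<and>
    \<psi> \<in> fi_morphisms R (fi_cover R K) C"
  have "(\<lambda>X v. \<psi> X (free_code R v)) \<in> fi_morphisms R ?F C"
    using fi_morphisms_comp[OF E.encode_morphism] as by (auto simp: fi_cover_def)
  from fi_free_lift[OF _ _ _ _ this, of A \<pi>] as
  obtain \<chi> where \<chi>: "\<chi> \<in> fi_morphisms R ?F A"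
    "\<And>X v. finite X \<Longrightarrow> v \<in> carrier (fi_obj ?F X) \<Longrightarrow> \<pi> X (\<chi> X v) = \<psi> X (free_code R v)" by auto
  have "(\<lambda>X t. \<chi> X (E.decode X t)) \<in> fi_morphisms R (fi_cover R K) A"
    unfolding fi_cover_def by (rule fi_morphisms_comp[OF E.decode_morphism \<chi>(1)])
  moreover have "\<pi> X (\<chi> X (E.decode X t)) = \<psi> X t"
    if "finite X" "t \<in> carrier (fi_obj (fi_cover R K) X)" for X t
    using that \<chi>(2)[OF that(1), of "E.decode X t"] E.encode_decode[of X t]
      fi_morphisms_closed[OF E.decode_morphism that(1), of t]
    by (simp add: fi_cover_def)
  ultimately show "\<exists>\<chi>\<in>fi_morphisms R (fi_cover R K) A. \<forall>X. finite X \<longrightarrow>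
      (\<forall>v\<in>carrier (fi_obj (fi_cover R K) X). \<pi> X (\<chi> X v) = \<psi> X v)"
    by (intro bexI[of _ "\<lambda>X t. \<chi> X (E.decode X t)"]) simp_all
qed

lemma fi_Elt_encoding: "fi_module R V \<Longrightarrow> fi_encoding R V (Elt :: 'b \<Rightarrow> ('a, 'b) fi_univ)"
  for V :: "('a, 'b) fi_mod"
  by (intro fi_encoding.intro fi_encoding_axioms.intro) (auto intro: inj_onI)

text \<open>Lifting the embedding \<open>Elt\<close> of P into its copy through the free cover of
  that copy makes P a retract of a free FI-module, and retracts inherit the splitting.\<close>

lemma fi_projective_split:
  fixes P :: "('a, 'b) fi_mod"
  assumes proj: "fi_projective R P" shows "fi_split R P"
proof -
  have P: "fi_module R P" using proj by (simp add: fi_projective_def)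
  interpret P: fi_module R P by fact
  interpret E: fi_encoding R P "Elt :: 'b \<Rightarrow> ('a, 'b) fi_univ" by (rule fi_Elt_encoding[OF P])
  let ?K = "fi_copy Elt P :: ('a, ('a, 'b) fi_univ) fi_mod"
  note K = E.copy_module
  note C = fi_cover_module[OF P.cring_axioms, of ?K]
  have lift: "\<And>(A :: ('a, ('a, 'b) fi_univ) fi_mod) (B :: ('a, ('a, 'b) fi_univ) fi_mod) \<pi> \<psi>.
      fi_module R A \<and> fi_module R B \<and> \<pi> \<in> fi_morphisms R A B \<and> fi_epi A B \<pi> \<and>
        \<psi> \<in> fi_morphisms R P B \<Longrightarrow>
        \<exists>\<chi>\<in>fi_morphisms R P A. \<forall>X. finite X \<longrightarrow> (\<forall>v\<in>carrier (fi_obj P X). \<pi> X (\<chi> X v) = \<psi> X v)"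
    using proj unfolding fi_projective_def by blast
  have "\<exists>\<chi>\<in>fi_morphisms R P (fi_cover R ?K). \<forall>X. finite X \<longrightarrow>
      (\<forall>v\<in>carrier (fi_obj P X). fi_cover_map R ?K X (\<chi> X v) = Elt v)"
    using lift[of "fi_cover R ?K" ?K "fi_cover_map R ?K" "\<lambda>X. Elt"] C K fi_cover_map_morphism[OF K]
      fi_cover_map_epi[OF K] E.encode_morphism by blast
  then obtain \<chi> where \<chi>: "\<chi> \<in> fi_morphisms R P (fi_cover R ?K)"
    "\<And>X v. finite X \<Longrightarrow> v \<in> carrier (fi_obj P X) \<Longrightarrow> fi_cover_map R ?K X (\<chi> X v) = Elt v" by blast
  show ?thesis
  proof (rule fi_split_retract[OF fi_cover_split[OF P.cring_axioms] P C \<chi>(1)])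
    show "(\<lambda>X t. E.decode X (fi_cover_map R ?K X t)) \<in> fi_morphisms R (fi_cover R ?K) P"
      by (rule fi_morphisms_comp[OF fi_cover_map_morphism[OF K] E.decode_morphism])
  qed (simp add: \<chi>(2))
qed

section \<open>Homology by dimension shifting\<close>

lemma fi_kernel_right_exact:
  assumes P: "fi_module R P" and D: "fi_module R D" and q: "q \<in> fi_morphisms R P D" "fi_epi P D q"
  shows "fi_right_exact R (fi_sub P (fi_kernel P D q)) (\<lambda>X v. v) P q D"
proof -
  note k = fi_subobject_kernel[OF q(1) P D]
  show ?thesis
    using fi_sub_module[OF P k] fi_sub_incl[OF P k] assms
    by (simp add: fi_right_exact_def fi_exact_def fi_image_def)
qed

lemma fi_mono_incl: "fi_mono V (\<lambda>X v. v)"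
  by (simp add: fi_mono_def)

lemma fi_corestrict:
  assumes "q \<in> fi_morphisms R P D" "\<And>X v. finite X \<Longrightarrow> v \<in> carrier (fi_obj P X) \<Longrightarrow> q X v \<in> N X"
  shows "q \<in> fi_morphisms R P (fi_sub D N)"
  by (rule fi_morphismsI)
     (use assms in \<open>auto simp: fi_morphisms_natural linear_maps_def dest!: fi_morphisms_linear\<close>)

text \<open>Vanishing of H_1(D) makes F(U) -> F(P) injective. Through \<open>fi_J_koszul\<close>
  decomposability is being a boundary, so the claim is that a boundary of P lying in U already
  bounds in U.\<close>

lemma fi_J_kernel:
  assumes re: "fi_right_exact R U i P q D" and mono: "fi_mono U i" and ex: "koszul_exact n D 1"
    and z: "z \<in> carrier (fi_obj U {0..<n})" "i {0..<n} z \<in> fi_J R P {0..<n}"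
  shows "z \<in> fi_J R U {0..<n}"
proof -
  have U: "fi_module R U" and P: "fi_module R P" and i: "i \<in> fi_morphisms R U P"
    using re by (auto simp: fi_right_exact_def)
  obtain p where p: "p \<in> kz_part n P 1" "kz_d n P p = kz_unit n P (i {0..<n} z)"
    using z(2) fi_J_koszul[OF P] by blast
  have "\<exists>y\<in>kz_part n U (0 + 1). kz_d n U y = kz_unit n U z"
    using ex p kz_map_unit[OF i U P, of n z]
    by (intro koszul_boundary_lift[OF re mono _ kz_unit_part[OF U z(1)]]) auto
  then show ?thesis using fi_J_koszul[OF U, of z n] z(1) by simp
qed

text \<open>Dimension shift: P has no higher Koszul homology, so a cycle of U bounds in P, and
  exactness for D moves the bounding chain into U.\<close>

lemma koszul_exact_syzygy:
  assumes re: "fi_right_exact R U i P q D" and mono: "fi_mono U i" and split: "fi_split R P"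
    and a: "1 \<le> a" and ex: "koszul_exact n D (a + 1)"
  shows "koszul_exact n U a"
  unfolding koszul_exact_def
proof (intro ballI impI)
  have U: "fi_module R U" and P: "fi_module R P" and i: "i \<in> fi_morphisms R U P"
    using re by (auto simp: fi_right_exact_def)
  fix z assume z: "z \<in> kz_part n U a" "kz_d n U z = \<zero>\<^bsub>kz n U\<^esub>"
  have "kz_d n P (kz_map n i z) = \<zero>\<^bsub>kz n P\<^esub>"
    using kz_d_natural[OF i U P kz_part_carrier[OF z(1) U]] z(2)
      add_homs_zero[OF kz_map_hom[OF i U P] kz_group[OF U] kz_group[OF P]] by simp
  from koszul_exactD[OF koszul_exact_split[OF P split a] kz_map_part[OF i U P z(1)] this]
  obtain p where "p \<in> kz_part n P (a + 1)" "kz_d n P p = kz_map n i z" by blast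
  then show "\<exists>y\<in>kz_part n U (a + 1). kz_d n U y = z"
    by (rule koszul_boundary_lift[OF re mono ex z(1)])
qed

section \<open>Homology computed on an arbitrary projective resolution\<close>

context
  fixes R :: "('a, 'x) ring_scheme" and V :: "('a, 'b) fi_mod"
    and P :: "nat \<Rightarrow> ('a, 'c) fi_mod" and d :: "nat \<Rightarrow> ('c, 'c) fi_map" and \<epsilon> :: "('c, 'b) fi_map"
  assumes V: "fi_module R V" and res: "fi_projective_resolution R P d \<epsilon> V"
begin

lemma resolution_facts:
  shows "fi_module R (P n)" "fi_split R (P n)" "d n \<in> fi_morphisms R (P (Suc n)) (P n)"
    "\<epsilon> \<in> fi_morphisms R (P 0) V" "fi_epi (P 0) V \<epsilon>" "fi_exact (P 1) (d 0) (P 0) \<epsilon> V"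
    "fi_exact (P (Suc (Suc n))) (d (Suc n)) (P (Suc n)) (d n) (P n)"
proof -
  have proj: "fi_projective R (P n)" using res by (simp add: fi_projective_resolution_def)
  then show "fi_module R (P n)" by (simp add: fi_projective_def)
  show "fi_split R (P n)" by (rule fi_projective_split[OF proj])
qed (use res in \<open>simp_all add: fi_projective_resolution_def\<close>)

definition syzygy_set :: "nat \<Rightarrow> nat set \<Rightarrow> 'c set" where
  "syzygy_set n = (case n of 0 \<Rightarrow> fi_kernel (P 0) V \<epsilon> | Suc m \<Rightarrow> fi_kernel (P (Suc m)) (P m) (d m))"

text \<open>Indexed by the projective that contains it: \<open>syzygy k\<close> is the (k+1)-st
  syzygy of V, so exactness for V in degree k + 1 + b becomes exactness for \<open>syzygy k\<close>
  in degree b.\<close>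

definition syzygy :: "nat \<Rightarrow> ('a, 'c) fi_mod" where
  "syzygy n = fi_sub (P n) (syzygy_set n)"

lemma syzygy_subobject: "fi_subobject R (P n) (syzygy_set n)"
  using V resolution_facts by (auto simp: syzygy_set_def intro!: fi_subobject_kernel split: nat.split)

lemma syzygy_module: "fi_module R (syzygy n)"
  unfolding syzygy_def by (rule fi_sub_module[OF resolution_facts(1) syzygy_subobject])

lemma image_syzygy_set: "finite X \<Longrightarrow> fi_image (P (Suc n)) (d n) X = syzygy_set n X"
  using resolution_facts(6) resolution_facts(7)
  by (cases n) (auto simp: syzygy_set_def fi_exact_def)

lemma differential_syzygy:
  "d n \<in> fi_morphisms R (P (Suc n)) (syzygy n)" "fi_epi (P (Suc n)) (syzygy n) (d n)"
proof -
  show "d n \<in> fi_morphisms R (P (Suc n)) (syzygy n)"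
    unfolding syzygy_def
    by (rule fi_corestrict[OF resolution_facts(3)])
       (use image_syzygy_set in \<open>auto simp: fi_image_def\<close>)
  show "fi_epi (P (Suc n)) (syzygy n) (d n)"
    using image_syzygy_set by (simp add: fi_epi_def syzygy_def)
qed

lemma syzygy_right_exact_0: "fi_right_exact R (syzygy 0) (\<lambda>X v. v) (P 0) \<epsilon> V"
  using fi_kernel_right_exact[OF resolution_facts(1) V resolution_facts(4,5)]
  by (simp add: syzygy_def syzygy_set_def)

lemma syzygy_right_exact_Suc:
  "fi_right_exact R (syzygy (Suc n)) (\<lambda>X v. v) (P (Suc n)) (d n) (syzygy n)"
proof -
  have "fi_kernel (P (Suc n)) (syzygy n) (d n) = fi_kernel (P (Suc n)) (P n) (d n)"
    by (auto simp: fi_kernel_def syzygy_def fun_eq_iff)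
  then have "syzygy (Suc n) = fi_sub (P (Suc n)) (fi_kernel (P (Suc n)) (syzygy n) (d n))"
    by (simp add: syzygy_def[of "Suc n"] syzygy_set_def)
  then show ?thesis
    using fi_kernel_right_exact[OF resolution_facts(1) syzygy_module differential_syzygy] by simp
qed

lemma koszul_exact_syzygy_iterate:
  "koszul_exact n V (int k + 1 + b) \<Longrightarrow> 1 \<le> b \<Longrightarrow> koszul_exact n (syzygy k) b"
proof (induction k arbitrary: b)
  case 0
  then show ?case
    by (intro koszul_exact_syzygy[OF syzygy_right_exact_0 fi_mono_incl resolution_facts(2)])
       (auto simp: add.commute)
next
  case (Suc k)
  have "koszul_exact n (syzygy k) (b + 1)" using Suc.prems by (intro Suc.IH) (auto simp: algebra_simps)
  then show ?case
    using Suc.prems(2)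
    by (intro koszul_exact_syzygy[OF syzygy_right_exact_Suc fi_mono_incl resolution_facts(2)])
qed

text \<open>Injectivity of F(\<open>syzygy k\<close>) -> F(\<open>P k\<close>). For k > 0 it is
  governed by H_1 of the preceding syzygy, that is, by H_{k+1}(V).\<close>

lemma syzygy_J:
  assumes "koszul_exact n V (int k + 1)" "z \<in> syzygy_set k {0..<n}" "z \<in> fi_J R (P k) {0..<n}"
  shows "z \<in> fi_J R (syzygy k) {0..<n}"
proof -
  have z: "z \<in> carrier (fi_obj (syzygy k) {0..<n})" using assms(2) by (simp add: syzygy_def)
  show ?thesis
  proof (cases k)
    case 0
    then show ?thesis
      using fi_J_kernel[OF syzygy_right_exact_0 fi_mono_incl, of n z] assms z by simp
  next
    case (Suc m)
    have "koszul_exact n (syzygy m) 1"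
      by (rule koszul_exact_syzygy_iterate) (use assms(1) Suc in \<open>auto simp: add.commute\<close>)
    then show ?thesis
      using fi_J_kernel[OF syzygy_right_exact_Suc fi_mono_incl, of n m z] assms z Suc by simp
  qed
qed

text \<open>A chain whose differential dies in F(\<open>P k\<close>) can be corrected by a
  decomposable chain to a true cycle: the differential is decomposable already in
  \<open>syzygy k\<close>, and decomposables lift along the epimorphism from
  \<open>P (Suc k)\<close>.\<close>

lemma differential_J:
  assumes ex: "koszul_exact (card X) V (int k + 1)" and X: "finite X"
    and x: "x \<in> carrier (fi_obj (P (Suc k)) X)" "d k X x \<in> fi_J R (P k) X"
  shows "\<exists>j\<in>fi_J R (P (Suc k)) X. d k X j = d k X x"
proof -
  let ?n = "card X"
  interpret Q: fi_module R "P (Suc k)" by (rule resolution_facts)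
  interpret Pk: fi_module R "P k" by (rule resolution_facts)
  note dm = resolution_facts(3)[of k]
  \<comment> \<open>X is replaced by an initial segment, on which the Koszul complex is defined, and
    the result is carried back along g.\<close>
  obtain f g where f: "f \<in> fi_hom X {0..<?n}" and g: "g \<in> fi_hom {0..<?n} X"
    and gf: "compose X g f = (\<lambda>x\<in>X. x)"
    by (rule ex_fi_iso[of X "{0..<?n}"]) (use X in auto)
  have n: "finite {0..<?n}" by simp
  let ?x = "fi_act (P (Suc k)) X {0..<?n} f x"
  have xc: "?x \<in> carrier (fi_obj (P (Suc k)) {0..<?n})" by (rule Q.act_closed[OF X n f x(1)])
  have dx: "d k {0..<?n} ?x = fi_act (P k) X {0..<?n} f (d k X x)"
    by (rule fi_morphisms_natural[OF dm X n f x(1)])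
  have "d k {0..<?n} ?x \<in> fi_J R (syzygy k) {0..<?n}"
  proof (rule syzygy_J[OF ex])
    show "d k {0..<?n} ?x \<in> syzygy_set k {0..<?n}"
      unfolding image_syzygy_set[OF n, symmetric] fi_image_def using xc by blast
    show "d k {0..<?n} ?x \<in> fi_J R (P k) {0..<?n}"
      unfolding dx by (rule fi_subobject_act[OF fi_J_subobject[OF resolution_facts(1)] X n f x(2)])
  qed
  from fi_J_epi[OF resolution_facts(1) syzygy_module differential_syzygy n this]
  obtain j where j: "j \<in> fi_J R (P (Suc k)) {0..<?n}" "d k {0..<?n} j = d k {0..<?n} ?x" by blast
  let ?j = "fi_act (P (Suc k)) {0..<?n} X g j"
  have "?j \<in> fi_J R (P (Suc k)) X"
    by (rule fi_subobject_act[OF fi_J_subobject[OF resolution_facts(1)] n X g j(1)])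
  moreover have "d k X ?j = d k X x"
  proof -
    have jc: "j \<in> carrier (fi_obj (P (Suc k)) {0..<?n})"
      by (rule fi_J_carrier[OF resolution_facts(1) n j(1)])
    have dxc: "d k X x \<in> carrier (fi_obj (P k) X)" by (rule fi_morphisms_closed[OF dm X x(1)])
    show ?thesis
      using fi_morphisms_natural[OF dm n X g jc] j(2) dx Pk.act_compose[OF X n X f g dxc] gf
        Pk.act_id[OF X dxc] by simp
  qed
  ultimately show ?thesis by blast
qed

lemma fi_F_obj: "fi_obj (fi_F R W) X = quot_module (fi_obj W X) (fi_J R W X)"
  by (simp add: fi_F_def)

lemma fi_F_map_morphism: "fi_F_map R (P n) (d n) \<in> fi_morphisms R (fi_F R (P (Suc n))) (fi_F R (P n))"
  unfolding fi_F_def fi_F_map_def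
  by (rule fi_quot_map[OF resolution_facts(1) fi_J_subobject[OF resolution_facts(1)] resolution_facts(1)
        fi_J_subobject[OF resolution_facts(1)] resolution_facts(3)
        fi_J_morphism[OF resolution_facts(1) resolution_facts(1) resolution_facts(3)]])

text \<open>A cycle x of the complex of F(\<open>P n\<close>) is corrected by a decomposable j to a
  cycle x - j of the resolution itself. That is a boundary by exactness, and j disappears in
  F.\<close>

lemma resolution_homology_vanishes:
  assumes ex: "koszul_exact (card X) V (int (Suc k))" and X: "finite X"
  shows "carrier (fi_obj (fi_complex_homology (\<lambda>n. fi_F R (P n)) (\<lambda>n. fi_F_map R (P n) (d n)) (Suc k)) X)
    = {\<zero>\<^bsub>fi_obj (fi_complex_homology (\<lambda>n. fi_F R (P n)) (\<lambda>n. fi_F_map R (P n) (d n)) (Suc k)) X\<^esub>}"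
proof -
  note res_mod = resolution_facts(1)
  let ?M = "fi_obj (P (Suc k)) X" and ?J = "fi_J R (P (Suc k)) X"
  have M: "Module.module R ?M" by (rule fi_module.obj_module[OF res_mod X])
  have J: "submodule ?J R ?M" by (rule fi_J_submodule[OF res_mod X])
  have M0: "Module.module R (fi_obj (P k) X)" by (rule fi_module.obj_module[OF res_mod X])
  have J0: "submodule (fi_J R (P k) X) R (fi_obj (P k) X)" by (rule fi_J_submodule[OF res_mod X])
  have M2: "Module.module R (fi_obj (P (Suc (Suc k))) X)" by (rule fi_module.obj_module[OF res_mod X])
  have J2: "submodule (fi_J R (P (Suc (Suc k))) X) R (fi_obj (P (Suc (Suc k))) X)"
    by (rule fi_J_submodule[OF res_mod X])
  interpret M: Module.module R ?M by (rule M)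
  interpret M0: Module.module R "fi_obj (P k) X" by (rule M0)
  let ?F = "quot_module ?M ?J"
  have F: "Module.module R ?F" by (rule quot_module_module[OF M J])
  let ?N = "fi_image (fi_F R (P (Suc (Suc k)))) (fi_F_map R (P (Suc k)) (d (Suc k))) X"
  let ?K = "fi_kernel (fi_F R (P (Suc k))) (fi_F R (P k)) (fi_F_map R (P k) (d k)) X"
  have FV: "fi_module R (fi_F R (P n))" for n
    unfolding fi_F_def by (rule fi_quot_module[OF res_mod fi_J_subobject[OF res_mod]])
  have N: "submodule ?N R ?F"
    using fi_subobject_submodule[OF fi_subobject_image[OF fi_F_map_morphism FV FV] X]
    by (simp add: fi_F_obj)
  note Nf = submodule_facts[OF F N]
  have dm: "d k X \<in> add_homs ?M (fi_obj (P k) X)" by (rule fi_morphisms_hom[OF resolution_facts(3) X])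
  have KN: "x \<in> ?N" if x: "x \<in> ?K" for x
  proof -
    have "x \<in> carrier ?F" using x by (simp add: fi_kernel_def fi_F_obj)
    then obtain x0 where x0: "x0 \<in> carrier ?M" "x = coset_rep ?M ?J x0" by auto
    have xM: "x \<in> carrier ?M" and xx: "coset_rep ?M ?J x = x"
      unfolding x0(2) by (rule coset_rep_closed[OF M J x0(1)] coset_rep_idem[OF M J x0(1)])+
    have dx: "d k X x \<in> carrier (fi_obj (P k) X)" by (rule add_homs_closed[OF dm xM])
    have "coset_rep (fi_obj (P k) X) (fi_J R (P k) X) (d k X x) = \<zero>\<^bsub>quot_module (fi_obj (P k) X) (fi_J R (P k) X)\<^esub>"
      using x by (simp add: fi_kernel_def fi_F_map_def fi_F_obj)
    then have "d k X x \<in> fi_J R (P k) X" using coset_rep_zero_iff[OF M0 J0 dx] by blast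
    then obtain j where j: "j \<in> ?J" "d k X j = d k X x"
      using differential_J[OF _ X xM] ex by (auto simp: add.commute)
    have jM: "j \<in> carrier ?M" by (rule submodule_facts(1)[OF M J j(1)])
    let ?y = "x \<oplus>\<^bsub>?M\<^esub> \<ominus>\<^bsub>?M\<^esub> j"
    have "d k X ?y = \<zero>\<^bsub>fi_obj (P k) X\<^esub>"
      using add_homs_add[OF dm xM M.a_inv_closed[OF jM]]
        add_homs_neg[OF dm M.abelian_group_axioms M0.abelian_group_axioms jM] j(2) dx
      by (simp add: M0.r_neg)
    moreover have "?y \<in> carrier ?M" using xM jM by simp
    ultimately obtain y where y: "y \<in> carrier (fi_obj (P (Suc (Suc k))) X)" "d (Suc k) X y = ?y"
      using fi_exactD[OF resolution_facts(7) X] by blast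
    let ?c = "coset_rep (fi_obj (P (Suc (Suc k))) X) (fi_J R (P (Suc (Suc k))) X)"
    have "coset_rep ?M ?J (d (Suc k) X (?c y)) = coset_rep ?M ?J (d (Suc k) X y)"
      by (rule coset_rep_hom[OF M2 J2 M J fi_morphisms_hom[OF resolution_facts(3) X] _ y(1)])
         (rule fi_J_morphism[OF res_mod res_mod resolution_facts(3) X])
    also have "\<dots> = coset_rep ?M ?J x"
      unfolding y(2) using xM jM j(1) coset_rep_eq_iff[OF M J, of ?y x] submodule_facts(4)[OF M J j(1)]
      by (simp add: M.a_comm[of x] M.a_assoc M.r_neg)
    finally have "fi_F_map R (P (Suc k)) (d (Suc k)) X (?c y) = x"
      by (simp add: fi_F_map_def xx)
    moreover have "?c y \<in> carrier (fi_obj (fi_F R (P (Suc (Suc k)))) X)"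
      using y(1) by (simp add: fi_F_obj)
    ultimately show ?thesis unfolding fi_image_def by (intro image_eqI[of _ _ "?c y"]) simp_all
  qed
  \<comment> \<open>Cosets depend only on addition, which the kernel \<open>?K\<close> shares with
    \<open>?F\<close>, so representatives may be computed in \<open>?F\<close>.\<close>
  have rep: "coset_rep (?F\<lparr>carrier := ?K\<rparr>) ?N x = coset_rep (?F\<lparr>carrier := ?K\<rparr>) ?N \<zero>\<^bsub>?F\<^esub>" if x: "x \<in> ?K" for x
  proof -
    interpret F: Module.module R ?F by (rule F)
    have "coset_rep (?F\<lparr>carrier := ?K\<rparr>) ?N = coset_rep ?F ?N"
      by (simp add: coset_rep_def a_r_coset_def' fun_eq_iff)
    moreover have "coset_rep ?F ?N x = coset_rep ?F ?N \<zero>\<^bsub>?F\<^esub>"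
      using coset_rep_zero_iff[OF F N Nf(1)[OF KN[OF x]]] KN[OF x] by simp
    ultimately show ?thesis by simp
  qed
  have "submodule ?K R ?F"
    using fi_subobject_submodule[OF fi_subobject_kernel[OF fi_F_map_morphism FV FV] X]
    by (simp add: fi_F_obj)
  then have "\<zero>\<^bsub>?F\<^esub> \<in> ?K" by (rule submodule_facts(2)[OF F])
  with rep have "coset_rep (?F\<lparr>carrier := ?K\<rparr>) ?N ` ?K = {coset_rep (?F\<lparr>carrier := ?K\<rparr>) ?N \<zero>\<^bsub>?F\<^esub>}"
    by blast
  then show ?thesis by (simp add: fi_complex_homology_def fi_F_obj)
qed

text \<open>A preimage x of v agrees with some d y up to decomposables, and
  \<open>\<epsilon>\<close> kills d y; so v is the image of a decomposable element.\<close>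

lemma resolution_homology_0:
  assumes X: "finite X" and v: "v \<in> carrier (fi_obj V X)"
    and z: "carrier (fi_obj (fi_complex_homology (\<lambda>n. fi_F R (P n)) (\<lambda>n. fi_F_map R (P n) (d n)) 0) X)
      = {\<zero>\<^bsub>fi_obj (fi_complex_homology (\<lambda>n. fi_F R (P n)) (\<lambda>n. fi_F_map R (P n) (d n)) 0) X\<^esub>}"
  shows "v \<in> fi_J R V X"
proof -
  note res_mod = resolution_facts(1)
  let ?M = "fi_obj (P 0) X" and ?J = "fi_J R (P 0) X"
  have M: "Module.module R ?M" by (rule fi_module.obj_module[OF res_mod X])
  have J: "submodule ?J R ?M" by (rule fi_J_submodule[OF res_mod X])
  have M1: "Module.module R (fi_obj (P 1) X)" by (rule fi_module.obj_module[OF res_mod X])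
  have J1: "submodule (fi_J R (P 1) X) R (fi_obj (P 1) X)" by (rule fi_J_submodule[OF res_mod X])
  interpret M: Module.module R ?M by (rule M)
  interpret VX: Module.module R "fi_obj V X" by (rule fi_module.obj_module[OF V X])
  let ?F = "quot_module ?M ?J"
  have F: "Module.module R ?F" by (rule quot_module_module[OF M J])
  let ?N = "fi_image (fi_F R (P 1)) (fi_F_map R (P 0) (d 0)) X"
  have FV: "fi_module R (fi_F R (P n))" for n
    unfolding fi_F_def by (rule fi_quot_module[OF res_mod fi_J_subobject[OF res_mod]])
  have N: "submodule ?N R ?F"
    using fi_subobject_submodule[OF fi_subobject_image[OF fi_F_map_morphism FV FV] X, of 0]
    by (simp add: fi_F_obj)
  obtain x where x: "x \<in> carrier ?M" "\<epsilon> X x = v" using fi_epiD[OF resolution_facts(5) X v] by blast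
  have xF: "coset_rep ?M ?J x \<in> carrier ?F" using x(1) by simp
  have "coset_rep ?F ?N (coset_rep ?M ?J x) \<in> carrier (quot_module ?F ?N)"
    unfolding quot_module_simps(1)[of ?F] using xF by (rule imageI)
  then have "coset_rep ?F ?N (coset_rep ?M ?J x) = \<zero>\<^bsub>quot_module ?F ?N\<^esub>"
    using z by (simp add: fi_complex_homology_def fi_F_obj del: quot_module_simps)
  then have "coset_rep ?M ?J x \<in> ?N" using coset_rep_zero_iff[OF F N xF] by blast
  then obtain y where y: "y \<in> carrier (fi_obj (fi_F R (P 1)) X)"
    "coset_rep ?M ?J x = coset_rep ?M ?J (d 0 X y)"
    by (auto simp: fi_image_def fi_F_map_def)
  have yc: "y \<in> carrier (fi_obj (P 1) X)" using y(1) coset_rep_closed[OF M1 J1] by (auto simp: fi_F_obj)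
  have dy: "d 0 X y \<in> carrier ?M" using fi_morphisms_closed[OF resolution_facts(3)[of 0] X] yc by simp
  have j: "x \<oplus>\<^bsub>?M\<^esub> \<ominus>\<^bsub>?M\<^esub> d 0 X y \<in> ?J" using coset_rep_eq_iff[OF M J x(1) dy] y(2) by blast
  note em = fi_morphisms_hom[OF resolution_facts(4) X]
  have "\<epsilon> X (x \<oplus>\<^bsub>?M\<^esub> \<ominus>\<^bsub>?M\<^esub> d 0 X y) = v \<oplus>\<^bsub>fi_obj V X\<^esub> \<ominus>\<^bsub>fi_obj V X\<^esub> \<epsilon> X (d 0 X y)"
    using add_homs_add[OF em x(1) M.a_inv_closed[OF dy]] x(2)
      add_homs_neg[OF em M.abelian_group_axioms VX.abelian_group_axioms dy] by simp
  also have "\<epsilon> X (d 0 X y) = \<zero>\<^bsub>fi_obj V X\<^esub>" by (rule fi_exact_zero[OF resolution_facts(6) X yc])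
  finally have "\<epsilon> X (x \<oplus>\<^bsub>?M\<^esub> \<ominus>\<^bsub>?M\<^esub> d 0 X y) = v" using v VX.neg_zero by (simp only: VX.r_zero)
  then show ?thesis using fi_J_morphism[OF res_mod V resolution_facts(4) X j] by simp
qed

end

text \<open>Each \<open>K (Suc n)\<close> is the kernel of the free cover of \<open>K n\<close>.
  Neither covers nor kernels change the element type, so the whole resolution stays in the universe
  over the element type of V.\<close>

lemma ex_projective_resolution:
  fixes V :: "('a, 'b) fi_mod"
  assumes V: "fi_module R V"
  shows "\<exists>(P :: nat \<Rightarrow> ('a, ('a, 'b) fi_univ) fi_mod) d \<epsilon>. fi_projective_resolution R P d \<epsilon> V"
proof -
  interpret V: fi_module R V by fact
  note R = V.cring_axioms
  interpret E: fi_encoding R V "Elt :: 'b \<Rightarrow> ('a, 'b) fi_univ" by (rule fi_Elt_encoding[OF V])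
  define K where "K = rec_nat (fi_copy Elt V :: ('a, ('a, 'b) fi_univ) fi_mod)
    (\<lambda>n K. fi_sub (fi_cover R K) (fi_kernel (fi_cover R K) K (fi_cover_map R K)))"
  have K0: "K 0 = fi_copy Elt V"
    and KS: "K (Suc n) = fi_sub (fi_cover R (K n)) (fi_kernel (fi_cover R (K n)) (K n) (fi_cover_map R (K n)))" for n
    by (simp_all add: K_def)
  have K: "fi_module R (K n)" for n
  proof (induction n)
    case 0
    show ?case unfolding K0 by (rule E.copy_module)
  next
    case (Suc n)
    show ?case unfolding KS
      by (intro fi_sub_module fi_cover_module R fi_subobject_kernel fi_cover_map_morphism Suc)
  qed
  let ?P = "\<lambda>n. fi_cover R (K n)" and ?d = "\<lambda>n. fi_cover_map R (K (Suc n))"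
    and ?e = "\<lambda>X t. E.decode X (fi_cover_map R (K 0) X t)"
  note P = fi_cover_module[OF R]
  have ker: "fi_subobject R (?P n) (fi_kernel (?P n) (K n) (fi_cover_map R (K n)))" for n
    by (rule fi_subobject_kernel[OF fi_cover_map_morphism[OF K] P K])
  have d: "?d n \<in> fi_morphisms R (?P (Suc n)) (?P n)" for n
  proof -
    have "(\<lambda>X v. v) \<in> fi_morphisms R (K (Suc n)) (?P n)" unfolding KS by (rule fi_sub_incl[OF P ker])
    from fi_morphisms_comp[OF fi_cover_map_morphism[OF K] this] show ?thesis .
  qed
  have img: "fi_image (?P (Suc n)) (?d n) X = fi_kernel (?P n) (K n) (fi_cover_map R (K n)) X"
    if "finite X" for n X
    using fi_cover_map_epi[OF K[of "Suc n"]] that by (simp add: fi_epi_def KS[of n])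
  have e: "?e \<in> fi_morphisms R (?P 0) V"
    using fi_morphisms_comp[OF fi_cover_map_morphism[OF K[of 0]]] E.decode_morphism by (simp add: K0)
  have epi: "fi_epi (?P 0) V ?e"
    unfolding fi_epi_def
  proof (intro allI impI equalityI)
    fix X :: "nat set" assume X: "finite X"
    show "fi_image (?P 0) ?e X \<subseteq> carrier (fi_obj V X)"
      using fi_morphisms_closed[OF e X] by (auto simp: fi_image_def)
    show "carrier (fi_obj V X) \<subseteq> fi_image (?P 0) ?e X"
    proof
      fix v assume v: "v \<in> carrier (fi_obj V X)"
      then have "Elt v \<in> carrier (fi_obj (K 0) X)" by (simp add: K0 E.copy_simps)
      from fi_epiD[OF fi_cover_map_epi[OF K] X this] obtain t
        where "t \<in> carrier (fi_obj (?P 0) X)" "fi_cover_map R (K 0) X t = Elt v" by blast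
      then show "v \<in> fi_image (?P 0) ?e X" using v X unfolding fi_image_def
        by (intro image_eqI[of _ _ t]) simp_all
    qed
  qed
  have ex0: "fi_exact (?P 1) (?d 0) (?P 0) ?e V"
    unfolding fi_exact_def
  proof (intro allI impI)
    fix X :: "nat set" assume X: "finite X"
    have "E.decode X t = \<zero>\<^bsub>fi_obj V X\<^esub> \<longleftrightarrow> t = \<zero>\<^bsub>fi_obj (K 0) X\<^esub>" if "t \<in> carrier (fi_obj (K 0) X)" for t
      using E.encode_decode[OF X, of t] that fi_morphisms_zero[OF E.decode_morphism E.copy_module V X]
      unfolding K0 by (metis E.copy_simps(2))
    then have "fi_kernel (?P 0) V ?e X = fi_kernel (?P 0) (K 0) (fi_cover_map R (K 0)) X"
      using fi_morphisms_closed[OF fi_cover_map_morphism[OF K] X] by (auto simp: fi_kernel_def)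
    then show "fi_image (?P 1) (?d 0) X = fi_kernel (?P 0) V ?e X" using img[OF X, of 0] by simp
  qed
  have "fi_exact (?P (Suc (Suc n))) (?d (Suc n)) (?P (Suc n)) (?d n) (?P n)" for n
    unfolding fi_exact_def
  proof (intro allI impI)
    fix X :: "nat set" assume X: "finite X"
    have "fi_kernel (?P (Suc n)) (?P n) (?d n) X = fi_kernel (?P (Suc n)) (K (Suc n)) (fi_cover_map R (K (Suc n))) X"
      by (simp add: fi_kernel_def KS[of n])
    then show "fi_image (?P (Suc (Suc n))) (?d (Suc n)) X = fi_kernel (?P (Suc n)) (?P n) (?d n) X"
      using img[OF X, of "Suc n"] by simp
  qed
  then have "fi_projective_resolution R ?P ?d ?e V"
    using d e epi ex0 by (simp add: fi_projective_resolution_def fi_cover_projective[OF R])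
  then show ?thesis by blast
qed

lemma fi_homology_eq:
  fixes V :: "('a, 'b) fi_mod"
  assumes V: "fi_module R V"
  obtains P :: "nat \<Rightarrow> ('a, ('a, 'b) fi_univ) fi_mod" and d \<epsilon> where "fi_projective_resolution R P d \<epsilon> V"
    "\<And>a. fi_homology R a V = fi_complex_homology (\<lambda>n. fi_F R (P n)) (\<lambda>n. fi_F_map R (P n) (d n)) a"
proof -
  define c where "c = (SOME (P :: nat \<Rightarrow> ('a, ('a, 'b) fi_univ) fi_mod, d, \<epsilon>). fi_projective_resolution R P d \<epsilon> V)"
  have "\<exists>c :: (nat \<Rightarrow> ('a, ('a, 'b) fi_univ) fi_mod) \<times> _ \<times> _. case c of (P, d, \<epsilon>) \<Rightarrow> fi_projective_resolution R P d \<epsilon> V"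
    using ex_projective_resolution[OF V] by auto
  then have c: "case c of (P, d, \<epsilon>) \<Rightarrow> fi_projective_resolution R P d \<epsilon> V"
    unfolding c_def by (rule someI_ex)
  obtain P d \<epsilon> where eq: "c = (P, d, \<epsilon>)" by (cases c)
  have "fi_homology R a V = fi_complex_homology (\<lambda>n. fi_F R (P n)) (\<lambda>n. fi_F_map R (P n) (d n)) a" for a
    unfolding fi_homology_def c_def[symmetric] eq by simp
  with c eq show ?thesis by (intro that[of P d \<epsilon>]) auto
qed

section \<open>Degrees of homology and torsion\<close>

lemma fi_deg_le_iff:
  "fi_deg V \<le> x \<longleftrightarrow> (\<forall>n. carrier (fi_obj V {1..n}) \<noteq> {\<zero>\<^bsub>fi_obj V {1..n}\<^esub>} \<longrightarrow> ereal (real n) \<le> x)"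
  unfolding fi_deg_def by (auto simp: Sup_le_iff)

lemma fi_hd_le:
  fixes V :: "('a, 'b) fi_mod"
  assumes V: "fi_module R V"
    and ex: "\<And>n. \<not> ereal (real n) \<le> x \<Longrightarrow> koszul_exact n V (int (Suc k))"
  shows "fi_hd R (Suc k) V \<le> x"
  unfolding fi_hd_def fi_deg_le_iff
proof (intro allI impI, rule ccontr)
  fix n assume nz: "carrier (fi_obj (fi_homology R (Suc k) V) {1..n}) \<noteq> {\<zero>\<^bsub>fi_obj (fi_homology R (Suc k) V) {1..n}\<^esub>}"
    and n: "\<not> ereal (real n) \<le> x"
  obtain P :: "nat \<Rightarrow> ('a, ('a, 'b) fi_univ) fi_mod" and d \<epsilon> where res: "fi_projective_resolution R P d \<epsilon> V"
    and H: "\<And>a. fi_homology R a V = fi_complex_homology (\<lambda>n. fi_F R (P n)) (\<lambda>n. fi_F_map R (P n) (d n)) a"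
    by (rule fi_homology_eq[OF V]) (rule that)
  have "koszul_exact (card {1..n}) V (int (Suc k))" using ex[OF n] by simp
  from resolution_homology_vanishes[OF V res this]
  have "carrier (fi_obj (fi_homology R (Suc k) V) {1..n}) = {\<zero>\<^bsub>fi_obj (fi_homology R (Suc k) V) {1..n}\<^esub>}"
    unfolding H by simp
  with nz show False by simp
qed

lemma fi_generatedD:
  fixes V :: "('a, 'b) fi_mod"
  assumes V: "fi_module R V" and gen: "fi_generated_in_degree_le R k V" and n: "k < n"
  shows "carrier (fi_obj V {0..<n}) \<subseteq> fi_J R V {0..<n}"
proof
  interpret V: fi_module R V by fact
  obtain P :: "nat \<Rightarrow> ('a, ('a, 'b) fi_univ) fi_mod" and d \<epsilon> where res: "fi_projective_resolution R P d \<epsilon> V"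
    and H: "\<And>a. fi_homology R a V = fi_complex_homology (\<lambda>n. fi_F R (P n)) (\<lambda>n. fi_F_map R (P n) (d n)) a"
    by (rule fi_homology_eq[OF V]) (rule that)
  have "carrier (fi_obj (fi_homology R 0 V) {1..n}) = {\<zero>\<^bsub>fi_obj (fi_homology R 0 V) {1..n}\<^esub>}"
    using gen n unfolding fi_generated_in_degree_le_def fi_hd_def fi_deg_le_iff by force
  then have J: "v \<in> fi_J R V {1..n}" if "v \<in> carrier (fi_obj V {1..n})" for v
    using resolution_homology_0[OF V res _ that] unfolding H by simp
  fix v assume v: "v \<in> carrier (fi_obj V {0..<n})"
  obtain f g where f: "f \<in> fi_hom {0..<n} {1..n}" and g: "g \<in> fi_hom {1..n} {0..<n}"
    and gf: "compose {0..<n} g f = (\<lambda>x\<in>{0..<n}. x)"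
    by (rule ex_fi_iso[of "{0..<n}" "{1..n}"]) auto
  have "fi_act V {1..n} {0..<n} g (fi_act V {0..<n} {1..n} f v) \<in> fi_J R V {0..<n}"
    by (rule fi_subobject_act[OF fi_J_subobject[OF V] _ _ g J[OF V.act_closed[OF _ _ f v]]]) auto
  then show "v \<in> fi_J R V {0..<n}"
    using V.act_compose[OF _ _ _ f g v] gf V.act_id[OF _ v] by simp
qed

text \<open>An injection into a set with one more element misses a point, hence is the inclusion by
  an added point followed by a bijection. Thus being killed by one such injection is being killed by
  all.\<close>

lemma fi_torsion_iff:
  assumes "fi_module R V"
  shows "(\<exists>v\<in>carrier (fi_obj V {1..n}). v \<noteq> \<zero>\<^bsub>fi_obj V {1..n}\<^esub> \<and>
      (\<forall>f\<in>fi_hom {1..n} {1..n+1}. fi_act V {1..n} {1..n+1} f v = \<zero>\<^bsub>fi_obj V {1..n+1}\<^esub>))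
    \<longleftrightarrow> \<not> iota_inj V n"
proof
  interpret fi_module R V by fact
  let ?A = "{0..<n}" and ?A' = "{0..<Suc n}" and ?B = "{1..n}" and ?B' = "{1..n+1}"
  have fin: "finite ?A" "finite ?A'" "finite ?B" "finite ?B'" by simp_all
  have s: "succ_map ?A \<in> fi_hom ?A ?A'" using succ_map_fi_hom[of ?A] by simp
  obtain f g where f: "f \<in> fi_hom ?A ?B" and g: "g \<in> fi_hom ?B ?A"
    and gf: "compose ?A g f = (\<lambda>x\<in>?A. x)" and fg: "compose ?B f g = (\<lambda>x\<in>?B. x)"
    by (rule ex_fi_iso[of ?A ?B]) auto
  obtain h h' where h: "h \<in> fi_hom ?A' ?B'" and h': "h' \<in> fi_hom ?B' ?A'"
    and h'h: "compose ?A' h' h = (\<lambda>x\<in>?A'. x)"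
    by (rule ex_fi_iso[of ?A' ?B']) auto
  {
    assume "\<exists>v\<in>carrier (fi_obj V ?B). v \<noteq> \<zero>\<^bsub>fi_obj V ?B\<^esub> \<and>
      (\<forall>f\<in>fi_hom ?B ?B'. fi_act V ?B ?B' f v = \<zero>\<^bsub>fi_obj V ?B'\<^esub>)"
    then obtain v where v: "v \<in> carrier (fi_obj V ?B)" "v \<noteq> \<zero>\<^bsub>fi_obj V ?B\<^esub>"
      and tor: "\<And>f. f \<in> fi_hom ?B ?B' \<Longrightarrow> fi_act V ?B ?B' f v = \<zero>\<^bsub>fi_obj V ?B'\<^esub>" by blast
    let ?v = "fi_act V ?B ?A g v"
    have vc: "?v \<in> carrier (fi_obj V ?A)" by (rule act_closed[OF fin(3,1) g v(1)])
    have ic: "fi_act V ?A ?A' (succ_map ?A) ?v \<in> carrier (fi_obj V ?A')" by (rule act_closed[OF fin(1,2) s vc])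
    have "fi_act V ?A' ?B' h (fi_act V ?A ?A' (succ_map ?A) ?v) = \<zero>\<^bsub>fi_obj V ?B'\<^esub>"
      using tor[OF fi_hom_compose[OF fi_hom_compose[OF g s] h]]
        act_compose[OF fin(3,1,2) g s v(1)] act_compose[OF fin(3,2,4) fi_hom_compose[OF g s] h v(1)]
      by simp
    then have "fi_act V ?A ?A' (succ_map ?A) ?v = \<zero>\<^bsub>fi_obj V ?A'\<^esub>"
      using act_compose[OF fin(2,4,2) h h' ic] h'h act_id[OF fin(2) ic] act_zero[OF fin(4,2) h'] by simp
    moreover have "?v \<noteq> \<zero>\<^bsub>fi_obj V ?A\<^esub>"
    proof
      assume "?v = \<zero>\<^bsub>fi_obj V ?A\<^esub>"
      then have "v = \<zero>\<^bsub>fi_obj V ?B\<^esub>"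
        using act_compose[OF fin(3,1,3) g f v(1)] fg act_id[OF fin(3) v(1)] act_zero[OF fin(1,3) f] by simp
      with v(2) show False by simp
    qed
    ultimately show "\<not> iota_inj V n" using vc by (auto simp: iota_inj_def fi_iota_def)
  next
    assume "\<not> iota_inj V n"
    then obtain v where v: "v \<in> carrier (fi_obj V ?A)" "v \<noteq> \<zero>\<^bsub>fi_obj V ?A\<^esub>"
      and iv: "fi_act V ?A ?A' (succ_map ?A) v = \<zero>\<^bsub>fi_obj V ?A'\<^esub>"
      by (auto simp: iota_inj_def fi_iota_def)
    let ?v = "fi_act V ?A ?B f v"
    have vc: "?v \<in> carrier (fi_obj V ?B)" by (rule act_closed[OF fin(1,3) f v(1)])
    have nz: "?v \<noteq> \<zero>\<^bsub>fi_obj V ?B\<^esub>"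
    proof
      assume "?v = \<zero>\<^bsub>fi_obj V ?B\<^esub>"
      then have "v = \<zero>\<^bsub>fi_obj V ?A\<^esub>"
        using act_compose[OF fin(1,3,1) f g v(1)] gf act_id[OF fin(1) v(1)] act_zero[OF fin(3,1) g] by simp
      with v(2) show False by simp
    qed
    have "fi_act V ?B ?B' F ?v = \<zero>\<^bsub>fi_obj V ?B'\<^esub>" if F: "F \<in> fi_hom ?B ?B'" for F
    proof -
      define G where "G = compose ?A F f"
      have G: "G \<in> fi_hom ?A ?B'" unfolding G_def by (rule fi_hom_compose[OF f F])
      have "card (G ` ?A) = n" using card_image[OF fi_hom_inj[OF G]] by simp
      then have "G ` ?A \<noteq> ?B'" by auto
      moreover have "G ` ?A \<subseteq> ?B'" using fi_hom_mem[OF G] by blast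
      ultimately obtain c where c: "c \<in> ?B'" "c \<notin> G ` ?A" by blast
      \<comment> \<open>The bijection extending G that sends the added point to the missed point
        c.\<close>
      let ?S = "\<lambda>x\<in>?A'. case x of 0 \<Rightarrow> c | Suc y \<Rightarrow> G y"
      have S: "?S \<in> fi_hom ?A' ?B'"
      proof (rule fi_homI)
        fix x assume "x \<in> ?A'"
        then show "(case x of 0 \<Rightarrow> c | Suc y \<Rightarrow> G y) \<in> ?B'"
          using c(1) fi_hom_mem[OF G, of "x - 1"] by (cases x) auto
      next
        show "inj_on (\<lambda>x. case x of 0 \<Rightarrow> c | Suc y \<Rightarrow> G y) ?A'"
        proof (rule inj_onI)
          fix x y assume *: "x \<in> ?A'" "y \<in> ?A'"
            "(case x of 0 \<Rightarrow> c | Suc y \<Rightarrow> G y) = (case y of 0 \<Rightarrow> c | Suc y \<Rightarrow> G y)"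
          have "G u \<noteq> c" if "u \<in> ?A" for u using c(2) that by blast
          moreover have "u = v" if "G u = G v" "u \<in> ?A" "v \<in> ?A" for u v
            by (rule inj_onD[OF fi_hom_inj[OF G] that])
          ultimately show "x = y" using * by (cases x; cases y) (auto simp: eq_commute[of c])
        qed
      qed
      have "compose ?A ?S (succ_map ?A) = G"
        by (rule fi_hom_eqI[OF fi_hom_compose[OF s S] G]) (simp add: compose_def)
      then have "fi_act V ?A ?B' G v = \<zero>\<^bsub>fi_obj V ?B'\<^esub>"
        using act_compose[OF fin(1,2,4) s S v(1)] iv act_zero[OF fin(2,4) S] by simp
      then show ?thesis using act_compose[OF fin(1,3,4) f F v(1)] by (simp add: G_def)
    qed
    with vc nz show "\<exists>v\<in>carrier (fi_obj V ?B). v \<noteq> \<zero>\<^bsub>fi_obj V ?B\<^esub> \<and>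
      (\<forall>f\<in>fi_hom ?B ?B'. fi_act V ?B ?B' f v = \<zero>\<^bsub>fi_obj V ?B'\<^esub>)" by blast
  }
qed

lemma fi_td_le_iff:
  assumes "fi_module R V"
  shows "fi_td V \<le> x \<longleftrightarrow> (\<forall>n. \<not> iota_inj V n \<longrightarrow> ereal (real n) \<le> x)"
  unfolding fi_td_def fi_torsion_iff[OF assms] by (auto simp: Sup_le_iff)

lemma ereal_add_le:
  assumes "x \<le> ereal (b - c)" shows "x + ereal c \<le> ereal b"
  using add_right_mono[OF assms, of "ereal c"] by simp

lemma ereal_diff_one_le:
  assumes "x \<le> ereal b" shows "x - 1 \<le> ereal (b - 1)"
  using ereal_minus_mono[OF assms order_refl, of 1] by (simp add: one_ereal_def)

theorem theorem9:
  fixes R :: "('a, 'x) ring_scheme"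
    and V :: "('a, 'v) fi_mod" and P :: "('a, 'p) fi_mod" and W :: "('a, 'w) fi_mod"
    and \<phi> :: "('w, 'p) fi_map" and \<psi> :: "('p, 'v) fi_map"
    and k d :: nat
  assumes "cring R" and "fi_module R V"
    and "fi_presentation R k d W \<phi> P \<psi> V"
  shows "fi_td V \<le> ereal (real (min k d) + real d - 1) \<and>
    fi_reg R V \<le> max (fi_hd1_D R k V - 1) (fi_td_D k V) \<and>
    max (fi_hd1_D R k V - 1) (fi_td_D k V) \<le> ereal (real (min k d) + real d - 1) \<and>
    fi_reg R V \<le> ereal (real (min k d) + real d - 1)"
proof -
  let ?b = "min (int k) (int d) + int d - 1"
  let ?B = "ereal (real (min k d) + real d - 1)"
  have B: "?B = ereal (real_of_int ?b)" by simp
  have V: "fi_module R V" and W: "fi_module R W" and P: "fi_module R P"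
    and re: "fi_right_exact R W \<phi> P \<psi> V" and proj: "fi_projective R P"
    and \<psi>: "\<psi> \<in> fi_morphisms R P V" "fi_epi P V \<psi>"
    and Pgen: "fi_generated_in_degree_le R k P" and Wgen: "fi_generated_in_degree_le R d W"
    using assms by (auto simp: fi_presentation_def fi_short_exact_def fi_right_exact_def)
  \<comment> \<open>Decomposability of all elements passes from P to its quotient V.\<close>
  have V0: "koszul_exact n V 0" if n: "k < n" for n
  proof (rule koszul_exact_generated[OF V], rule subsetI)
    fix v assume "v \<in> carrier (fi_obj V {0..<n})"
    then obtain p where p: "p \<in> carrier (fi_obj P {0..<n})" "\<psi> {0..<n} p = v"
      using fi_epiD[OF \<psi>(2), of "{0..<n}"] by auto
    then have "p \<in> fi_J R P {0..<n}" using fi_generatedD[OF P Pgen n] by blast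
    from fi_J_morphism[OF P V \<psi>(1) _ this] p(2) show "v \<in> fi_J R V {0..<n}" by simp
  qed
  \<comment> \<open>P is acyclic and W is generated in degree at most d, so H_1(V) vanishes above
    d.\<close>
  have V1: "koszul_exact n V 1" if n: "d < n" for n
    by (rule koszul_exact_one[OF re koszul_exact_generated[OF W fi_generatedD[OF W Wgen n]]
          koszul_exact_split[OF P fi_projective_split[OF proj] order_refl]])
  let ?D = "\<lambda>i. (fi_deriv ^^ i) V"
  note D = fi_deriv_funpow_module[OF V]
  have D1: "koszul_exact n (?D i) 1" if "d < n + i" for n i
    using that by (intro koszul_exact_deriv_funpow[OF V _ V1]) auto
  \<comment> \<open>The i-th derivative has degree of generation k - i, hence
    \<open>g = Suc (k - i)\<close>, and relation bound d - i. Its torsion bound is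
    \<open>?b - 2 * i\<close>, which is below the required \<open>?b - i\<close>, unless d < i, when
    there is no torsion at all.\<close>
  have inj: "iota_inj (?D i) n" if i: "i \<le> k" and n: "?b < int n + int i" for i n
  proof -
    have "(\<forall>n. int d - int i < 0 \<or> min (int (Suc (k - i)) - 1) (int d - int i) + (int d - int i) - 1 < int n
        \<longrightarrow> iota_inj (?D i) n)"
    proof (rule torsion_regularity_bound[OF D, THEN conjunct1])
      show "koszul_exact m (?D i) 0" if "Suc (k - i) \<le> m" for m
        using that i by (intro koszul_exact_deriv_funpow[OF V _ V0]) auto
      show "koszul_exact m (?D i) 1" if "int d - int i < int m" for m
        using that by (intro D1) linarith
    qed
    then show ?thesis using n i by (auto simp: of_nat_diff)
  qed
  have td: "fi_td (?D i) + ereal (real i) \<le> ?B" if i: "i \<le> k" for i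
  proof -
    have "ereal (real n) \<le> ereal (real_of_int ?b - real i)" if "\<not> iota_inj (?D i) n" for n
    proof -
      have "int n + int i \<le> ?b" using inj[OF i, of n] that by linarith
      then show ?thesis unfolding ereal_less_eq by linarith
    qed
    then have "fi_td (?D i) \<le> ereal (real_of_int ?b - real i)" by (simp add: fi_td_le_iff[OF D])
    then show ?thesis unfolding B by (rule ereal_add_le)
  qed
  have hd: "fi_hd R 1 (?D i) + ereal (real i) \<le> ereal (real d)" for i
  proof (rule ereal_add_le)
    have "koszul_exact n (?D i) (int (Suc 0))" if "\<not> ereal (real n) \<le> ereal (real d - real i)" for n
      using that D1[of n i] by (simp add: of_nat_less_iff[symmetric] del: of_nat_less_iff)
    then have "fi_hd R (Suc 0) (?D i) \<le> ereal (real d - real i)" by (rule fi_hd_le[OF D])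
    then show "fi_hd R 1 (?D i) \<le> ereal (real d - real i)" by simp
  qed
  have td_D: "fi_td_D k V \<le> ?B"
    unfolding fi_td_D_def using td by (subst Max_le_iff) auto
  have "fi_hd1_D R k V \<le> ereal (real d)"
    unfolding fi_hd1_D_def using hd by (subst Max_le_iff) auto
  then have "fi_hd1_D R k V - 1 \<le> ereal (real d - 1)" by (rule ereal_diff_one_le)
  also have "\<dots> \<le> ?B" by simp
  finally have hd_D: "fi_hd1_D R k V - 1 \<le> ?B" .
  have td_i: "fi_td (?D i) + ereal (real i) \<le> fi_td_D k V" if "i \<le> k" for i
    unfolding fi_td_D_def using that by (intro Max_ge) auto
  \<comment> \<open>Torsion degrees are integers, so a strict bound by c + 1 acts like a bound by c;
    it allows c to be a floor without showing that a finite \<open>fi_td_D\<close> is an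
    integer.\<close>
  have reg_c: "fi_reg R V \<le> ereal (real_of_int c)" if c: "fi_td_D k V < ereal (real_of_int c + 1)" for c
  proof -
    have ic: "iota_inj (?D i) n" if i: "i < Suc k" and n: "c - int i < int n" for i n
    proof (rule ccontr)
      assume "\<not> iota_inj (?D i) n"
      then have "ereal (real n) \<le> fi_td (?D i)" using fi_td_le_iff[OF D] by blast
      then have "ereal (real n) + ereal (real i) \<le> fi_td (?D i) + ereal (real i)" by (rule add_right_mono)
      also have "\<dots> < ereal (real_of_int c + 1)" using td_i[of i] i c by (auto intro: le_less_trans)
      finally have "real n + real i < real_of_int c + 1" by simp
      with n show False by linarith
    qed
    have "fi_hd R a V \<le> ereal (real_of_int c + real a)" if a: "1 \<le> a" for a
    proof -
      obtain a' where a': "a = Suc a'" using a by (cases a) auto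
      show ?thesis unfolding a'
      proof (rule fi_hd_le[OF V])
        fix n assume "\<not> ereal (real n) \<le> ereal (real_of_int c + real (Suc a'))"
        then have n: "int (Suc a') + c < int n" unfolding ereal_less_eq by linarith
        \<comment> \<open>V is generated in degree at most k, so \<open>g = Suc k\<close> and the
          derivatives of order 0 to k are the ones that enter, as in \<open>fi_td_D\<close>.\<close>
        show "koszul_exact n V (int (Suc a'))"
          by (rule regularity_le_torsion[OF V, where g = "Suc k" and c = c, OF _ ic _ n])
             (simp_all add: V0 Suc_le_eq)
      qed
    qed
    then show ?thesis unfolding fi_reg_def by (intro Inf_lower) auto
  qed
  have reg: "fi_reg R V \<le> fi_td_D k V"
  proof (cases "fi_td_D k V")
    case (real t)
    have "fi_reg R V \<le> ereal (real_of_int \<lfloor>t\<rfloor>)" by (rule reg_c) (simp add: real)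
    also have "\<dots> \<le> ereal t" by simp
    finally show ?thesis using real by simp
  next
    \<comment> \<open>None of these derivatives has torsion, so every integer c is admissible and
      the infimum is minus infinity.\<close>
    case MInf
    have "fi_reg R V \<le> ereal y" for y
    proof -
      have "fi_reg R V \<le> ereal (real_of_int \<lfloor>y\<rfloor>)" by (rule reg_c) (simp add: MInf)
      also have "\<dots> \<le> ereal y" by simp
      finally show ?thesis .
    qed
    then have "fi_reg R V = - \<infinity>" by (rule ereal_bot)
    then show ?thesis by simp
  qed simp
  show ?thesis
    using td[of 0] reg td_D hd_D by (auto simp: zero_ereal_def[symmetric] intro: max.coboundedI2 order_trans)
qed

end
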